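(* Let $1<p<\infty$, $1<q\le\infty$, $0<\beta<1$ and $\Lambda\ge 41$. Assume that the measure $\mu$ is doubling and reverse doubling, and satisfies the quantitative reverse doubling condition for some exponent $\sigma>\beta p$. Then there exists a constant $C\ge 1$ such that for every ball $B=B(x,r)\subset X$ with $x\in X$ and $0<r<\frac{1}{80}\operatorname{diam}(X)$, and every compact set $E\subset\overline{B}$, $$C^{-1}\operatorname{Cap}^{\beta}_{p,q}(E)\le \operatorname{cap}_{\dot M^{\beta}_{p,q}}(E,2B,\Lambda B)\le C\operatorname{Cap}^{\beta}_{p,q}(E),$$ where $C$ is independent of $B$ and $E$.
   Context: Setting: $X=(X,d,\mu)$ is a metric space with at least two points, with a nonnegative complete Borel measure $\mu$ such that $0<\mu(B)<\infty$ for every open ball $B=B(x,r)=\{y\in X: d(y,x)<r\}$, $x\in X$, $r>0$. Balls come with a fixed centre and radius; $tB=B(x,tr)$ for $t>0$; $\overline{A}$ is the closure of $A$; $\mathbf 1_A$ is the characteristic function. The measure $\mu$ is doubling: there is $c_\mu>1$ with $\mu(2B)\le c_\mu\mu(B)$ for all balls $B$. Reverse doubling: there is $0<c_R<1$ with $\mu(B(x,r/2))\le c_R\,\mu(B(x,r))$ for all $x\in X$ and $0<r<\operatorname{diam}(X)/2$. Quantitative reverse doubling condition with exponent $\sigma>0$: there is a constant $c_\sigma>0$ with $\mu(B(x,r))/\mu(B(x,R))\le c_\sigma (r/R)^\sigma$ for all $x\in X$ and $0<r<R\le 2\operatorname{diam}(X)$. Index $n_0$: $n_0=-\infty$ if $\operatorname{diam}(X)=\infty$;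 otherwise $n_0$ is the smallest integer with $2^{-n_0}\le 2\operatorname{diam}(X)$. Sums and sequences over $n\ge n_0$ are over integers $n\ge n_0$. Mixed norms: for a sequence $g=(g_k)$ of measurable functions on an open set $\Omega$ (indexed by $\mathbb Z$ or by $n\ge n_0$), $\|g\|_{L^p(\Omega;l^q)}=\big\|\,\|(g_k)_k\|_{l^q}\,\big\|_{L^p(\Omega)}$, where $\|(g_k)\|_{l^q}=(\sum_k|g_k|^q)^{1/q}$ for $q<\infty$ and $\sup_k|g_k|$ for $q=\infty$. Fractional Hajłasz gradients: for a measurable $u:\Omega\to\mathbb R$ on an open set $\Omega\subset X$, $\mathbb D^\beta_\Omega(u)$ is the set of sequences $g=(g_k)_{k\in\mathbb Z}$ of nonnegative measurable functions for which there is $N\subset\Omega$ with $\mu(N)=0$ such that $|u(x)-u(y)|\le d(x,y)^\beta(g_k(x)+g_k(y))$ whenever $k\in\mathbb Z$, $x,y\in\Omega\setminus N$ and $2^{-k-1}\le d(x,y)<2^{-k}$. Put $|u|_{\dot M^\beta_{p,q}(\Omega)}=\inf_{g\in\mathbb D^\beta_\Omega(u)}\|g\|_{L^p(\Omega;l^q)}$. Relative capacity: for a ball $B$, a closed set $E\subset\overline B$ and $\Lambda\ge2$, $\operatorname{cap}_{\dot M^{\beta}_{p,q}}(E,2B,\Lambda B)=\inf_\varphi|\varphi|^p_{\dot M^\beta_{p,q}(\Lambda B)}$, the infimum over all continuous $\varphi:X\to\mathbb R$ with $\varphi\ge1$ on $E$ and $\varphi=0$ on $X\setminus 2B$. Potential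 capacity: for a sequence $f=(f_n)_{n\ge n_0}$ of nonnegative Borel functions in $X$ let $$\mathcal H_\beta f(x)=\sum_{n=n_0}^\infty 2^{-\beta n}\int_X\frac{\mathbf 1_{B(y,2^{-n})}(x)}{\mu(B(y,2^{-n}))}f_n(y)\,d\mu(y),\qquad x\in X.$$ Then $\operatorname{Cap}^\beta_{p,q}(E)=\inf\|f\|^p_{L^p(X;l^q)}$ over all such sequences $f$ with $\mathcal H_\beta f(x)\ge 1$ for all $x\in E$. *)

theory Defs
  imports "HOL-Analysis.Analysis"
begin

(* Complete means that all subsets of null sets are measurable.  The sigma-algebra may be larger
   than the completion of the Borel sigma-algebra. *)
locale metric_measure_space = complete_measure M
  for M :: "'a::metric_space measure" +
  assumes two_points: "\<exists>x y::'a. x \<noteq> y"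
    and space_eq: "space M = UNIV"
    and borel_subset: "sets borel \<subseteq> sets M"
    and ball_pos: "\<And>x r. 0 < r \<Longrightarrow> 0 < emeasure M (ball x r)"
    and ball_finite: "\<And>x r. 0 < r \<Longrightarrow> emeasure M (ball x r) < \<infinity>"

(* Unlike the library's real-valued diameter, this is infinite for unbounded sets. *)
definition ediam :: "'a::metric_space set \<Rightarrow> ennreal" where
  "ediam S = (SUP x\<in>S. SUP y\<in>S. ennreal (dist x y))"

definition doubling :: "'a::metric_space measure \<Rightarrow> bool" where
  "doubling M \<longleftrightarrow>
     (\<exists>c>1::real. \<forall>x. \<forall>r>0. emeasure M (ball x (2 * r)) \<le> ennreal c * emeasure M (ball x r))"

definition reverse_doubling :: "'a::metric_space measure \<Rightarrow> bool" where
  "reverse_doubling M \<longleftrightarrow>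
     (\<exists>c::real. 0 < c \<and> c < 1 \<and>
        (\<forall>x r. 0 < r \<and> ennreal r < ediam (UNIV :: 'a set) / 2 \<longrightarrow>
           emeasure M (ball x (r / 2)) \<le> ennreal c * emeasure M (ball x r)))"

definition quantitative_reverse_doubling :: "'a::metric_space measure \<Rightarrow> real \<Rightarrow> bool" where
  "quantitative_reverse_doubling M \<sigma> \<longleftrightarrow>
     (\<exists>c>0::real. \<forall>x r R. 0 < r \<and> r < R \<and> ennreal R \<le> 2 * ediam (UNIV :: 'a set) \<longrightarrow>
        emeasure M (ball x r) / emeasure M (ball x R) \<le> ennreal (c * (r / R) powr \<sigma>))"

(* The integers n with n >= n_0, where n_0 is minus infinity if the space is unbounded. *)
definition levels :: "'a::metric_space set \<Rightarrow> int set" where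
  "levels X =
     (if ediam X = \<infinity> then UNIV
      else {(LEAST n::int. ennreal (2 powi (- n)) \<le> 2 * ediam X)..})"

(* Real powers of extended nonnegative numbers; only used with exponents a > 0. *)
definition ennpowr :: "ennreal \<Rightarrow> real \<Rightarrow> ennreal" where
  "ennpowr t a = (if t = \<infinity> then \<infinity> else ennreal (enn2real t powr a))"

definition lq_norm :: "int set \<Rightarrow> ennreal \<Rightarrow> (int \<Rightarrow> ennreal) \<Rightarrow> ennreal" where
  "lq_norm I q a =
     (if q = \<infinity> then (SUP k\<in>I. a k)
      else ennpowr (\<Sum>\<^sub>\<infinity>k\<in>I. ennpowr (a k) (enn2real q)) (1 / enn2real q))"

definition mixed_norm ::
    "'a measure \<Rightarrow> 'a set \<Rightarrow> int set \<Rightarrow> real \<Rightarrow> ennreal \<Rightarrow> (int \<Rightarrow> 'a \<Rightarrow> ennreal) \<Rightarrow> ennreal" where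
  "mixed_norm M \<Omega> I p q g =
     ennpowr (\<integral>\<^sup>+x. ennpowr (lq_norm I q (\<lambda>k. g k x)) p \<partial>restrict_space M \<Omega>) (1 / p)"

(* Functions on Omega are total functions of which only the values on Omega matter. *)
definition hajlasz_gradients ::
    "'a::metric_space measure \<Rightarrow> real \<Rightarrow> 'a set \<Rightarrow> ('a \<Rightarrow> real) \<Rightarrow> (int \<Rightarrow> 'a \<Rightarrow> ennreal) set" where
  "hajlasz_gradients M \<beta> \<Omega> u =
     {g. (\<forall>k. g k \<in> borel_measurable (restrict_space M \<Omega>)) \<and>
         (\<exists>N\<in>null_sets M. N \<subseteq> \<Omega> \<and>
            (\<forall>k. \<forall>x\<in>\<Omega> - N. \<forall>y\<in>\<Omega> - N.
               2 powi (- k - 1) \<le> dist x y \<and> dist x y < 2 powi (- k) \<longrightarrow>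
               ennreal \<bar>u x - u y\<bar> \<le> ennreal (dist x y powr \<beta>) * (g k x + g k y)))}"

definition hajlasz_seminorm ::
    "'a::metric_space measure \<Rightarrow> real \<Rightarrow> real \<Rightarrow> ennreal \<Rightarrow> 'a set \<Rightarrow> ('a \<Rightarrow> real) \<Rightarrow> ennreal" where
  "hajlasz_seminorm M \<beta> p q \<Omega> u =
     (INF g\<in>hajlasz_gradients M \<beta> \<Omega> u. mixed_norm M \<Omega> UNIV p q g)"

(* Here U and Omega stand for the balls 2B and Lambda B; a ball as a set need not determine
   its centre and radius. *)
definition relative_capacity ::
    "'a::metric_space measure \<Rightarrow> real \<Rightarrow> real \<Rightarrow> ennreal \<Rightarrow> 'a set \<Rightarrow> 'a set \<Rightarrow> 'a set \<Rightarrow> ennreal" where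
  "relative_capacity M \<beta> p q E U \<Omega> =
     (INF \<phi>\<in>{\<phi>::'a \<Rightarrow> real. continuous_on UNIV \<phi> \<and> (\<forall>x\<in>E. 1 \<le> \<phi> x) \<and> (\<forall>x\<in>- U. \<phi> x = 0)}.
        ennpowr (hajlasz_seminorm M \<beta> p q \<Omega> \<phi>) p)"

definition potential ::
    "'a::metric_space measure \<Rightarrow> real \<Rightarrow> (int \<Rightarrow> 'a \<Rightarrow> ennreal) \<Rightarrow> 'a \<Rightarrow> ennreal" where
  "potential M \<beta> f x =
     (\<Sum>\<^sub>\<infinity>n\<in>levels (UNIV :: 'a set). ennreal (2 powr (- \<beta> * real_of_int n)) *
        (\<integral>\<^sup>+y. indicator (ball y (2 powi (- n))) x / emeasure M (ball y (2 powi (- n))) * f n y \<partial>M))"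

definition potential_capacity ::
    "'a::metric_space measure \<Rightarrow> real \<Rightarrow> real \<Rightarrow> ennreal \<Rightarrow> 'a set \<Rightarrow> ennreal" where
  "potential_capacity M \<beta> p q E =
     (INF f\<in>{f. (\<forall>n\<in>levels (UNIV :: 'a set). f n \<in> borel_measurable borel) \<and>
                (\<forall>x\<in>E. 1 \<le> potential M \<beta> f x)}.
        ennpowr (mixed_norm M UNIV (levels (UNIV :: 'a set)) p q f) p)"

end

theory Submission
  imports Defs
begin

text \<open>
Write \<open>ball_avg M r h\<close> for the mean of \<open>h\<close> over balls of radius \<open>r\<close>. Both inequalities rest on the
vector-valued bound
\<open>\<integral> ennpowr (lq_norm UNIV q (\<lambda>n. ball_avg M (R * 2 powi (- n)) (h n) x)) p \<le> K * \<integral> ennpowr (lq_norm UNIV q (\<lambda>n. h n x)) p\<close>.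
It needs no covering theorem: on \<open>L\<^sup>s\<close> with \<open>s \<ge> 1\<close>, sums of averages at different scales are controlled by a
telescoping and duality argument, the scalar maximal inequality follows by linearization and duality, and Hoelder's
inequality then gives all \<open>p\<close> and \<open>q\<close>.

Given an admissible \<open>f\<close> for the potential capacity of \<open>E\<close>, the quantitative reverse doubling condition
with \<open>\<sigma> > \<beta> p\<close> bounds the contribution of the scales larger than \<open>r\<close>. If this contribution is large
somewhere on \<open>E\<close>, the norm of \<open>f\<close> dominates the capacity of the whole ball. Otherwise the small scales suffice; after
cutting off \<open>f\<close> near \<open>B\<close>, replacing the kernels by Lipschitz ones and keeping finitely many scales (compactness), their
potential is a continuous test function supported in \<open>2B\<close>, with a gradient given by dyadic convolutions of averages of \<open>f\<close>.

Conversely, for a test function \<open>\<phi>\<close> with gradient \<open>g\<close>, telescoping the means of \<open>\<phi>\<close> over the balls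
\<open>ball x (2 powi (- n))\<close>, starting from a part of \<open>4B - 2B\<close> where \<open>\<phi>\<close> vanishes, shows that averages of dyadic
convolutions of \<open>g\<close> are admissible for the potential capacity. These averages are Borel functions although \<open>g\<close> is only
measurable with respect to \<open>M\<close>.
\<close>

section \<open>Powers of extended nonnegative reals\<close>

text \<open>The averaging inequalities are proved by absorption: Young's inequality leaves half of
  the quantity to be bounded on the right, and this half can be removed only if it is finite. Hence
  finite sets of scales are treated before all scales, with a crude bound depending on their number
  that serves for finiteness alone. The condition \<sigma> > \<beta> p enters in one place. By
  Hoelder's inequality a scale n coarser than m contributes at most a multiple of 2^(-\<beta> n)
  times the p-th root of the integral of f^p over the volume of a ball of radius 2^(-n); volume
  growth turns this into 2^(-\<beta> m) times 2^(-(\<sigma>/p - \<beta>)(m - n)), which is summable.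
  The condition 0 < \<beta> < 1 is what makes the gradient a dyadic convolution: at distances about
  2^(-k) coarse scales are controlled by their Lipschitz constants, fine ones by their size.
  Admissibility for the potential capacity is required at every point of E, not almost everywhere.
  This is why the telescoping over shrinking balls ends, after finitely many steps, by continuity of
  \<phi> at the given point.\<close>

lemma ennpowr_ennreal: "0 \<le> t \<Longrightarrow> ennpowr (ennreal t) a = ennreal (t powr a)"
  by (simp add: ennpowr_def)

lemma ennpowr_top [simp]: "ennpowr top a = top"
  by (simp add: ennpowr_def)

lemma ennpowr_0 [simp]: "ennpowr 0 a = 0"
  by (simp add: ennpowr_def)

lemma ennpowr_1 [simp]: "ennpowr 1 a = 1"
  by (simp add: ennpowr_def)

lemma ennpowr_one [simp]: "ennpowr t 1 = t"
  by (cases t) (simp_all add: ennpowr_ennreal)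

lemma ennpowr_eq_0_iff [simp]: "ennpowr t a = 0 \<longleftrightarrow> t = 0"
  by (cases t) (auto simp: ennpowr_ennreal)

lemma ennpowr_eq_top_iff [simp]: "ennpowr t a = top \<longleftrightarrow> t = top"
  by (cases t) (auto simp: ennpowr_ennreal)

lemma ennpowr_mono: "s \<le> t \<Longrightarrow> 0 \<le> a \<Longrightarrow> ennpowr s a \<le> ennpowr t a"
  by (cases s; cases t) (auto simp: ennpowr_ennreal powr_mono2 top_unique)

text \<open>Zero goes to zero and \<open>top\<close> to \<open>top\<close> for every exponent, also
  for 0 and negative ones. With 0 * \<open>top\<close> = 0 this makes the rules for products and for
  sums of exponents hold without sign conditions, so that a negative exponent such as
  \<open>p - t\<close> can be used below.\<close>

lemma ennpowr_mult: "ennpowr (s * t) a = ennpowr s a * ennpowr t a"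
proof (cases "s = 0 \<or> t = 0 \<or> s = top \<or> t = top")
  case True
  then show ?thesis by (auto simp: ennreal_mult_top ennreal_top_mult)
next
  case False
  then obtain s' t' where "s = ennreal s'" "0 \<le> s'" "t = ennreal t'" "0 \<le> t'"
    by (metis ennreal_cases)
  then show ?thesis
    by (simp add: ennpowr_ennreal powr_mult flip: ennreal_mult)
qed

lemma ennpowr_ennpowr: "ennpowr (ennpowr t a) b = ennpowr t (a * b)"
  by (cases t) (simp_all add: ennpowr_ennreal powr_powr)

lemma ennpowr_add: "ennpowr t a * ennpowr t b = ennpowr t (a + b)"
  by (cases t) (simp_all add: ennpowr_ennreal powr_add flip: ennreal_mult)

lemma ennpowr_Suc: "t * ennpowr t a = ennpowr t (a + 1)"
  using ennpowr_add[of t 1 a] by (simp add: add.commute)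

lemma ennpowr_inverse_cancel [simp]:
  "a \<noteq> 0 \<Longrightarrow> ennpowr (ennpowr t (1 / a)) a = t"
  "a \<noteq> 0 \<Longrightarrow> ennpowr (ennpowr t a) (1 / a) = t"
  by (simp_all add: ennpowr_ennpowr)

text \<open>For a > 0 the power is increasing and has an increasing inverse, the power 1 / a, so it
  preserves suprema.\<close>

lemma ennpowr_SUP:
  assumes "0 < a"
  shows "ennpowr (SUP i\<in>I. f i) a = (SUP i\<in>I. ennpowr (f i) a)"
proof (rule antisym)
  have "f i \<le> ennpowr (SUP i\<in>I. ennpowr (f i) a) (1 / a)" if "i \<in> I" for i
  proof -
    have "ennpowr (ennpowr (f i) a) (1 / a) \<le> ennpowr (SUP i\<in>I. ennpowr (f i) a) (1 / a)"
      using assms that by (intro ennpowr_mono SUP_upper) auto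
    then show ?thesis using assms by simp
  qed
  then have "ennpowr (SUP i\<in>I. f i) a \<le> ennpowr (ennpowr (SUP i\<in>I. ennpowr (f i) a) (1 / a)) a"
    using assms by (intro ennpowr_mono SUP_least) auto
  then show "ennpowr (SUP i\<in>I. f i) a \<le> (SUP i\<in>I. ennpowr (f i) a)"
    using assms by simp
qed (use assms in \<open>auto intro!: SUP_least ennpowr_mono SUP_upper\<close>)

lemma borel_measurable_ennpowr [measurable (raw)]:
  assumes [measurable]: "f \<in> borel_measurable M"
  shows "(\<lambda>x. ennpowr (f x) a) \<in> borel_measurable M"
proof -
  have [measurable]: "(\<lambda>x. ennreal (enn2real (f x) powr a)) \<in> borel_measurable M"
    by measurable
  show ?thesis
    unfolding ennpowr_def by measurable
qed

lemma ennreal_cancel_factor: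
  "0 < l \<Longrightarrow> ennreal (inverse l) * (ennreal l * t) = t"
  by (simp add: mult.assoc[symmetric] flip: ennreal_mult)

lemma ennreal_le_mult_swap:
  assumes "0 < l" "ennreal (inverse l) * s \<le> t" shows "s \<le> ennreal l * t"
proof -
  have "ennreal l * (ennreal (inverse l) * s) \<le> ennreal l * t"
    using assms by (intro mult_left_mono) auto
  then show ?thesis
    using ennreal_cancel_factor[of "inverse l" s] assms by simp
qed

text \<open>Young's inequality up to a constant: compare \<open>T\<close> with \<open>G / \<epsilon>\<close>.\<close>
lemma young_ennpowr:
  assumes "0 < \<epsilon>" "1 \<le> s"
  shows "G * ennpowr T (s - 1) \<le>
    ennreal (\<epsilon> powr (1 - s)) * ennpowr G s + ennreal \<epsilon> * ennpowr T s"
proof (cases "ennreal \<epsilon> * T \<le> G")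
  case True
  have "ennreal (inverse (inverse \<epsilon>)) * T \<le> G" using True by simp
  then have "T \<le> ennreal (inverse \<epsilon>) * G"
    using assms by (intro ennreal_le_mult_swap) auto
  then have "ennpowr T (s - 1) \<le> ennpowr (ennreal (inverse \<epsilon>)) (s - 1) * ennpowr G (s - 1)"
    using assms by (metis ennpowr_mono ennpowr_mult diff_ge_0_iff_ge)
  also have "ennpowr (ennreal (inverse \<epsilon>)) (s - 1) = ennreal (\<epsilon> powr (1 - s))"
    using assms by (simp add: ennpowr_ennreal inverse_powr flip: powr_minus)
  finally have "G * ennpowr T (s - 1) \<le> ennreal (\<epsilon> powr (1 - s)) * (G * ennpowr G (s - 1))"
    by (metis mult.left_commute mult_left_mono zero_le)
  then show ?thesis
    by (simp add: ennpowr_Suc add_increasing2)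
next
  case False
  then have "G * ennpowr T (s - 1) \<le> (ennreal \<epsilon> * T) * ennpowr T (s - 1)"
    by (intro mult_right_mono) auto
  also have "\<dots> = ennreal \<epsilon> * ennpowr T s"
    by (simp add: mult.assoc ennpowr_Suc)
  finally show ?thesis
    by (simp add: add_increasing)
qed

text \<open>The product is at most the larger of X and Y raised to the total exponent. Replacing
  this maximum by a sum keeps the bound additive under the integral.\<close>

lemma ennpowr_geometric_mean_le:
  assumes "0 \<le> a" "0 \<le> b" "0 < a + b"
  shows "ennpowr X a * ennpowr Y b \<le> ennpowr X (a + b) + ennpowr Y (a + b)"
proof (cases "X \<le> Y")
  case True
  then have "ennpowr X a * ennpowr Y b \<le> ennpowr Y a * ennpowr Y b"
    using assms by (intro mult_right_mono ennpowr_mono) auto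
  then show ?thesis by (simp add: ennpowr_add add_increasing)
next
  case False
  then have "ennpowr X a * ennpowr Y b \<le> ennpowr X a * ennpowr X b"
    using assms by (intro mult_left_mono ennpowr_mono) auto
  then show ?thesis by (simp add: ennpowr_add add_increasing2)
qed

text \<open>Convexity of the s-th power: an increment is at most its length times the derivative at
  the right end.\<close>

lemma ennpowr_add_step:
  assumes "1 \<le> s"
  shows "ennpowr (S + a) s \<le> ennpowr S s + ennreal s * (a * ennpowr (S + a) (s - 1))"
proof (cases "a = top \<or> S = top")
  case True
  then show ?thesis using assms by (auto simp: ennreal_mult_top)
next
  case False
  then obtain a' S' where *: "a = ennreal a'" "0 \<le> a'" "S = ennreal S'" "0 \<le> S'"
    by (metis ennreal_cases)
  have "(S' + a') powr s \<le> S' powr s + s * (a' * (S' + a') powr (s - 1))"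
  proof (cases "a' = 0")
    case False
    then have a': "0 < a'" using * by simp
    define T where "T = S' + a'"
    have T: "0 < T" using a' * by (simp add: T_def)
    \<comment> \<open>By homogeneity, division by T^s leaves Bernoulli's inequality 1 + s (x - 1)
      \<le> x^s at x = S' / T; the mean value theorem gives it on either side of 1.\<close>
    have "1 + s * (S' / T - 1) \<le> (S' / T) powr s"
    proof (cases "S' = 0")
      case True
      then show ?thesis using assms by simp
    next
      case False
      then have "0 < S' / T" using * T by simp
      define x where "x = S' / T"
      have x: "0 < x" using \<open>0 < S' / T\<close> by (simp add: x_def)
      have "1 * (x powr s - 1) \<ge> s * (x - 1)"
      proof -
        have *: "((\<lambda>y. y powr s) has_real_derivative s * y powr (s - 1)) (at y)" if "0 < y" for y
          using that by (auto intro!: derivative_eq_intros)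
        consider "x < 1" | "x = 1" | "1 < x" by linarith
        then show ?thesis
        proof cases
          case 1
          have "\<exists>z>x. z < 1 \<and> 1 powr s - x powr s = (1 - x) * (s * z powr (s - 1))"
            using x by (intro MVT2[OF 1] *) auto
          then obtain z where z: "x < z" "z < 1" "1 powr s - x powr s = (1 - x) * (s * z powr (s - 1))"
            by blast
          have "z powr (s - 1) \<le> 1"
            using z x assms by (intro powr_le1) auto
          then have "(1 - x) * (s * z powr (s - 1)) \<le> (1 - x) * (s * 1)"
            using 1 assms by (intro mult_left_mono) auto
          with z show ?thesis by (simp add: algebra_simps)
        next
          case 3
          have "\<exists>z>1. z < x \<and> x powr s - 1 powr s = (x - 1) * (s * z powr (s - 1))"
            using x by (intro MVT2[OF 3] *) auto
          then obtain z where z: "1 < z" "z < x" "x powr s - 1 powr s = (x - 1) * (s * z powr (s - 1))"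
            by blast
          have "1 \<le> z powr (s - 1)"
            using z assms by (intro ge_one_powr_ge_zero) auto
          then have "(x - 1) * (s * z powr (s - 1)) \<ge> (x - 1) * (s * 1)"
            using 3 assms by (intro mult_left_mono) auto
          with z show ?thesis by (simp add: algebra_simps)
        qed simp
      qed
      then show ?thesis by (simp add: x_def)
    qed
    then have "(1 + s * (S' / T - 1)) * T powr s \<le> (S' / T) powr s * T powr s"
      by (intro mult_right_mono) auto
    also have "(S' / T) powr s * T powr s = S' powr s"
      using T * by (simp flip: powr_mult)
    also have "(1 + s * (S' / T - 1)) * T powr s = T powr s - s * (a' * T powr (s - 1))"
    proof -
      have "S' / T - 1 = - a' / T" using T by (simp add: T_def field_simps)
      then have "1 + s * (S' / T - 1) = 1 - s * (a' / T)" by simp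
      moreover have "T powr (s - 1) = T powr s / T" using T by (simp add: powr_diff)
      ultimately show ?thesis by (simp only:) (simp add: algebra_simps)
    qed
    finally show ?thesis by (simp add: T_def)
  qed simp
  then have "ennreal ((S' + a') powr s) \<le> ennreal (S' powr s + s * (a' * (S' + a') powr (s - 1)))"
    by (rule ennreal_leI)
  also have "\<dots> = ennreal (S' powr s) + ennreal s * (ennreal a' * ennreal ((S' + a') powr (s - 1)))"
    using * assms by (simp add: ennreal_plus ennreal_mult)
  finally show ?thesis
    using * assms by (simp add: ennpowr_ennreal flip: ennreal_plus)
qed

lemma ennpowr_sum_le:
  fixes a :: "'i \<Rightarrow> ennreal"
  assumes "finite J" "0 \<le> s"
  shows "ennpowr (\<Sum>j\<in>J. a j) s \<le> ennpowr (of_nat (card J)) s * (\<Sum>j\<in>J. ennpowr (a j) s)"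
proof (cases "J = {}")
  case False
  have "Max (a ` J) \<in> a ` J" using assms False by (intro Max_in) auto
  then obtain j where j: "j \<in> J" "a j = Max (a ` J)" by auto
  have "sum a J \<le> of_nat (card J) * a j"
    using assms j by (intro sum_bounded_above) auto
  then have "ennpowr (sum a J) s \<le> ennpowr (of_nat (card J)) s * ennpowr (a j) s"
    using assms by (metis ennpowr_mono ennpowr_mult)
  also have "\<dots> \<le> ennpowr (of_nat (card J)) s * (\<Sum>j\<in>J. ennpowr (a j) s)"
    using assms j by (intro mult_left_mono member_le_sum) auto
  finally show ?thesis .
qed simp

text \<open>Finiteness of x is essential: for x = \<open>top\<close> the first assumption holds
  whatever y is. This is the reason for the a priori finiteness bounds below.\<close>

lemma ennreal_absorb:
  fixes x y :: ennreal
  assumes "x \<le> y + ennreal (1/2) * x" "x < top"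
  shows "x \<le> 2 * y"
proof (cases y)
  case (real y')
  obtain x' where x: "x = ennreal x'" "0 \<le> x'" using assms by (cases x) auto
  have "ennreal (y' + 1/2 * x') = ennreal y' + ennreal (1/2) * ennreal x'"
  proof -
    have "ennreal (1/2) * ennreal x' = ennreal (1/2 * x')"
      using x by (intro ennreal_mult[symmetric]) auto
    then show ?thesis using real x by (subst ennreal_plus) auto
  qed
  then have "ennreal x' \<le> ennreal (y' + 1/2 * x')"
    using assms(1) real x by simp
  then have "x' \<le> y' + 1/2 * x'"
    using real x by (subst (asm) ennreal_le_iff) auto
  then have "x' \<le> 2 * y'" by simp
  then have "ennreal x' \<le> ennreal (2 * y')" by (rule ennreal_leI)
  also have "\<dots> = 2 * ennreal y'" using real by (simp add: ennreal_mult)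
  finally show ?thesis using real x by simp
qed (simp add: ennreal_mult_top)

section \<open>Hoelder's inequality, by optimizing a linear bound\<close>

lemma hoelder_pointwise:
  assumes "1 < q" "0 < l" and le: "ennpowr f q \<le> ennpowr X (q - 1) * w"
  shows "f \<le> ennreal l * X + ennreal (l powr (1 - q)) * w"
proof (cases "f \<le> ennreal l * X")
  case False
  then have lt: "ennreal l * X < f" by simp
  then have X: "X \<noteq> top" using assms by (auto simp: ennreal_mult_top)
  show ?thesis
  proof (cases "f = top")
    case True
    then have "w = top"
      using le X by (auto simp: top_unique ennreal_mult_eq_top_iff)
    then show ?thesis using assms by (simp add: ennreal_mult_top)
  next
    case False
    \<comment> \<open>Since l X < f, the factor X^(q-1) in the hypothesis is at most l^(1-q)
      f^(q-1). Cancelling f^(q-1), which is neither 0 nor \<open>top\<close>, leaves f \<le> l^(1-q)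
      w.\<close>
    have *: "ennpowr X (q - 1) \<le> ennreal (l powr (1 - q)) * ennpowr f (q - 1)"
    proof -
      have "X \<le> ennreal (inverse l) * f"
        using lt assms by (intro ennreal_le_mult_swap) auto
      then have "ennpowr X (q - 1) \<le> ennpowr (ennreal (inverse l)) (q - 1) * ennpowr f (q - 1)"
        using assms by (metis ennpowr_mono ennpowr_mult diff_ge_0_iff_ge less_imp_le)
      also have "ennpowr (ennreal (inverse l)) (q - 1) = ennreal (l powr (1 - q))"
        using assms by (simp add: ennpowr_ennreal inverse_powr flip: powr_minus)
      finally show ?thesis .
    qed
    have f0: "f \<noteq> 0" using lt by auto
    have "f * ennpowr f (q - 1) \<le> (ennreal (l powr (1 - q)) * w) * ennpowr f (q - 1)"
    proof -
      have "f * ennpowr f (q - 1) = ennpowr f q" by (simp add: ennpowr_Suc)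
      also have "\<dots> \<le> (ennreal (l powr (1 - q)) * ennpowr f (q - 1)) * w"
        using le * by (meson mult_right_mono order_trans zero_le)
      finally show ?thesis by (simp add: mult_ac)
    qed
    then have "f \<le> ennreal (l powr (1 - q)) * w"
      using f0 False
      by (subst (asm) (1 2) mult.commute) (simp add: ennreal_mult_le_mult_iff)
    then show ?thesis by (simp add: add_increasing)
  qed
qed (simp add: add_increasing2)

text \<open>The choice l = (w / X)^(1/q) makes the two terms equal, each being the q-th root of
  X^(q-1) w. The factor 2 from adding them becomes 2^q.\<close>

lemma hoelder_optimize:
  assumes "1 < q" and le: "\<And>l. 0 < l \<Longrightarrow> x \<le> ennreal l * X + ennreal (l powr (1 - q)) * w"
    and X: "X \<noteq> 0" and w: "w \<noteq> 0"
  shows "ennpowr x q \<le> ennreal (2 powr q) * (ennpowr X (q - 1) * w)"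
proof (cases "X = top \<or> w = top")
  case True
  then show ?thesis using X w by (auto simp: ennreal_mult_top ennreal_top_mult)
next
  case False
  then obtain X' w' where *: "X = ennreal X'" "0 < X'" "w = ennreal w'" "0 < w'"
    using X w by (metis ennreal_cases ennreal_eq_0_iff linorder_not_le)
  define l where "l = (w' / X') powr (1 / q)"
  have l: "0 < l" using * by (simp add: l_def)
  have e1: "l * X' = (X' powr (q - 1) * w') powr (1 / q)"
  proof -
    have "(X' powr (q - 1) * w') powr (1 / q) = X' powr ((q - 1) / q) * w' powr (1 / q)"
      using * by (simp add: powr_mult powr_powr)
    also have "\<dots> = w' powr (1/q) * (X' powr (1 - 1 / q))"
      using assms by (simp add: diff_divide_distrib)
    also have "\<dots> = l * X'"
      using * by (simp add: l_def powr_divide powr_diff)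
    finally show ?thesis by simp
  qed
  have e2: "l powr (1 - q) * w' = l * X'"
  proof -
    have "l powr (1 - q) = l * (l powr (- q))"
      using l powr_add[of l 1 "- q"] by simp
    also have "l powr (- q) = X' / w'"
      using * assms by (simp add: l_def powr_powr powr_minus)
    finally show ?thesis using * by simp
  qed
  have "x \<le> ennreal (2 * (l * X'))"
  proof -
    have "x \<le> ennreal l * ennreal X' + ennreal (l powr (1 - q)) * ennreal w'"
      using le[OF l] * by simp
    also have "\<dots> = ennreal (l * X' + l powr (1 - q) * w')"
      using * l by (simp add: ennreal_mult'')
    finally show ?thesis by (simp only: e2 mult_2)
  qed
  then have "ennpowr x q \<le> ennpowr (ennreal (2 * (l * X'))) q"
    using assms by (rule_tac ennpowr_mono) auto
  also have "\<dots> = ennreal ((2 * (l * X')) powr q)"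
    using * l by (intro ennpowr_ennreal) auto
  also have "(2 * (l * X')) powr q = 2 powr q * (X' powr (q - 1) * w')"
    using * assms unfolding e1 by (subst powr_mult) (simp_all add: powr_powr)
  also have "ennreal \<dots> = ennreal (2 powr q) * (ennpowr X (q - 1) * w)"
    using * by (simp add: ennpowr_ennreal ennreal_mult)
  finally show ?thesis .
qed

text \<open>For fixed l the pointwise bound is linear in X and w, so it survives integration, and l
  is optimized only afterwards. Vanishing integrals are treated apart because the optimal l then
  degenerates.\<close>

lemma hoelder_nn_integral:
  assumes [measurable]: "f \<in> borel_measurable N" "X \<in> borel_measurable N" "w \<in> borel_measurable N"
    and q: "1 < q" and le: "AE y in N. ennpowr (f y) q \<le> ennpowr (X y) (q - 1) * w y"
  shows "ennpowr (\<integral>\<^sup>+y. f y \<partial>N) q \<le>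
    ennreal (2 powr q) * (ennpowr (\<integral>\<^sup>+y. X y \<partial>N) (q - 1) * (\<integral>\<^sup>+y. w y \<partial>N))"
proof (cases "(\<integral>\<^sup>+y. X y \<partial>N) = 0 \<or> (\<integral>\<^sup>+y. w y \<partial>N) = 0")
  case True
  then have "(AE y in N. X y = 0) \<or> (AE y in N. w y = 0)"
    by (simp add: nn_integral_0_iff_AE)
  then have "AE y in N. f y = 0"
  proof
    assume "AE y in N. X y = 0"
    with le show ?thesis by eventually_elim auto
  next
    assume "AE y in N. w y = 0"
    with le show ?thesis by eventually_elim auto
  qed
  then have "(\<integral>\<^sup>+y. f y \<partial>N) = 0" by (simp add: nn_integral_0_iff_AE)
  then show ?thesis by simp
next
  case False
  show ?thesis
  proof (rule hoelder_optimize[OF q])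
    fix l :: real assume l: "0 < l"
    have "(\<integral>\<^sup>+y. f y \<partial>N) \<le> (\<integral>\<^sup>+y. ennreal l * X y + ennreal (l powr (1 - q)) * w y \<partial>N)"
      using le by (intro nn_integral_mono_AE) (auto elim!: eventually_mono intro: hoelder_pointwise[OF q l])
    also have "\<dots> = ennreal l * (\<integral>\<^sup>+y. X y \<partial>N) + ennreal (l powr (1 - q)) * (\<integral>\<^sup>+y. w y \<partial>N)"
      by (simp add: nn_integral_add nn_integral_cmult)
    finally show "(\<integral>\<^sup>+y. f y \<partial>N) \<le> \<dots>" .
  qed (use False in auto)
qed

section \<open>Doubling measures\<close>

locale doubling_space = metric_measure_space M
  for M :: "'a::metric_space measure" +
  fixes c :: real
  assumes c_gt_1: "1 < c"
    and doubling_ball: "\<And>x r. 0 < r \<Longrightarrow> emeasure M (ball x (2 * r)) \<le> ennreal c * emeasure M (ball x r)"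
begin

abbreviation vol :: "'a \<Rightarrow> real \<Rightarrow> ennreal" where
  "vol x r \<equiv> emeasure M (ball x r)"

lemma sets_borelI [measurable (raw)]: "A \<in> sets borel \<Longrightarrow> A \<in> sets M"
  using borel_subset by blast

lemma ball_in_sets [measurable]: "ball x r \<in> sets M"
  by (intro sets_borelI) auto

lemma borel_measurable_imp_measurable: "f \<in> borel_measurable borel \<Longrightarrow> f \<in> borel_measurable M"
  using borel_subset space_eq by (auto simp: measurable_def)

lemma emeasure_ball_pos [simp]: "0 < r \<Longrightarrow> vol x r \<noteq> 0"
  using ball_pos[of r x] by simp

lemma emeasure_ball_finite [simp]: "vol x r < top"
  using ball_finite[of r x] by (cases "0 < r") (auto simp: ball_empty)

lemma emeasure_ball_mono: "ball x r \<subseteq> ball y s \<Longrightarrow> vol x r \<le> vol y s"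
  by (intro emeasure_mono) auto

lemma doubling_ball_power:
  assumes "0 < r"
  shows "vol x (2 ^ k * r) \<le> ennreal (c ^ k) * vol x r"
proof (induction k)
  case (Suc k)
  have "vol x (2 ^ Suc k * r) \<le> ennreal c * vol x (2 ^ k * r)"
    using doubling_ball[of "2 ^ k * r" x] assms by (simp add: mult.assoc)
  also have "\<dots> \<le> ennreal c * (ennreal (c ^ k) * vol x r)"
    by (intro mult_left_mono Suc) auto
  also have "\<dots> = ennreal (c ^ Suc k) * vol x r"
    using c_gt_1 by (simp add: ennreal_mult mult.assoc)
  finally show ?case .
qed simp

text \<open>Most volume comparisons below are instances: k counts the doublings of r needed to cover
  the distance of the centres plus the second radius.\<close>

lemma emeasure_ball_le_power:
  assumes "0 < r" "dist x y + s \<le> 2 ^ k * r"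
  shows "vol y s \<le> ennreal (c ^ k) * vol x r"
proof -
  have "ball y s \<subseteq> ball x (2 ^ k * r)"
  proof
    fix z assume "z \<in> ball y s"
    then show "z \<in> ball x (2 ^ k * r)"
      using assms dist_triangle[of x z y] by simp
  qed
  then have "vol y s \<le> vol x (2 ^ k * r)"
    by (rule emeasure_ball_mono)
  also have "\<dots> \<le> ennreal (c ^ k) * vol x r"
    by (intro doubling_ball_power assms)
  finally show ?thesis .
qed

lemma sigma_finite: "sigma_finite_measure M"
proof
  obtain x0 :: 'a where True by blast
  show "\<exists>A. countable A \<and> A \<subseteq> sets M \<and> \<Union> A = space M \<and> (\<forall>a\<in>A. emeasure M a \<noteq> \<infinity>)"
  proof (intro exI[of _ "range (\<lambda>n::nat. ball x0 (real n))"] conjI ballI)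
    show "\<Union> (range (\<lambda>n. ball x0 (real n))) = space M"
      using reals_Archimedean2 by (auto simp: space_eq)
  qed (use emeasure_ball_finite in \<open>auto simp: less_top\<close>)
qed

sublocale sigma_finite_measure M
  by (rule sigma_finite)

section \<open>Separability of the space and joint measurability of the ball kernel\<close>

lemma separated_card_le:
  fixes x0 :: 'a
  assumes "0 < e" "2 * R + e \<le> 2 ^ k * (e / 2)" "0 < R"
    and S: "finite S" "S \<subseteq> ball x0 R" "\<And>a b. a \<in> S \<Longrightarrow> b \<in> S \<Longrightarrow> a \<noteq> b \<Longrightarrow> e \<le> dist a b"
  shows "real (card S) \<le> c ^ k"
proof -
  define V where "V = vol x0 (R + e)"
  have V: "0 < V" "V < top" using assms by (auto simp: V_def ball_pos)
  \<comment> \<open>Packing by volume: the balls of radius e / 2 about S are disjoint and lie in the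
    ball of measure V, while V is at most c^k times the measure of each of them.\<close>
  have "of_nat (card S) * V = (\<Sum>a\<in>S. V)" by simp
  also have "\<dots> \<le> (\<Sum>a\<in>S. ennreal (c ^ k) * vol a (e / 2))"
  proof (intro sum_mono)
    fix a assume "a \<in> S"
    then have "dist a x0 < R" using S by (auto simp: dist_commute)
    then have "dist a x0 + (R + e) \<le> 2 ^ k * (e / 2)" using assms(2) by linarith
    then show "V \<le> ennreal (c ^ k) * vol a (e / 2)"
      unfolding V_def using assms by (intro emeasure_ball_le_power) auto
  qed
  also have "\<dots> = ennreal (c ^ k) * emeasure M (\<Union>a\<in>S. ball a (e / 2))"
  proof -
    have "disjoint_family_on (\<lambda>a. ball a (e / 2)) S"
      unfolding disjoint_family_on_def
    proof (intro ballI impI)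
      fix a b assume "a \<in> S" "b \<in> S" "a \<noteq> b"
      then have ab: "e \<le> dist a b" by (rule S)
      have False if "dist a z < e / 2" "dist b z < e / 2" for z
        using that ab dist_triangle2[of a b z] by linarith
      then show "ball a (e / 2) \<inter> ball b (e / 2) = {}" by auto
    qed
    then show ?thesis
      using S sum_emeasure[of "\<lambda>a. ball a (e / 2)" S M] by (auto simp: image_subset_iff simp flip: sum_distrib_left)
  qed
  also have "emeasure M (\<Union>a\<in>S. ball a (e / 2)) \<le> V"
    unfolding V_def
  proof (intro emeasure_mono subsetI)
    fix z assume "z \<in> (\<Union>a\<in>S. ball a (e / 2))"
    then obtain a where a: "a \<in> S" "dist a z < e / 2" by auto
    then have "dist x0 a < R" using S by auto
    then show "z \<in> ball x0 (R + e)"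
      using a dist_triangle[of x0 z a] assms by simp
  qed auto
  finally have "of_nat (card S) * V \<le> ennreal (c ^ k) * V"
    by (simp add: mult_left_mono)
  then have "of_nat (card S) \<le> ennreal (c ^ k)"
    using V by (subst (asm) (1 2) mult.commute) (simp add: ennreal_mult_le_mult_iff less_top)
  then show ?thesis
    using c_gt_1 by (simp add: ennreal_of_nat_eq_real_of_nat)
qed

text \<open>A separated set of largest cardinality is a net, since a point at distance at least e
  from it could be added. The packing bound guarantees that a largest one exists.\<close>

lemma finite_ball_net:
  fixes x0 :: 'a
  assumes "0 < e" "0 < R"
  shows "\<exists>S. finite S \<and> (\<forall>x\<in>ball x0 R. \<exists>a\<in>S. dist x a < e)"
proof -
  define sep where "sep S \<longleftrightarrow> finite S \<and> S \<subseteq> ball x0 R \<and> (\<forall>a\<in>S. \<forall>b\<in>S. a \<noteq> b \<longrightarrow> e \<le> dist a b)" for S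
  obtain k :: nat where "(2 * R + e) / (e / 2) < 2 ^ k"
    using real_arch_pow[of 2] by auto
  then have k: "2 * R + e \<le> 2 ^ k * (e / 2)"
    using assms by (simp add: field_simps)
  have "card S \<le> nat \<lfloor>c ^ k\<rfloor>" if "sep S" for S
    using separated_card_le[OF assms(1) k assms(2), of S x0] that
    by (auto simp: sep_def le_nat_floor)
  moreover have "sep {}" by (simp add: sep_def)
  ultimately obtain S where S: "sep S" "\<And>T. sep T \<Longrightarrow> card T \<le> card S"
    using ex_has_greatest_nat[of sep "{}" card "Suc (nat \<lfloor>c ^ k\<rfloor>)"] by (metis le_imp_less_Suc less_imp_le)
  have "\<exists>a\<in>S. dist x a < e" if "x \<in> ball x0 R" for x
  proof (rule ccontr)
    assume *: "\<not> (\<exists>a\<in>S. dist x a < e)"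
    then have "x \<notin> S" using assms by force
    moreover have "sep (insert x S)"
      using S(1) that * by (auto simp: sep_def dist_commute not_less)
    ultimately show False
      using S(2)[of "insert x S"] S(1) by (simp add: sep_def)
  qed
  with S(1) show ?thesis by (auto simp: sep_def)
qed

lemma countable_dense_set: "\<exists>D::'a set. countable D \<and> (\<forall>x. \<forall>e>0. \<exists>a\<in>D. dist x a < e)"
proof -
  obtain x0 :: 'a where True by blast
  have "\<exists>S. \<forall>m n. finite (S m n) \<and> (\<forall>x\<in>ball x0 (real (Suc n)). \<exists>a\<in>S m n. dist x a < 1 / real (Suc m))"
    by (intro choice allI finite_ball_net) auto
  then obtain S :: "nat \<Rightarrow> nat \<Rightarrow> 'a set" where S: "\<And>m n. finite (S m n)"
    "\<And>m n x. x \<in> ball x0 (real (Suc n)) \<Longrightarrow> \<exists>a\<in>S m n. dist x a < 1 / real (Suc m)"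
    by blast
  show ?thesis
  proof (intro exI[of _ "\<Union>m. \<Union>n. S m n"] conjI allI impI)
    show "countable (\<Union>m. \<Union>n. S m n)"
      using S(1) by (intro countable_UN) (auto intro: countable_finite)
    fix x :: 'a and e :: real assume "0 < e"
    then obtain m where "1 / real (Suc m) < e" using nat_approx_posE by blast
    moreover obtain n where "dist x0 x < real (Suc n)"
      using reals_Archimedean2 by (metis less_trans lessI of_nat_less_iff)
    ultimately show "\<exists>a\<in>\<Union>m. \<Union>n. S m n. dist x a < e"
      using S(2)[of x n m] by force
  qed
qed

text \<open>Separability writes this set as a countable union of rectangles. The two sigma-algebras
  stay general so that the centre can range over the Borel sigma-algebra while the integration
  variable ranges over that of M.\<close>

lemma dist_less_sets:
  assumes "sets borel \<subseteq> sets N1" "sets borel \<subseteq> sets N2"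
  shows "{z. dist (fst z) (snd z :: 'a) < r} \<in> sets (N1 \<Otimes>\<^sub>M N2)"
proof -
  obtain D :: "'a set" where D: "countable D" "\<And>x e. 0 < e \<Longrightarrow> \<exists>a\<in>D. dist x a < e"
    using countable_dense_set by blast
  have "{z. dist (fst z) (snd z :: 'a) < r} = (\<Union>a\<in>D. \<Union>t\<in>\<rat>. ball a t \<times> ball a (r - t))"
  proof (intro set_eqI iffI)
    fix z :: "'a \<times> 'a" assume "z \<in> {z. dist (fst z) (snd z) < r}"
    then obtain x y where z: "z = (x, y)" "dist x y < r" by (cases z) auto
    \<comment> \<open>The gap is 3 e: with dist x a < t < e, the distance from a to y is below e +
      (r - 3 e), hence below r - t.\<close>
    define e where "e = (r - dist x y) / 3"
    have e: "0 < e" using z by (simp add: e_def)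
    obtain a where a: "a \<in> D" "dist x a < e" using D(2)[OF e] by blast
    obtain t where t: "t \<in> \<rat>" "dist x a < t" "t < e" using Rats_dense_in_real[OF a(2)] by blast
    have "dist a y < r - t"
      using dist_triangle[of a y x] a t z by (simp add: e_def dist_commute field_simps)
    then show "z \<in> (\<Union>a\<in>D. \<Union>t\<in>\<rat>. ball a t \<times> ball a (r - t))"
      using a t z by (auto simp: dist_commute)
  next
    fix z :: "'a \<times> 'a" assume "z \<in> (\<Union>a\<in>D. \<Union>t\<in>\<rat>. ball a t \<times> ball a (r - t))"
    then obtain a t where "dist a (fst z) < t" "dist a (snd z) < r - t" by auto
    then show "z \<in> {z. dist (fst z) (snd z) < r}"
      using dist_triangle3[of "fst z" "snd z" a] by simp
  qed
  also have "\<dots> \<in> sets (N1 \<Otimes>\<^sub>M N2)"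
    using D(1) assms by (intro sets.countable_UN'' countable_rat pair_measureI subsetD[OF assms(1)] subsetD[OF assms(2)]) auto
  finally show ?thesis .
qed

lemma measurable_ball_kernel:
  assumes "sets borel \<subseteq> sets N1" "sets borel \<subseteq> sets N2"
  shows "(\<lambda>z. indicator (ball (fst z) r) (snd z :: 'a) :: ennreal) \<in> borel_measurable (N1 \<Otimes>\<^sub>M N2)"
proof -
  have "(\<lambda>z. indicator (ball (fst z) r) (snd z :: 'a) :: ennreal) =
      indicator {z. dist (fst z) (snd z) < r}"
    by (auto simp: indicator_def fun_eq_iff)
  then show ?thesis using dist_less_sets[OF assms] by simp
qed

end

section \<open>Averages over balls\<close>

text \<open>Integration against the normalized measure lets Hoelder's inequality and monotonicity
  apply to averages as to any integral; \<open>ball_avg_eq\<close> is the quotient form.\<close>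

definition ball_avg :: "'a::metric_space measure \<Rightarrow> real \<Rightarrow> ('a \<Rightarrow> ennreal) \<Rightarrow> 'a \<Rightarrow> ennreal" where
  "ball_avg M r h x = (\<integral>\<^sup>+y. h y \<partial>uniform_measure M (ball x r))"

context doubling_space
begin

lemma ball_avg_eq:
  "h \<in> borel_measurable M \<Longrightarrow>
    ball_avg M r h x = (\<integral>\<^sup>+y. h y * indicator (ball x r) y \<partial>M) / vol x r"
  unfolding ball_avg_def by (rule nn_integral_uniform_measure) auto

lemma ball_avg_mono:
  assumes "\<And>y. h y \<le> h' y"
  shows "ball_avg M r h x \<le> ball_avg M r h' x"
  unfolding ball_avg_def using assms by (intro nn_integral_mono) auto

lemma ball_avg_le_const:
  assumes [measurable]: "h \<in> borel_measurable M" and "0 < r"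
    and le: "\<And>y. dist x y < r \<Longrightarrow> h y \<le> K"
  shows "ball_avg M r h x \<le> K"
proof -
  have "ball_avg M r h x \<le> (\<integral>\<^sup>+y. K * indicator (ball x r) y \<partial>M) / vol x r"
    unfolding ball_avg_eq[OF assms(1)]
    by (intro divide_right_mono_ennreal nn_integral_mono) (auto simp: indicator_def le)
  also have "\<dots> = K"
    using assms emeasure_ball_pos[of r x] emeasure_ball_finite[of x r]
    by (simp add: nn_integral_cmult_indicator ennreal_mult_divide_eq less_top del: emeasure_ball_finite)
  finally show ?thesis .
qed

lemma ball_avg_1: "0 < r \<Longrightarrow> ball_avg M r (\<lambda>_. 1) x = 1"
  by (simp add: ball_avg_eq)

lemma borel_measurable_vol: "(\<lambda>x. vol x r) \<in> borel_measurable borel"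
proof -
  note measurable_ball_kernel[of borel M r, OF order_refl borel_subset, measurable]
  have "(\<lambda>x. (\<integral>\<^sup>+y. indicator (ball x r) y \<partial>M)) \<in> borel_measurable borel"
    by (rule borel_measurable_nn_integral) (auto simp: case_prod_beta')
  then show ?thesis by simp
qed

lemma measurable_vol [measurable]: "(\<lambda>x. vol x r) \<in> borel_measurable M"
  by (rule borel_measurable_imp_measurable[OF borel_measurable_vol])

text \<open>The kernel is jointly measurable for the Borel sigma-algebra in the centre, so
  integrating out the other variable gives a Borel function although h is only M-measurable.
  Sequences admissible for the potential capacity have to be Borel.\<close>

lemma ball_avg_measurable_borel:
  assumes [measurable]: "h \<in> borel_measurable M"
  shows "ball_avg M r h \<in> borel_measurable borel"
proof -
  note measurable_ball_kernel[of borel M r, OF order_refl borel_subset, measurable]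
  have "(\<lambda>x. (\<integral>\<^sup>+y. h y * indicator (ball x r) y \<partial>M)) \<in> borel_measurable borel"
    by (rule borel_measurable_nn_integral) (auto simp: case_prod_beta')
  moreover note borel_measurable_vol[of r]
  ultimately show ?thesis
    unfolding ball_avg_eq[OF assms, abs_def] by measurable
qed

lemma ball_avg_measurable [measurable (raw)]:
  "h \<in> borel_measurable M \<Longrightarrow> ball_avg M r h \<in> borel_measurable M"
  by (rule borel_measurable_imp_measurable[OF ball_avg_measurable_borel])

lemma emeasure_ball_le_near:
  assumes "0 < r" "dist x y < r"
  shows "vol x r \<le> ennreal c * vol y r"
  using emeasure_ball_le_power[of r y x r 1] assms by (simp add: dist_commute)

lemma inverse_emeasure_le:
  assumes "0 < r" "0 < s" "vol x r \<le> ennreal k * vol y s" "0 < k"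
  shows "1 / vol y s \<le> ennreal k * (1 / vol x r)"
proof -
  obtain a b where ab: "vol x r = ennreal a" "vol y s = ennreal b" "0 < a" "0 < b"
    using assms emeasure_ball_finite emeasure_ball_pos
    by (metis ennreal_cases ennreal_eq_0_iff less_irrefl linorder_not_le)
  then have "a \<le> k * b" using assms by (simp flip: ennreal_mult)
  then have "1 / b \<le> k * (1 / a)" using ab by (simp add: field_simps)
  then have "ennreal (1 / b) \<le> ennreal (k * (1 / a))"
    by (rule ennreal_leI)
  also have "\<dots> = ennreal k * ennreal (1 / a)"
    using assms ab by (intro ennreal_mult) auto
  finally have "ennreal (1 / b) \<le> ennreal k * ennreal (1 / a)" .
  then show ?thesis
    using ab divide_ennreal[of 1 a] divide_ennreal[of 1 b] by simp
qed

text \<open>\<open>ball x r\<close> lies in \<open>ball y (2 * r)\<close>, which in turn lies in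
  \<open>ball x (4 * r)\<close>; the two doublings give c^2.\<close>

lemma ball_avg_le_ball_avg_double:
  assumes [measurable]: "h \<in> borel_measurable M" and "0 < r" "dist x y < r"
  shows "ball_avg M r h x \<le> ennreal (c\<^sup>2) * ball_avg M (2 * r) h y"
proof -
  have "vol y (2 * r) \<le> ennreal (c ^ 2) * vol x r"
    using assms by (intro emeasure_ball_le_power) auto
  then have inv: "1 / vol x r \<le> ennreal (c\<^sup>2) * (1 / vol y (2 * r))"
    using assms c_gt_1 by (intro inverse_emeasure_le) auto
  have "(\<integral>\<^sup>+z. h z * indicator (ball x r) z \<partial>M) \<le> (\<integral>\<^sup>+z. h z * indicator (ball y (2 * r)) z \<partial>M)"
  proof (intro nn_integral_mono)
    fix z
    have "z \<in> ball x r \<Longrightarrow> z \<in> ball y (2 * r)"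
      using assms dist_triangle[of y z x] by (simp add: dist_commute)
    then show "h z * indicator (ball x r) z \<le> h z * indicator (ball y (2 * r)) z"
      by (auto simp: indicator_def)
  qed
  then have "(\<integral>\<^sup>+z. h z * indicator (ball x r) z \<partial>M) * (1 / vol x r) \<le>
      (\<integral>\<^sup>+z. h z * indicator (ball y (2 * r)) z \<partial>M) * (ennreal (c\<^sup>2) * (1 / vol y (2 * r)))"
    using inv by (intro mult_mono) auto
  then show ?thesis
    by (simp add: ball_avg_eq ennreal_times_divide mult.commute[of _ "ennreal (c\<^sup>2)"])
qed

text \<open>The relation dist x y < r is symmetric, and the volumes of the two balls agree up to the
  factor c. By Fubini's theorem averaging is therefore its own adjoint up to c.\<close>

lemma ball_avg_duality:
  assumes [measurable]: "g \<in> borel_measurable M" "w \<in> borel_measurable M" and r: "0 < r"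
  shows "(\<integral>\<^sup>+x. ball_avg M r g x * w x \<partial>M) \<le> ennreal c * (\<integral>\<^sup>+y. g y * ball_avg M r w y \<partial>M)"
proof -
  interpret P: pair_sigma_finite M M
    by unfold_locales
  note measurable_ball_kernel[of M M r, OF borel_subset borel_subset, measurable]
  have "(\<integral>\<^sup>+x. ball_avg M r g x * w x \<partial>M) =
      (\<integral>\<^sup>+x. (\<integral>\<^sup>+y. g y * indicator (ball x r) y * (w x / vol x r) \<partial>M) \<partial>M)"
    by (intro nn_integral_cong)
      (simp add: ball_avg_eq nn_integral_multc ennreal_divide_times)
  also have "\<dots> = (\<integral>\<^sup>+y. (\<integral>\<^sup>+x. g y * indicator (ball x r) y * (w x / vol x r) \<partial>M) \<partial>M)"
    by (rule P.Fubini'[symmetric]) (simp add: case_prod_beta')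
  also have "\<dots> \<le> (\<integral>\<^sup>+y. ennreal c * (g y * ball_avg M r w y) \<partial>M)"
  proof (intro nn_integral_mono)
    fix y
    have "(\<integral>\<^sup>+x. g y * indicator (ball x r) y * (w x / vol x r) \<partial>M) \<le>
      (\<integral>\<^sup>+x. (g y * ennreal c / vol y r) * (w x * indicator (ball y r) x) \<partial>M)"
    proof (intro nn_integral_mono)
      fix x
      show "g y * indicator (ball x r) y * (w x / vol x r) \<le>
        (g y * ennreal c / vol y r) * (w x * indicator (ball y r) x)"
      proof (cases "dist x y < r")
        case True
        have "1 / vol x r \<le> ennreal c * (1 / vol y r)"
          using emeasure_ball_le_near[of r y x] True r c_gt_1
          by (intro inverse_emeasure_le) (auto simp: dist_commute)
        then have "g y * w x * (1 / vol x r) \<le> g y * w x * (ennreal c * (1 / vol y r))"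
          by (intro mult_left_mono) auto
        then show ?thesis
          using True by (simp add: dist_commute ennreal_times_divide mult_ac)
      qed auto
    qed
    also have "\<dots> = (g y * ennreal c / vol y r) * (\<integral>\<^sup>+x. w x * indicator (ball y r) x \<partial>M)"
      by (rule nn_integral_cmult) measurable
    also have "\<dots> = ennreal c * (g y * ball_avg M r w y)"
      by (simp add: ball_avg_eq ennreal_times_divide ennreal_divide_times mult_ac)
    finally show "(\<integral>\<^sup>+x. g y * indicator (ball x r) y * (w x / vol x r) \<partial>M) \<le> \<dots>" .
  qed
  also have "\<dots> = ennreal c * (\<integral>\<^sup>+y. g y * ball_avg M r w y \<partial>M)"
    by (rule nn_integral_cmult) measurable
  finally show ?thesis .
qed

lemma nn_integral_ball_avg_le:
  assumes [measurable]: "g \<in> borel_measurable M" and "0 < r"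
  shows "(\<integral>\<^sup>+x. ball_avg M r g x \<partial>M) \<le> ennreal c * (\<integral>\<^sup>+y. g y \<partial>M)"
  using ball_avg_duality[of g "\<lambda>_. 1" r] assms by (simp add: ball_avg_1)

lemma ennpowr_ball_avg_le_hoelder:
  assumes [measurable]: "f \<in> borel_measurable M" "X \<in> borel_measurable M" "w \<in> borel_measurable M"
    and "1 < q" "\<And>y. ennpowr (f y) q \<le> ennpowr (X y) (q - 1) * w y"
  shows "ennpowr (ball_avg M r f x) q \<le>
    ennreal (2 powr q) * (ennpowr (ball_avg M r X x) (q - 1) * ball_avg M r w x)"
  unfolding ball_avg_def by (intro hoelder_nn_integral) (use assms in auto)

text \<open>Hoelder's inequality with X = 1 gives Jensen's inequality up to the factor 2^q; q = 1
  lies outside its range and is immediate.\<close>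

lemma ennpowr_ball_avg_le:
  assumes [measurable]: "f \<in> borel_measurable M" and "1 \<le> q" "0 < r"
  shows "ennpowr (ball_avg M r f x) q \<le> ennreal (2 powr q) * ball_avg M r (\<lambda>y. ennpowr (f y) q) x"
proof (cases "q = 1")
  case True
  have "ball_avg M r f x \<le> 2 * ball_avg M r f x"
    by (simp add: mult_2)
  then show ?thesis using True by simp
next
  case False
  then show ?thesis
    using ennpowr_ball_avg_le_hoelder[of f "\<lambda>_. 1" "\<lambda>y. ennpowr (f y) q" q r x] assms
    by (simp add: ball_avg_1)
qed

lemma nn_integral_ennpowr_ball_avg_le:
  assumes [measurable]: "f \<in> borel_measurable M" and "1 \<le> q" "0 < r"
  shows "(\<integral>\<^sup>+x. ennpowr (ball_avg M r f x) q \<partial>M) \<le>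
    ennreal (2 powr q * c) * (\<integral>\<^sup>+x. ennpowr (f x) q \<partial>M)"
proof -
  have "(\<integral>\<^sup>+x. ennpowr (ball_avg M r f x) q \<partial>M) \<le>
      (\<integral>\<^sup>+x. ennreal (2 powr q) * ball_avg M r (\<lambda>y. ennpowr (f y) q) x \<partial>M)"
    using assms by (intro nn_integral_mono ennpowr_ball_avg_le) auto
  also have "\<dots> = ennreal (2 powr q) * (\<integral>\<^sup>+x. ball_avg M r (\<lambda>y. ennpowr (f y) q) x \<partial>M)"
    by (rule nn_integral_cmult) measurable
  also have "\<dots> \<le> ennreal (2 powr q) * (ennreal c * (\<integral>\<^sup>+x. ennpowr (f x) q \<partial>M))"
    using assms by (intro mult_left_mono nn_integral_ball_avg_le) auto
  finally show ?thesis
    using c_gt_1 by (simp add: ennreal_mult mult.assoc)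
qed

end

section \<open>Sums of averages at different scales\<close>

text \<open>Indices are added in increasing order, each by \<open>ennpowr_add_step\<close>. So every
  term is paired only with indices not above its own, that is, with scales at least as
  coarse.\<close>

lemma ennpowr_sum_le_telescope:
  fixes a :: "int \<Rightarrow> ennreal"
  assumes "finite J" "1 \<le> s"
  shows "ennpowr (\<Sum>j\<in>J. a j) s \<le>
    ennreal s * (\<Sum>n\<in>J. a n * ennpowr (\<Sum>j\<in>J \<inter> {..n}. a j) (s - 1))"
  using assms(1)
proof (induction J rule: finite_linorder_max_induct)
  case (insert b J)
  have b: "b \<notin> J" using insert by auto
  have 1: "insert b J \<inter> {..b} = insert b J" using insert by auto
  have 2: "insert b J \<inter> {..n} = J \<inter> {..n}" if "n \<in> J" for n using insert that by auto
  have "ennpowr (\<Sum>j\<in>insert b J. a j) s = ennpowr ((\<Sum>j\<in>J. a j) + a b) s"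
    using insert b by (simp add: add.commute)
  also have "\<dots> \<le> ennpowr (\<Sum>j\<in>J. a j) s +
      ennreal s * (a b * ennpowr ((\<Sum>j\<in>J. a j) + a b) (s - 1))"
    by (rule ennpowr_add_step) fact
  also have "\<dots> \<le> ennreal s * (\<Sum>n\<in>J. a n * ennpowr (\<Sum>j\<in>J \<inter> {..n}. a j) (s - 1)) +
      ennreal s * (a b * ennpowr (\<Sum>j\<in>insert b J. a j) (s - 1))"
    using insert b by (intro add_mono insert.IH) (simp add: add.commute)
  also have "\<dots> = ennreal s *
      (\<Sum>n\<in>insert b J. a n * ennpowr (\<Sum>j\<in>insert b J \<inter> {..n}. a j) (s - 1))"
    using insert(1) b by (simp add: 1 2 distrib_left add.commute cong: sum.cong)
  finally show ?case .
qed simp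

context doubling_space
begin

text \<open>The balls of the coarser scales \<open>j \<le> n\<close> hardly change when the centre moves by the
  radius of scale \<open>n\<close>. So the average \<open>ball_avg M (R * 2 powi (- n))\<close>, moved to the other factor by duality,
  can be replaced by doubling all radii. This bounds the sum for \<open>R\<close> by a small multiple of
  the one for \<open>2 * R\<close>, which is absorbed into the supremum over all \<open>R\<close>.\<close>

lemma nn_integral_sum_ball_avg_step:
  assumes [measurable]: "\<And>j. g j \<in> borel_measurable M"
    and s: "1 \<le> s" and J: "finite (J :: int set)" and R: "0 < R"
  shows "(\<integral>\<^sup>+x. ennpowr (\<Sum>j\<in>J. ball_avg M (R * 2 powi (- j)) (g j) x) s \<partial>M) \<le>
    ennreal (s * c * c\<^sup>2 powr (s - 1)) *
      (\<integral>\<^sup>+y. (\<Sum>j\<in>J. g j y) * ennpowr (\<Sum>j\<in>J. ball_avg M (2 * R * 2 powi (- j)) (g j) y) (s - 1) \<partial>M)"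
proof -
  define a where "a j = ball_avg M (R * 2 powi (- j)) (g j)" for j
  define S where "S n x = (\<Sum>j\<in>J \<inter> {..n}. a j x)" for n x
  define T where "T y = (\<Sum>j\<in>J. ball_avg M (2 * R * 2 powi (- j)) (g j) y)" for y
  have [measurable]: "a j \<in> borel_measurable M" for j
    unfolding a_def by measurable
  have [measurable]: "S n \<in> borel_measurable M" for n
    unfolding S_def by measurable
  have [measurable]: "T \<in> borel_measurable M"
    unfolding T_def by measurable
  have ST: "S n x \<le> ennreal (c\<^sup>2) * T y" if xy: "dist y x < R * 2 powi (- n)" for n x y
  proof -
    have "S n x \<le> (\<Sum>j\<in>J \<inter> {..n}. ennreal (c\<^sup>2) * ball_avg M (2 * (R * 2 powi (- j))) (g j) y)"
      unfolding S_def a_def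
    proof (intro sum_mono ball_avg_le_ball_avg_double)
      fix j assume "j \<in> J \<inter> {..n}"
      then have "R * 2 powi (- n) \<le> R * 2 powi (- j)"
        using R by (intro mult_left_mono power_int_increasing) auto
      then show "dist x y < R * 2 powi (- j)" using xy by (simp add: dist_commute)
    qed (use R in auto)
    also have "\<dots> \<le> ennreal (c\<^sup>2) * T y"
      using J unfolding T_def sum_distrib_left[symmetric] mult.assoc
      by (intro mult_left_mono sum_mono2) auto
    finally show ?thesis .
  qed
  have term_le: "(\<integral>\<^sup>+x. a n x * ennpowr (S n x) (s - 1) \<partial>M) \<le>
      ennreal (c * c\<^sup>2 powr (s - 1)) * (\<integral>\<^sup>+y. g n y * ennpowr (T y) (s - 1) \<partial>M)" for n
  proof -
    have "(\<integral>\<^sup>+x. a n x * ennpowr (S n x) (s - 1) \<partial>M) \<le>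
        ennreal c * (\<integral>\<^sup>+y. g n y * ball_avg M (R * 2 powi (- n)) (\<lambda>x. ennpowr (S n x) (s - 1)) y \<partial>M)"
      unfolding a_def using R by (intro ball_avg_duality) auto
    also have "\<dots> \<le> ennreal c * (\<integral>\<^sup>+y. ennreal (c\<^sup>2 powr (s - 1)) * (g n y * ennpowr (T y) (s - 1)) \<partial>M)"
    proof (intro mult_left_mono nn_integral_mono)
      fix y
      have "ball_avg M (R * 2 powi (- n)) (\<lambda>x. ennpowr (S n x) (s - 1)) y \<le>
          ennpowr (ennreal (c\<^sup>2) * T y) (s - 1)"
        using s R by (intro ball_avg_le_const ennpowr_mono ST) auto
      also have "\<dots> = ennreal (c\<^sup>2 powr (s - 1)) * ennpowr (T y) (s - 1)"
        using c_gt_1 by (simp add: ennpowr_mult ennpowr_ennreal)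
      finally show "g n y * ball_avg M (R * 2 powi (- n)) (\<lambda>x. ennpowr (S n x) (s - 1)) y \<le>
          ennreal (c\<^sup>2 powr (s - 1)) * (g n y * ennpowr (T y) (s - 1))"
        by (subst mult.left_commute) (rule mult_left_mono, auto)
    qed auto
    also have "\<dots> = ennreal c * (ennreal (c\<^sup>2 powr (s - 1)) * (\<integral>\<^sup>+y. g n y * ennpowr (T y) (s - 1) \<partial>M))"
      by (subst nn_integral_cmult) auto
    also have "\<dots> = ennreal (c * c\<^sup>2 powr (s - 1)) * (\<integral>\<^sup>+y. g n y * ennpowr (T y) (s - 1) \<partial>M)"
      using c_gt_1 by (simp add: ennreal_mult mult.assoc)
    finally show ?thesis .
  qed
  have "(\<integral>\<^sup>+x. ennpowr (\<Sum>j\<in>J. a j x) s \<partial>M) \<le>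
      (\<integral>\<^sup>+x. ennreal s * (\<Sum>n\<in>J. a n x * ennpowr (S n x) (s - 1)) \<partial>M)"
    unfolding S_def using s J by (intro nn_integral_mono ennpowr_sum_le_telescope)
  also have "\<dots> = ennreal s * (\<Sum>n\<in>J. \<integral>\<^sup>+x. a n x * ennpowr (S n x) (s - 1) \<partial>M)"
    by (subst nn_integral_cmult) (auto simp: nn_integral_sum)
  also have "\<dots> \<le> ennreal s * (\<Sum>n\<in>J. ennreal (c * c\<^sup>2 powr (s - 1)) * (\<integral>\<^sup>+y. g n y * ennpowr (T y) (s - 1) \<partial>M))"
    by (intro mult_left_mono sum_mono term_le) auto
  also have "\<dots> = ennreal s * (ennreal (c * c\<^sup>2 powr (s - 1)) * (\<integral>\<^sup>+y. (\<Sum>n\<in>J. g n y) * ennpowr (T y) (s - 1) \<partial>M))"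
    by (simp add: sum_distrib_right nn_integral_sum flip: sum_distrib_left)
  finally show ?thesis
    using s c_gt_1 unfolding a_def T_def by (simp add: ennreal_mult mult.assoc)
qed

text \<open>The bound depends on \<open>card J\<close>; its purpose is that it does not depend on R,
  so that the supremum over R in the next proof is known to be finite.\<close>

lemma nn_integral_sum_ball_avg_crude:
  assumes [measurable]: "\<And>j. g j \<in> borel_measurable M"
    and s: "1 \<le> s" and J: "finite (J :: int set)" and R: "0 < R"
  shows "(\<integral>\<^sup>+x. ennpowr (\<Sum>j\<in>J. ball_avg M (R * 2 powi (- j)) (g j) x) s \<partial>M) \<le>
    ennpowr (of_nat (card J)) s * (of_nat (card J) * (ennreal (2 powr s * c) *
      (\<integral>\<^sup>+x. ennpowr (\<Sum>j\<in>J. g j x) s \<partial>M)))"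
proof -
  have "(\<integral>\<^sup>+x. ennpowr (\<Sum>j\<in>J. ball_avg M (R * 2 powi (- j)) (g j) x) s \<partial>M) \<le>
    (\<integral>\<^sup>+x. ennpowr (of_nat (card J)) s * (\<Sum>j\<in>J. ennpowr (ball_avg M (R * 2 powi (- j)) (g j) x) s) \<partial>M)"
    using s J by (intro nn_integral_mono ennpowr_sum_le) auto
  also have "\<dots> = ennpowr (of_nat (card J)) s *
      (\<Sum>j\<in>J. \<integral>\<^sup>+x. ennpowr (ball_avg M (R * 2 powi (- j)) (g j) x) s \<partial>M)"
    by (subst nn_integral_cmult) (auto simp: nn_integral_sum)
  also have "\<dots> \<le> ennpowr (of_nat (card J)) s *
      (\<Sum>j\<in>J. ennreal (2 powr s * c) * (\<integral>\<^sup>+x. ennpowr (\<Sum>j\<in>J. g j x) s \<partial>M))"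
  proof (intro mult_left_mono sum_mono)
    fix j assume j: "j \<in> J"
    have "(\<integral>\<^sup>+x. ennpowr (ball_avg M (R * 2 powi (- j)) (g j) x) s \<partial>M) \<le>
        ennreal (2 powr s * c) * (\<integral>\<^sup>+x. ennpowr (g j x) s \<partial>M)"
      using s R by (intro nn_integral_ennpowr_ball_avg_le) auto
    also have "\<dots> \<le> ennreal (2 powr s * c) * (\<integral>\<^sup>+x. ennpowr (\<Sum>j\<in>J. g j x) s \<partial>M)"
      using s J j by (intro mult_left_mono nn_integral_mono ennpowr_mono member_le_sum) auto
    finally show "(\<integral>\<^sup>+x. ennpowr (ball_avg M (R * 2 powi (- j)) (g j) x) s \<partial>M) \<le> \<dots>" .
  qed auto
  finally show ?thesis by simp
qed

lemma nn_integral_sum_ball_avg: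
  assumes s: "1 \<le> s"
  obtains K where "0 < K"
    "\<And>(J :: int set) (g :: int \<Rightarrow> 'a \<Rightarrow> ennreal) R. finite J \<Longrightarrow> (\<And>j. g j \<in> borel_measurable M) \<Longrightarrow> 0 < R \<Longrightarrow>
      (\<integral>\<^sup>+x. ennpowr (\<Sum>j\<in>J. ball_avg M (R * 2 powi (- j)) (g j) x) s \<partial>M) \<le>
        ennreal K * (\<integral>\<^sup>+x. ennpowr (\<Sum>j\<in>J. g j x) s \<partial>M)"
proof
  define C0 where "C0 = s * c * c\<^sup>2 powr (s - 1)"
  have C0: "0 < C0" using s c_gt_1 by (simp add: C0_def)
  \<comment> \<open>Chosen so that the coefficient C0 * e of the term to be absorbed is 1/2.\<close>
  define e where "e = 1 / (2 * C0)"
  have e: "0 < e" using C0 by (simp add: e_def)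
  define K where "K = 2 * (C0 * e powr (1 - s))"
  show "0 < K" using C0 e by (simp add: K_def)
  fix J :: "int set" and g :: "int \<Rightarrow> 'a \<Rightarrow> ennreal" and R :: real
  assume J: "finite J" and [measurable]: "\<And>j. g j \<in> borel_measurable M" and R: "0 < R"
  define G where "G y = (\<Sum>j\<in>J. g j y)" for y
  define T where "T R y = (\<Sum>j\<in>J. ball_avg M (R * 2 powi (- j)) (g j) y)" for R y
  define I where "I R = (\<integral>\<^sup>+x. ennpowr (T R x) s \<partial>M)" for R
  define Q where "Q = (\<integral>\<^sup>+x. ennpowr (G x) s \<partial>M)"
  have [measurable]: "G \<in> borel_measurable M" "T R \<in> borel_measurable M" for R
    unfolding G_def T_def by measurable
  show "(\<integral>\<^sup>+x. ennpowr (\<Sum>j\<in>J. ball_avg M (R * 2 powi (- j)) (g j) x) s \<partial>M) \<le>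
        ennreal K * (\<integral>\<^sup>+x. ennpowr (\<Sum>j\<in>J. g j x) s \<partial>M)"
  proof (cases "Q = top")
    case True
    then show ?thesis using \<open>0 < K\<close> by (simp add: Q_def G_def ennreal_mult_top)
  next
    case False
    have step: "I R \<le> ennreal (C0 * e powr (1 - s)) * Q + ennreal (1/2) * I (2 * R)" if "0 < R" for R
    proof -
      have "I R \<le> ennreal C0 * (\<integral>\<^sup>+y. G y * ennpowr (T (2 * R) y) (s - 1) \<partial>M)"
        unfolding I_def T_def G_def C0_def
        using s J that by (intro nn_integral_sum_ball_avg_step) auto
      also have "\<dots> \<le> ennreal C0 * (\<integral>\<^sup>+y. ennreal (e powr (1 - s)) * ennpowr (G y) s +
          ennreal e * ennpowr (T (2 * R) y) s \<partial>M)"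
        using e s by (intro mult_left_mono nn_integral_mono young_ennpowr) auto
      also have "\<dots> = ennreal C0 * (ennreal (e powr (1 - s)) * Q + ennreal e * I (2 * R))"
        unfolding Q_def I_def by (simp add: nn_integral_add nn_integral_cmult)
      also have "\<dots> = ennreal (C0 * e powr (1 - s)) * Q + ennreal (C0 * e) * I (2 * R)"
        using C0 e by (simp add: ennreal_mult distrib_left mult.assoc)
      also have "C0 * e = 1/2" using C0 by (simp add: e_def)
      finally show ?thesis .
    qed
    define B where "B = (SUP R\<in>{0<..}. I R)"
    have "B \<le> ennpowr (of_nat (card J)) s * (of_nat (card J) * (ennreal (2 powr s * c) * Q))"
      unfolding B_def I_def T_def Q_def G_def
      using s J by (intro SUP_least nn_integral_sum_ball_avg_crude) auto
    also have "\<dots> < top"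
    proof -
      have "ennpowr (of_nat (card J)) s < top" "Q < top"
        using False by (simp_all add: less_top[symmetric])
      then show ?thesis
        by (simp add: ennreal_mult_less_top ennreal_of_nat_eq_real_of_nat)
    qed
    finally have fin: "B < top" .
    have "B \<le> ennreal (C0 * e powr (1 - s)) * Q + ennreal (1/2) * B"
      unfolding B_def
    proof (rule SUP_least)
      fix R :: real assume R: "R \<in> {0<..}"
      then have "I R \<le> ennreal (C0 * e powr (1 - s)) * Q + ennreal (1/2) * I (2 * R)"
        by (intro step) auto
      also have "\<dots> \<le> ennreal (C0 * e powr (1 - s)) * Q + ennreal (1/2) * (SUP R\<in>{0<..}. I R)"
        using R by (intro add_left_mono mult_left_mono SUP_upper) auto
      finally show "I R \<le> \<dots>" .
    qed
    from ennreal_absorb[OF this fin] have "B \<le> ennreal K * Q"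
      using C0 by (simp add: K_def ennreal_mult mult.assoc)
    moreover have "I R \<le> B"
      unfolding B_def using R by (intro SUP_upper) auto
    ultimately show ?thesis
      unfolding I_def T_def Q_def G_def by (rule order_trans[rotated])
  qed
qed

end

section \<open>Mixed norms\<close>

text \<open>An increasing sequence replaces the directed family of all finite sets, which yields
  measurability of the sum and permits monotone convergence.\<close>

lemma infsum_ennreal_int_SUP:
  fixes f :: "int \<Rightarrow> ennreal"
  shows "infsum f UNIV = (SUP N::nat. sum f {- int N..int N})"
proof -
  have "infsum f UNIV = (SUP F\<in>{F. finite F \<and> F \<subseteq> UNIV}. sum f F)"
    by (rule nonneg_infsum_complete) auto
  also have "\<dots> = (SUP N::nat. sum f {- int N..int N})"
  proof (rule antisym; rule SUP_least)
    fix F :: "int set" assume "F \<in> {F. finite F \<and> F \<subseteq> UNIV}"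
    then have F: "finite F" by auto
    define N where "N = nat (Max (insert 0 (abs ` F)))"
    have "F \<subseteq> {- int N..int N}"
    proof
      fix k assume "k \<in> F"
      then have "\<bar>k\<bar> \<le> Max (insert 0 (abs ` F))" using F by (intro Max_ge) auto
      then show "k \<in> {- int N..int N}" by (auto simp: N_def)
    qed
    then have "sum f F \<le> sum f {- int N..int N}" by (intro sum_mono2) auto
    then show "sum f F \<le> (SUP N::nat. sum f {- int N..int N})" by (rule SUP_upper2[OF UNIV_I])
  next
    fix N :: nat
    show "sum f {- int N..int N} \<le> (SUP F\<in>{F. finite F \<and> F \<subseteq> UNIV}. sum f F)"
      by (rule SUP_upper) auto
  qed
  finally show ?thesis .
qed

lemma infsum_ennreal_mono:
  fixes f g :: "'i \<Rightarrow> ennreal"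
  assumes "\<And>k. k \<in> A \<Longrightarrow> f k \<le> g k"
  shows "infsum f A \<le> infsum g A"
  using assms by (intro infsum_mono nonneg_summable_on_complete) auto

lemma sum_le_infsum_ennreal:
  fixes f :: "'i \<Rightarrow> ennreal"
  assumes "finite F" "F \<subseteq> A"
  shows "sum f F \<le> infsum f A"
  unfolding nonneg_infsum_complete[of A f, OF zero_le] using assms by (intro SUP_upper) auto

lemma infsum_ennreal_le:
  fixes f :: "'i \<Rightarrow> ennreal"
  assumes "\<And>F. finite F \<Longrightarrow> F \<subseteq> A \<Longrightarrow> sum f F \<le> K"
  shows "infsum f A \<le> K"
  unfolding nonneg_infsum_complete[of A f, OF zero_le] using assms by (intro SUP_least) auto

lemma lq_norm_top: "lq_norm I top a = (SUP k\<in>I. a k)"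
  by (simp add: lq_norm_def)

lemma lq_norm_finite_exponent:
  "q \<noteq> top \<Longrightarrow> lq_norm I q a = ennpowr (\<Sum>\<^sub>\<infinity>k\<in>I. ennpowr (a k) (enn2real q)) (1 / enn2real q)"
  by (simp add: lq_norm_def)

lemma enn2real_gt_1: "1 < q \<Longrightarrow> q \<noteq> top \<Longrightarrow> 1 < enn2real q"
  by (cases q) (auto simp: ennreal_less_iff simp flip: ennreal_1)

lemma lq_norm_mono:
  assumes "1 < q" "\<And>k. k \<in> I \<Longrightarrow> a k \<le> b k"
  shows "lq_norm I q a \<le> lq_norm I q b"
proof (cases "q = top")
  case True
  then show ?thesis using assms by (auto simp: lq_norm_top intro: SUP_mono)
next
  case False
  then show ?thesis
    using assms enn2real_gt_1[OF assms(1) False]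
    by (auto simp: lq_norm_finite_exponent intro!: ennpowr_mono infsum_ennreal_mono)
qed

lemma lq_norm_cmult:
  assumes "1 < q"
  shows "lq_norm I q (\<lambda>k. t * a k) = t * lq_norm I q a"
proof (cases "q = top")
  case True
  then show ?thesis by (simp add: lq_norm_top SUP_mult_left_ennreal)
next
  case False
  note q = enn2real_gt_1[OF assms False]
  have "(\<Sum>\<^sub>\<infinity>k\<in>I. ennpowr t (enn2real q) * ennpowr (a k) (enn2real q)) =
      ennpowr t (enn2real q) * (\<Sum>\<^sub>\<infinity>k\<in>I. ennpowr (a k) (enn2real q))"
    unfolding nonneg_infsum_complete[of I, OF zero_le]
    by (simp add: SUP_mult_left_ennreal sum_distrib_left)
  then show ?thesis
    using q False by (simp add: lq_norm_finite_exponent ennpowr_mult)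
qed

lemma le_lq_norm:
  assumes "1 < q" "k \<in> I"
  shows "a k \<le> lq_norm I q a"
proof (cases "q = top")
  case True
  then show ?thesis using assms by (auto simp: lq_norm_top intro: SUP_upper)
next
  case False
  note q = enn2real_gt_1[OF assms(1) False]
  have "ennpowr (a k) (enn2real q) \<le> (\<Sum>\<^sub>\<infinity>k\<in>I. ennpowr (a k) (enn2real q))"
    using sum_le_infsum_ennreal[of "{k}" I "\<lambda>k. ennpowr (a k) (enn2real q)"] assms by simp
  then have "ennpowr (ennpowr (a k) (enn2real q)) (1 / enn2real q) \<le> lq_norm I q a"
    unfolding lq_norm_finite_exponent[OF False] using q by (intro ennpowr_mono) auto
  then show ?thesis using q by simp
qed

text \<open>Extension by zero reduces all index sets to the set of all integers, so measurability
  and the averaging inequality can be stated there.\<close>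

lemma lq_norm_restrict:
  assumes "1 < q"
  shows "lq_norm UNIV q (\<lambda>k. if k \<in> I then a k else 0) = lq_norm I q a"
proof (cases "q = top")
  case True
  have "(SUP k. if k \<in> I then a k else 0) = (SUP k\<in>I. a k)"
  proof (rule antisym; rule SUP_least)
    fix k assume "k \<in> I"
    then show "a k \<le> (SUP k. if k \<in> I then a k else 0)"
      by (intro SUP_upper2[of k]) auto
  qed (auto intro: SUP_upper)
  then show ?thesis using True by (simp add: lq_norm_top)
next
  case False
  have "(\<Sum>\<^sub>\<infinity>k. ennpowr (if k \<in> I then a k else 0) (enn2real q)) = (\<Sum>\<^sub>\<infinity>k\<in>I. ennpowr (a k) (enn2real q))"
    by (rule infsum_cong_neutral) auto
  then show ?thesis using False by (simp add: lq_norm_finite_exponent)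
qed

lemma lq_norm_mono_set:
  assumes "1 < q" "I \<subseteq> J"
  shows "lq_norm I q a \<le> lq_norm J q a"
  unfolding lq_norm_restrict[OF assms(1), symmetric, of I] lq_norm_restrict[OF assms(1), symmetric, of J]
  using assms by (intro lq_norm_mono) auto

lemma lq_norm_UNIV_SUP:
  assumes "1 < q"
  shows "lq_norm UNIV q a = (SUP N::nat. lq_norm {- int N..int N} q a)"
proof (cases "q = top")
  case True
  have "(SUP k. a k) \<le> (SUP N::nat. SUP k\<in>{- int N..int N}. a k)"
  proof (rule SUP_least)
    fix k :: int
    have "a k \<le> (SUP k\<in>{- int (nat \<bar>k\<bar>)..int (nat \<bar>k\<bar>)}. a k)"
      by (rule SUP_upper) auto
    then show "a k \<le> (SUP N::nat. SUP k\<in>{- int N..int N}. a k)"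
      by (rule SUP_upper2[OF UNIV_I])
  qed
  moreover have "(SUP N::nat. SUP k\<in>{- int N..int N}. a k) \<le> (SUP k. a k)"
    by (intro SUP_least SUP_upper) auto
  ultimately show ?thesis
    unfolding True lq_norm_top by (rule antisym)
next
  case False
  then show ?thesis
    using enn2real_gt_1[OF assms False]
    by (simp add: lq_norm_finite_exponent infsum_ennreal_int_SUP ennpowr_SUP)
qed

lemma borel_measurable_lq_norm_UNIV:
  assumes "1 < q" and [measurable]: "\<And>k. g k \<in> borel_measurable N"
  shows "(\<lambda>x. lq_norm UNIV q (\<lambda>k. g k x)) \<in> borel_measurable N"
proof (cases "q = top")
  case False
  then show ?thesis
    by (simp add: lq_norm_finite_exponent infsum_ennreal_int_SUP)
qed (simp add: lq_norm_top)

lemma borel_measurable_lq_norm: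
  assumes "1 < q" and [measurable]: "\<And>k. k \<in> I \<Longrightarrow> g k \<in> borel_measurable N"
  shows "(\<lambda>x. lq_norm I q (\<lambda>k. g k x)) \<in> borel_measurable N"
  unfolding lq_norm_restrict[OF assms(1), symmetric, of I]
proof (rule borel_measurable_lq_norm_UNIV[OF assms(1)])
  show "(\<lambda>x. if k \<in> I then g k x else 0) \<in> borel_measurable N" for k
    by (cases "k \<in> I") simp_all
qed

context doubling_space
begin

section \<open>The scalar maximal inequality\<close>

lemma sum_indicator_first_maximizer:
  fixes a :: "int \<Rightarrow> 'x \<Rightarrow> ennreal"
  assumes "finite J" "J \<noteq> {}"
  defines "m \<equiv> \<lambda>x. SUP n\<in>J. a n x"
  shows "(\<Sum>n\<in>J. indicator {x. a n x = m x \<and> (\<forall>j\<in>J. j < n \<longrightarrow> a j x \<noteq> m x)} x) = (1 :: ennreal)"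
proof -
  \<comment> \<open>A collects the maximizing indices at x. Ties are broken in favour of the least
    one, so exactly one of the indicators is 1.\<close>
  define A where "A = {n\<in>J. a n x = m x}"
  have "m x = Max ((\<lambda>n. a n x) ` J)"
    unfolding m_def using assms by (subst Max_Sup) auto
  moreover have "Max ((\<lambda>n. a n x) ` J) \<in> (\<lambda>n. a n x) ` J"
    using assms by (intro Max_in) auto
  ultimately have A: "A \<noteq> {}" "finite A" using assms(1) by (auto simp: A_def)
  have "indicator {x. a n x = m x \<and> (\<forall>j\<in>J. j < n \<longrightarrow> a j x \<noteq> m x)} x =
      (if n = Min A then 1 else 0 :: ennreal)" if "n \<in> J" for n
  proof -
    have "(a n x = m x \<and> (\<forall>j\<in>J. j < n \<longrightarrow> a j x \<noteq> m x)) \<longleftrightarrow> n = Min A"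
    proof
      assume "a n x = m x \<and> (\<forall>j\<in>J. j < n \<longrightarrow> a j x \<noteq> m x)"
      then show "n = Min A"
        using A that by (intro Min_eqI[symmetric]) (auto simp: A_def not_less[symmetric])
    next
      assume n: "n = Min A"
      then have "n \<in> A" using A by simp
      moreover have "n \<le> j" if "j \<in> A" for j using A that n by simp
      ultimately show "a n x = m x \<and> (\<forall>j\<in>J. j < n \<longrightarrow> a j x \<noteq> m x)"
        by (auto simp: A_def not_less[symmetric])
    qed
    then show ?thesis by (simp add: indicator_def)
  qed
  moreover have "Min A \<in> J" using A Min_in[of A] by (auto simp: A_def)
  ultimately show ?thesis
    using assms(1) by (simp cong: sum.cong)
qed

text \<open>The weights \<open>w n\<close> = 1 on \<open>E n\<close> times m^(v-1) add up to
  m^(v-1), and the conjugate exponent s turns this back into m^v. After duality, Young's inequality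
  and the bound for sums of averages in L^s therefore return a small multiple of the integral of
  m^v, which is absorbed.\<close>

lemma nn_integral_maximal_ball_avg:
  assumes v: "1 < v"
  obtains K where "0 < K"
    "\<And>(J :: int set) (h :: 'a \<Rightarrow> ennreal) R. finite J \<Longrightarrow> h \<in> borel_measurable M \<Longrightarrow> 0 < R \<Longrightarrow>
      (\<integral>\<^sup>+x. ennpowr (SUP n\<in>J. ball_avg M (R * 2 powi (- n)) h x) v \<partial>M) \<le>
        ennreal K * (\<integral>\<^sup>+x. ennpowr (h x) v \<partial>M)"
proof -
  define s where "s = v / (v - 1)"
  have s: "1 \<le> s" using v by (simp add: s_def field_simps)
  obtain K' where K': "0 < K'" "\<And>(J :: int set) (g :: int \<Rightarrow> 'a \<Rightarrow> ennreal) R. finite J \<Longrightarrow>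
      (\<And>j. g j \<in> borel_measurable M) \<Longrightarrow> 0 < R \<Longrightarrow>
      (\<integral>\<^sup>+x. ennpowr (\<Sum>j\<in>J. ball_avg M (R * 2 powi (- j)) (g j) x) s \<partial>M) \<le>
        ennreal K' * (\<integral>\<^sup>+x. ennpowr (\<Sum>j\<in>J. g j x) s \<partial>M)"
    using nn_integral_sum_ball_avg[OF s] by blast
  \<comment> \<open>Makes the coefficient c * e * K' of the absorbed integral equal to 1/2.\<close>
  define e where "e = 1 / (2 * c * K')"
  have e: "0 < e" using c_gt_1 K' by (simp add: e_def)
  define K where "K = 2 * (c * e powr (1 - v))"
  show thesis
  proof
    show "0 < K" using c_gt_1 e by (simp add: K_def)
    fix J :: "int set" and h :: "'a \<Rightarrow> ennreal" and R :: real
    assume J: "finite J" and [measurable]: "h \<in> borel_measurable M" and R: "0 < R"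
    define a where "a n = ball_avg M (R * 2 powi (- n)) h" for n
    define m where "m x = (SUP n\<in>J. a n x)" for x
    define Q where "Q = (\<integral>\<^sup>+x. ennpowr (h x) v \<partial>M)"
    have [measurable]: "a n \<in> borel_measurable M" for n unfolding a_def by measurable
    have [measurable]: "m \<in> borel_measurable M"
      unfolding m_def using J by (intro borel_measurable_SUP) (auto intro: countable_finite)
    have "(\<integral>\<^sup>+x. ennpowr (m x) v \<partial>M) \<le> ennreal K * Q"
    proof (cases "Q = top \<or> J = {}")
      case True
      then show ?thesis
        using \<open>0 < K\<close> by (auto simp: ennreal_mult_top m_def bot_ennreal)
    next
      case False
      define E where "E n = {x. a n x = m x \<and> (\<forall>j\<in>J. j < n \<longrightarrow> a j x \<noteq> m x)}" for n
      define w where "w n x = indicator (E n) x * ennpowr (m x) (v - 1)" for n x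
      have sum_E: "(\<Sum>n\<in>J. indicator (E n) x) = (1 :: ennreal)" for x
        using sum_indicator_first_maximizer[of J a x] J False by (simp add: E_def m_def)
      have [measurable]: "E n \<in> sets M" for n
      proof -
        have "E n = {x\<in>space M. a n x = m x \<and> (\<forall>j\<in>J \<inter> {..<n}. a j x \<noteq> m x)}"
          by (auto simp: E_def space_eq)
        also have "\<dots> \<in> sets M"
          using J by (intro sets.sets_Collect_conj sets.sets_Collect_finite_All) auto
        finally show ?thesis .
      qed
      have [measurable]: "w n \<in> borel_measurable M" for n unfolding w_def by measurable
      have sum_w: "(\<Sum>n\<in>J. w n x) = ennpowr (m x) (v - 1)" for x
        unfolding w_def sum_distrib_right[symmetric] sum_E by simp
      define S where "S x = (\<Sum>n\<in>J. ball_avg M (R * 2 powi (- n)) (w n) x)" for x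
      \<comment> \<open>T^(v-1) = S and T^v = S^s are the two forms in which T enters Young's
        inequality.\<close>
      define T where "T x = ennpowr (S x) (1 / (v - 1))" for x
      have [measurable]: "S \<in> borel_measurable M" "T \<in> borel_measurable M"
        unfolding T_def S_def by measurable
      have "(\<integral>\<^sup>+x. ennpowr (m x) v \<partial>M) = (\<integral>\<^sup>+x. (\<Sum>n\<in>J. a n x * w n x) \<partial>M)"
      proof (intro nn_integral_cong)
        fix x
        have "(\<Sum>n\<in>J. a n x * w n x) = (\<Sum>n\<in>J. m x * w n x)"
          by (intro sum.cong) (auto simp: w_def E_def indicator_def)
        also have "\<dots> = m x * ennpowr (m x) (v - 1)"
          by (simp add: sum_w flip: sum_distrib_left)
        finally show "ennpowr (m x) v = (\<Sum>n\<in>J. a n x * w n x)"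
          by (simp add: ennpowr_Suc)
      qed
      also have "\<dots> = (\<Sum>n\<in>J. \<integral>\<^sup>+x. a n x * w n x \<partial>M)"
        by (rule nn_integral_sum) measurable
      also have "\<dots> \<le> (\<Sum>n\<in>J. ennreal c * (\<integral>\<^sup>+x. h x * ball_avg M (R * 2 powi (- n)) (w n) x \<partial>M))"
        unfolding a_def using R by (intro sum_mono ball_avg_duality) auto
      also have "\<dots> = ennreal c * (\<integral>\<^sup>+x. h x * ennpowr (T x) (v - 1) \<partial>M)"
      proof -
        have "(\<integral>\<^sup>+x. h x * ennpowr (T x) (v - 1) \<partial>M) =
            (\<integral>\<^sup>+x. (\<Sum>n\<in>J. h x * ball_avg M (R * 2 powi (- n)) (w n) x) \<partial>M)"
          using v by (simp add: S_def T_def sum_distrib_left)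
        also have "\<dots> = (\<Sum>n\<in>J. \<integral>\<^sup>+x. h x * ball_avg M (R * 2 powi (- n)) (w n) x \<partial>M)"
          by (rule nn_integral_sum) measurable
        finally show ?thesis by (simp add: sum_distrib_left)
      qed
      also have "\<dots> \<le> ennreal c * (\<integral>\<^sup>+x. ennreal (e powr (1 - v)) * ennpowr (h x) v +
          ennreal e * ennpowr (T x) v \<partial>M)"
        using e v by (intro mult_left_mono nn_integral_mono young_ennpowr) auto
      also have "\<dots> = ennreal c * (ennreal (e powr (1 - v)) * Q + ennreal e * (\<integral>\<^sup>+x. ennpowr (T x) v \<partial>M))"
        unfolding Q_def by (simp add: nn_integral_add nn_integral_cmult)
      also have "(\<integral>\<^sup>+x. ennpowr (T x) v \<partial>M) \<le> ennreal K' * (\<integral>\<^sup>+x. ennpowr (m x) v \<partial>M)"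
      proof -
        have "(\<integral>\<^sup>+x. ennpowr (T x) v \<partial>M) = (\<integral>\<^sup>+x. ennpowr (S x) s \<partial>M)"
          by (simp add: T_def s_def ennpowr_ennpowr)
        also have "\<dots> \<le> ennreal K' * (\<integral>\<^sup>+x. ennpowr (\<Sum>n\<in>J. w n x) s \<partial>M)"
          unfolding S_def using J R by (intro K') auto
        also have "\<dots> = ennreal K' * (\<integral>\<^sup>+x. ennpowr (m x) v \<partial>M)"
          using v by (simp add: sum_w s_def ennpowr_ennpowr)
        finally show ?thesis .
      qed
      finally have "(\<integral>\<^sup>+x. ennpowr (m x) v \<partial>M) \<le>
          ennreal c * (ennreal (e powr (1 - v)) * Q + ennreal e * (ennreal K' * (\<integral>\<^sup>+x. ennpowr (m x) v \<partial>M)))"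
        by (simp add: mult_left_mono add_left_mono)
      also have "\<dots> = ennreal (c * e powr (1 - v)) * Q + ennreal (c * e * K') * (\<integral>\<^sup>+x. ennpowr (m x) v \<partial>M)"
        using c_gt_1 K' e by (simp add: ennreal_mult distrib_left mult.assoc)
      also have "c * e * K' = 1/2" using c_gt_1 K' by (simp add: e_def)
      finally have absorb: "(\<integral>\<^sup>+x. ennpowr (m x) v \<partial>M) \<le>
          ennreal (c * e powr (1 - v)) * Q + ennreal (1/2) * (\<integral>\<^sup>+x. ennpowr (m x) v \<partial>M)" .
      \<comment> \<open>A priori finiteness: the largest of finitely many powers is at most their
        sum, at a cost that depends on J.\<close>
      have "(\<integral>\<^sup>+x. ennpowr (m x) v \<partial>M) \<le> (\<integral>\<^sup>+x. (\<Sum>n\<in>J. ennpowr (a n x) v) \<partial>M)"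
        unfolding m_def using v J by (intro nn_integral_mono) (auto simp: ennpowr_SUP intro!: SUP_least member_le_sum)
      also have "\<dots> = (\<Sum>n\<in>J. \<integral>\<^sup>+x. ennpowr (a n x) v \<partial>M)"
        by (rule nn_integral_sum) measurable
      also have "\<dots> \<le> (\<Sum>n\<in>J. ennreal (2 powr v * c) * Q)"
        unfolding Q_def a_def using v R by (intro sum_mono nn_integral_ennpowr_ball_avg_le) auto
      also have "\<dots> < top"
        using False by (simp add: ennreal_mult_less_top less_top of_nat_less_top)
      finally have "(\<integral>\<^sup>+x. ennpowr (m x) v \<partial>M) < top" .
      from ennreal_absorb[OF absorb this] show ?thesis
        using c_gt_1 by (simp add: K_def ennreal_mult mult.assoc)
    qed
    then show "(\<integral>\<^sup>+x. ennpowr (SUP n\<in>J. ball_avg M (R * 2 powi (- n)) h x) v \<partial>M) \<le>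
        ennreal K * (\<integral>\<^sup>+x. ennpowr (h x) v \<partial>M)"
      by (simp add: m_def a_def Q_def)
  qed
qed

end

section \<open>The vector-valued averaging inequality\<close>

context doubling_space
begin

text \<open>For t \<le> p, Jensen's inequality moves the power t inside each average, and the bound
  for sums of averages applies to h^t in L^(p/t), because p/t \<ge> 1.\<close>

lemma lq_norm_ball_avg_large_p:
  assumes t: "1 < t" "t \<le> p"
  obtains K where "0 < K"
    "\<And>(J :: int set) (h :: int \<Rightarrow> 'a \<Rightarrow> ennreal) R. finite J \<Longrightarrow>
      (\<And>j. h j \<in> borel_measurable M) \<Longrightarrow> 0 < R \<Longrightarrow>
      (\<integral>\<^sup>+x. ennpowr (\<Sum>n\<in>J. ennpowr (ball_avg M (R * 2 powi (- n)) (h n) x) t) (p / t) \<partial>M) \<le>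
        ennreal K * (\<integral>\<^sup>+x. ennpowr (\<Sum>n\<in>J. ennpowr (h n x) t) (p / t) \<partial>M)"
proof -
  have s: "1 \<le> p / t" using t by simp
  obtain K where K: "0 < K" "\<And>(J :: int set) (g :: int \<Rightarrow> 'a \<Rightarrow> ennreal) R. finite J \<Longrightarrow>
      (\<And>j. g j \<in> borel_measurable M) \<Longrightarrow> 0 < R \<Longrightarrow>
      (\<integral>\<^sup>+x. ennpowr (\<Sum>j\<in>J. ball_avg M (R * 2 powi (- j)) (g j) x) (p / t) \<partial>M) \<le>
        ennreal K * (\<integral>\<^sup>+x. ennpowr (\<Sum>j\<in>J. g j x) (p / t) \<partial>M)"
    using nn_integral_sum_ball_avg[OF s] by blast
  show thesis
  proof
    show "0 < 2 powr p * K" using K by simp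
    fix J :: "int set" and h :: "int \<Rightarrow> 'a \<Rightarrow> ennreal" and R :: real
    assume J: "finite J" and [measurable]: "\<And>j. h j \<in> borel_measurable M" and R: "0 < R"
    define g where "g n x = ennpowr (h n x) t" for n x
    have [measurable]: "g n \<in> borel_measurable M" for n unfolding g_def by measurable
    have "(\<integral>\<^sup>+x. ennpowr (\<Sum>n\<in>J. ennpowr (ball_avg M (R * 2 powi (- n)) (h n) x) t) (p / t) \<partial>M) \<le>
        (\<integral>\<^sup>+x. ennreal (2 powr p) * ennpowr (\<Sum>n\<in>J. ball_avg M (R * 2 powi (- n)) (g n) x) (p / t) \<partial>M)"
    proof (intro nn_integral_mono)
      fix x
      have "(\<Sum>n\<in>J. ennpowr (ball_avg M (R * 2 powi (- n)) (h n) x) t) \<le>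
          (\<Sum>n\<in>J. ennreal (2 powr t) * ball_avg M (R * 2 powi (- n)) (g n) x)"
        unfolding g_def using t R by (intro sum_mono ennpowr_ball_avg_le) auto
      then have "ennpowr (\<Sum>n\<in>J. ennpowr (ball_avg M (R * 2 powi (- n)) (h n) x) t) (p / t) \<le>
          ennpowr (ennreal (2 powr t) * (\<Sum>n\<in>J. ball_avg M (R * 2 powi (- n)) (g n) x)) (p / t)"
        using t unfolding sum_distrib_left by (rule_tac ennpowr_mono) auto
      also have "\<dots> = ennreal (2 powr p) * ennpowr (\<Sum>n\<in>J. ball_avg M (R * 2 powi (- n)) (g n) x) (p / t)"
        using t by (simp add: ennpowr_mult ennpowr_ennreal powr_powr)
      finally show "ennpowr (\<Sum>n\<in>J. ennpowr (ball_avg M (R * 2 powi (- n)) (h n) x) t) (p / t) \<le> \<dots>" .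
    qed
    also have "\<dots> = ennreal (2 powr p) *
        (\<integral>\<^sup>+x. ennpowr (\<Sum>n\<in>J. ball_avg M (R * 2 powi (- n)) (g n) x) (p / t) \<partial>M)"
      by (rule nn_integral_cmult) measurable
    also have "\<dots> \<le> ennreal (2 powr p) * (ennreal K * (\<integral>\<^sup>+x. ennpowr (\<Sum>n\<in>J. g n x) (p / t) \<partial>M))"
      using J R by (intro mult_left_mono K) auto
    finally show "(\<integral>\<^sup>+x. ennpowr (\<Sum>n\<in>J. ennpowr (ball_avg M (R * 2 powi (- n)) (h n) x) t) (p / t) \<partial>M) \<le>
        ennreal (2 powr p * K) * (\<integral>\<^sup>+x. ennpowr (\<Sum>n\<in>J. ennpowr (h n x) t) (p / t) \<partial>M)"
      using K by (simp add: g_def ennreal_mult mult.assoc)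
  qed
qed

text \<open>For \<open>p < t\<close>, write \<open>F\<close> for the pointwise \<open>l\<^sup>t\<close> norm of \<open>h\<close>. Hoelder's inequality with the weight
  \<open>X = F powr ((t - p) / (t - 1))\<close> separates a scalar maximal function from the averages of
  \<open>w n = h n powr t * F powr (p - t)\<close>, which sum to \<open>F powr p\<close>.\<close>
lemma lq_norm_ball_avg_small_p:
  assumes p: "1 < p" "p < t"
  obtains K where "0 < K"
    "\<And>(J :: int set) (h :: int \<Rightarrow> 'a \<Rightarrow> ennreal) R. finite J \<Longrightarrow>
      (\<And>j. h j \<in> borel_measurable M) \<Longrightarrow> 0 < R \<Longrightarrow>
      (\<integral>\<^sup>+x. ennpowr (\<Sum>n\<in>J. ennpowr (ball_avg M (R * 2 powi (- n)) (h n) x) t) (p / t) \<partial>M) \<le>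
        ennreal K * (\<integral>\<^sup>+x. ennpowr (\<Sum>n\<in>J. ennpowr (h n x) t) (p / t) \<partial>M)"
proof -
  \<comment> \<open>v is determined by \<alpha> v = p, which gives X^v = F^p. That v > 1 comes from
    (t - 1) p - (t - p) = t (p - 1) and p > 1.\<close>
  define v where "v = (t - 1) * p / (t - p)"
  define \<alpha> where "\<alpha> = (t - p) / (t - 1)"
  have "t - p < (t - 1) * p"
  proof -
    have "(t - 1) * p - (t - p) = t * (p - 1)" by (simp add: algebra_simps)
    moreover have "0 < t * (p - 1)" using p by (intro mult_pos_pos) auto
    ultimately show ?thesis by linarith
  qed
  then have v: "1 < v" using p by (simp add: v_def)
  have \<alpha>v: "\<alpha> * v = p" using p by (simp add: v_def \<alpha>_def)
  obtain K where K: "0 < K" "\<And>(J :: int set) (h :: 'a \<Rightarrow> ennreal) R. finite J \<Longrightarrow>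
      h \<in> borel_measurable M \<Longrightarrow> 0 < R \<Longrightarrow>
      (\<integral>\<^sup>+x. ennpowr (SUP n\<in>J. ball_avg M (R * 2 powi (- n)) h x) v \<partial>M) \<le>
        ennreal K * (\<integral>\<^sup>+x. ennpowr (h x) v \<partial>M)"
    using nn_integral_maximal_ball_avg[OF v] by blast
  show thesis
  proof
    show "0 < 2 powr p * (K + c)" using K c_gt_1 by simp
    fix J :: "int set" and h :: "int \<Rightarrow> 'a \<Rightarrow> ennreal" and R :: real
    assume J: "finite J" and [measurable]: "\<And>j. h j \<in> borel_measurable M" and R: "0 < R"
    define F where "F x = ennpowr (\<Sum>n\<in>J. ennpowr (h n x) t) (1 / t)" for x
    define X where "X x = ennpowr (F x) \<alpha>" for x
    define w where "w n x = ennpowr (h n x) t * ennpowr (F x) (p - t)" for n x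
    define m where "m x = (SUP n\<in>J. ball_avg M (R * 2 powi (- n)) X x)" for x
    define S where "S x = (\<Sum>n\<in>J. ball_avg M (R * 2 powi (- n)) (w n) x)" for x
    have [measurable]: "F \<in> borel_measurable M" unfolding F_def by measurable
    have [measurable]: "X \<in> borel_measurable M" unfolding X_def by measurable
    have [measurable]: "w n \<in> borel_measurable M" for n unfolding w_def by measurable
    have [measurable]: "S \<in> borel_measurable M" unfolding S_def by measurable
    have [measurable]: "m \<in> borel_measurable M"
      unfolding m_def using J by (intro borel_measurable_SUP) (auto intro: countable_finite)
    have F_t: "ennpowr (F x) t = (\<Sum>n\<in>J. ennpowr (h n x) t)" for x
      using p by (simp add: F_def)
    have F_p: "ennpowr (F x) p = ennpowr (\<Sum>n\<in>J. ennpowr (h n x) t) (p / t)" for x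
      by (simp add: F_def ennpowr_ennpowr)
    have sum_w: "(\<Sum>n\<in>J. w n x) = ennpowr (F x) p" for x
      unfolding w_def sum_distrib_right[symmetric] F_t[symmetric] by (simp add: ennpowr_add)
    have hoelder: "ennpowr (h n x) t \<le> ennpowr (X x) (t - 1) * w n x" if "n \<in> J" for n x
    proof -
      have eq: "ennpowr (X x) (t - 1) * w n x = ennpowr (h n x) t * ennpowr (F x) 0"
      proof -
        have "ennpowr (X x) (t - 1) = ennpowr (F x) (t - p)"
          using p by (simp add: X_def \<alpha>_def ennpowr_ennpowr)
        moreover have "ennpowr (F x) (t - p) * ennpowr (F x) (p - t) = ennpowr (F x) 0"
          by (simp add: ennpowr_add)
        ultimately show ?thesis by (simp add: w_def mult.left_commute)
      qed
      \<comment> \<open>If F x = 0, the negative power of F is 0 by convention and the right side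
        vanishes, but so does \<open>h n x\<close>. Otherwise the power 0 of F is 1 or
        \<open>top\<close>.\<close>
      show ?thesis
      proof (cases "F x = 0")
        case True
        then have "(\<Sum>n\<in>J. ennpowr (h n x) t) = 0" by (simp add: F_def)
        then show ?thesis using that J by simp
      next
        case False
        then have "1 \<le> ennpowr (F x) 0"
          by (cases "F x") (auto simp: ennpowr_ennreal)
        then have "ennpowr (h n x) t * 1 \<le> ennpowr (h n x) t * ennpowr (F x) 0"
          by (intro mult_left_mono) auto
        then show ?thesis by (simp add: eq)
      qed
    qed
    have pointwise: "ennpowr (\<Sum>n\<in>J. ennpowr (ball_avg M (R * 2 powi (- n)) (h n) x) t) (p / t) \<le>
        ennreal (2 powr p) * (ennpowr (m x) v + S x)" for x
    proof -
      have "(\<Sum>n\<in>J. ennpowr (ball_avg M (R * 2 powi (- n)) (h n) x) t) \<le>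
          (\<Sum>n\<in>J. ennreal (2 powr t) * (ennpowr (m x) (t - 1) * ball_avg M (R * 2 powi (- n)) (w n) x))"
      proof (intro sum_mono)
        fix n assume n: "n \<in> J"
        have "ennpowr (ball_avg M (R * 2 powi (- n)) (h n) x) t \<le> ennreal (2 powr t) *
            (ennpowr (ball_avg M (R * 2 powi (- n)) X x) (t - 1) * ball_avg M (R * 2 powi (- n)) (w n) x)"
          using p by (intro ennpowr_ball_avg_le_hoelder hoelder n) auto
        also have "\<dots> \<le> ennreal (2 powr t) * (ennpowr (m x) (t - 1) * ball_avg M (R * 2 powi (- n)) (w n) x)"
          unfolding m_def using p n by (intro mult_left_mono mult_right_mono ennpowr_mono SUP_upper) auto
        finally show "ennpowr (ball_avg M (R * 2 powi (- n)) (h n) x) t \<le> \<dots>" .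
      qed
      also have "\<dots> = ennreal (2 powr t) * (ennpowr (m x) (t - 1) * S x)"
        by (simp add: S_def sum_distrib_left)
      finally have "ennpowr (\<Sum>n\<in>J. ennpowr (ball_avg M (R * 2 powi (- n)) (h n) x) t) (p / t) \<le>
          ennpowr (ennreal (2 powr t) * (ennpowr (m x) (t - 1) * S x)) (p / t)"
        using p by (rule_tac ennpowr_mono) auto
      also have "\<dots> = ennreal (2 powr p) * (ennpowr (ennpowr (m x) v) (1 - p / t) * ennpowr (S x) (p / t))"
      proof -
        \<comment> \<open>The powers of m^v and S thus have exponents adding up to 1, and the
          geometric mean splits into two quantities with integrals bounded by that of F^p.\<close>
        have "v * (1 - p / t) = (t - 1) * (p / t)"
          using p by (simp add: v_def field_simps)
        then show ?thesis
          using p by (simp add: ennpowr_mult ennpowr_ennreal powr_powr ennpowr_ennpowr)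
      qed
      also have "\<dots> \<le> ennreal (2 powr p) * (ennpowr (m x) v + S x)"
        using ennpowr_geometric_mean_le[of "1 - p / t" "p / t" "ennpowr (m x) v" "S x"] p
        by (intro mult_left_mono) auto
      finally show ?thesis .
    qed
    have "(\<integral>\<^sup>+x. ennpowr (m x) v \<partial>M) \<le> ennreal K * (\<integral>\<^sup>+x. ennpowr (X x) v \<partial>M)"
      unfolding m_def using J R by (intro K) auto
    then have m_le: "(\<integral>\<^sup>+x. ennpowr (m x) v \<partial>M) \<le> ennreal K * (\<integral>\<^sup>+x. ennpowr (F x) p \<partial>M)"
      by (simp add: X_def ennpowr_ennpowr \<alpha>v)
    have "(\<integral>\<^sup>+x. S x \<partial>M) = (\<Sum>n\<in>J. \<integral>\<^sup>+x. ball_avg M (R * 2 powi (- n)) (w n) x \<partial>M)"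
      unfolding S_def by (rule nn_integral_sum) measurable
    also have "\<dots> \<le> (\<Sum>n\<in>J. ennreal c * (\<integral>\<^sup>+x. w n x \<partial>M))"
      using R by (intro sum_mono nn_integral_ball_avg_le) auto
    also have "\<dots> = ennreal c * (\<integral>\<^sup>+x. ennpowr (F x) p \<partial>M)"
      unfolding sum_distrib_left[symmetric] by (simp add: sum_w flip: nn_integral_sum)
    finally have S_le: "(\<integral>\<^sup>+x. S x \<partial>M) \<le> ennreal c * (\<integral>\<^sup>+x. ennpowr (F x) p \<partial>M)" .
    have "(\<integral>\<^sup>+x. ennpowr (\<Sum>n\<in>J. ennpowr (ball_avg M (R * 2 powi (- n)) (h n) x) t) (p / t) \<partial>M) \<le>
        (\<integral>\<^sup>+x. ennreal (2 powr p) * (ennpowr (m x) v + S x) \<partial>M)"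
      by (intro nn_integral_mono pointwise)
    also have "\<dots> = ennreal (2 powr p) * ((\<integral>\<^sup>+x. ennpowr (m x) v \<partial>M) + (\<integral>\<^sup>+x. S x \<partial>M))"
      by (simp add: nn_integral_cmult nn_integral_add)
    also have "\<dots> \<le> ennreal (2 powr p) * (ennreal K * (\<integral>\<^sup>+x. ennpowr (F x) p \<partial>M) +
        ennreal c * (\<integral>\<^sup>+x. ennpowr (F x) p \<partial>M))"
      by (intro mult_left_mono add_mono m_le S_le) auto
    finally show "(\<integral>\<^sup>+x. ennpowr (\<Sum>n\<in>J. ennpowr (ball_avg M (R * 2 powi (- n)) (h n) x) t) (p / t) \<partial>M) \<le>
        ennreal (2 powr p * (K + c)) * (\<integral>\<^sup>+x. ennpowr (\<Sum>n\<in>J. ennpowr (h n x) t) (p / t) \<partial>M)"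
      using K c_gt_1 by (simp add: F_p ennreal_mult ennreal_plus distrib_right mult.assoc)
  qed
qed

text \<open>For q = \<open>top\<close> each average of \<open>h n\<close> is below the average of
  the supremum of all of them, so the scalar maximal inequality suffices. For finite q the two
  ranges of the exponent are combined.\<close>

lemma lq_norm_ball_avg_finite:
  assumes p: "1 < p" and q: "1 < q"
  obtains K where "0 < K"
    "\<And>(J :: int set) (h :: int \<Rightarrow> 'a \<Rightarrow> ennreal) R. finite J \<Longrightarrow>
      (\<And>j. h j \<in> borel_measurable M) \<Longrightarrow> 0 < R \<Longrightarrow>
      (\<integral>\<^sup>+x. ennpowr (lq_norm J q (\<lambda>n. ball_avg M (R * 2 powi (- n)) (h n) x)) p \<partial>M) \<le>
        ennreal K * (\<integral>\<^sup>+x. ennpowr (lq_norm J q (\<lambda>n. h n x)) p \<partial>M)"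
proof (cases "q = top")
  case True
  obtain K where K: "0 < K" "\<And>(J :: int set) (h :: 'a \<Rightarrow> ennreal) R. finite J \<Longrightarrow>
      h \<in> borel_measurable M \<Longrightarrow> 0 < R \<Longrightarrow>
      (\<integral>\<^sup>+x. ennpowr (SUP n\<in>J. ball_avg M (R * 2 powi (- n)) h x) p \<partial>M) \<le>
        ennreal K * (\<integral>\<^sup>+x. ennpowr (h x) p \<partial>M)"
    using nn_integral_maximal_ball_avg[OF p] by blast
  show thesis
  proof
    show "0 < K" by fact
    fix J :: "int set" and h :: "int \<Rightarrow> 'a \<Rightarrow> ennreal" and R :: real
    assume J: "finite J" and [measurable]: "\<And>j. h j \<in> borel_measurable M" and R: "0 < R"
    have "(\<integral>\<^sup>+x. ennpowr (lq_norm J q (\<lambda>n. ball_avg M (R * 2 powi (- n)) (h n) x)) p \<partial>M) \<le>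
        (\<integral>\<^sup>+x. ennpowr (SUP n\<in>J. ball_avg M (R * 2 powi (- n)) (\<lambda>y. SUP n\<in>J. h n y) x) p \<partial>M)"
      unfolding True lq_norm_top using p
      by (intro nn_integral_mono ennpowr_mono SUP_mono) (auto intro!: ball_avg_mono SUP_upper bexI)
    also have "\<dots> \<le> ennreal K * (\<integral>\<^sup>+x. ennpowr (SUP n\<in>J. h n x) p \<partial>M)"
      using J R by (intro K borel_measurable_SUP) (auto intro: countable_finite)
    finally show "(\<integral>\<^sup>+x. ennpowr (lq_norm J q (\<lambda>n. ball_avg M (R * 2 powi (- n)) (h n) x)) p \<partial>M) \<le>
        ennreal K * (\<integral>\<^sup>+x. ennpowr (lq_norm J q (\<lambda>n. h n x)) p \<partial>M)"
      unfolding True lq_norm_top .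
  qed
next
  case False
  define t where "t = enn2real q"
  have t: "1 < t" using enn2real_gt_1[OF q False] by (simp add: t_def)
  obtain K where K: "0 < K" "\<And>(J :: int set) (h :: int \<Rightarrow> 'a \<Rightarrow> ennreal) R. finite J \<Longrightarrow>
      (\<And>j. h j \<in> borel_measurable M) \<Longrightarrow> 0 < R \<Longrightarrow>
      (\<integral>\<^sup>+x. ennpowr (\<Sum>n\<in>J. ennpowr (ball_avg M (R * 2 powi (- n)) (h n) x) t) (p / t) \<partial>M) \<le>
        ennreal K * (\<integral>\<^sup>+x. ennpowr (\<Sum>n\<in>J. ennpowr (h n x) t) (p / t) \<partial>M)"
  proof (cases "t \<le> p")
    case True
    show ?thesis using lq_norm_ball_avg_large_p[OF t True] that by blast
  next
    case False
    then have "p < t" by simp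
    show ?thesis using lq_norm_ball_avg_small_p[OF p \<open>p < t\<close>] that by blast
  qed
  show thesis
    by (rule that[OF K(1)])
      (use K(2) False in \<open>simp add: lq_norm_finite_exponent ennpowr_ennpowr flip: t_def\<close>)
qed

abbreviation lpq :: "real \<Rightarrow> ennreal \<Rightarrow> (int \<Rightarrow> 'a \<Rightarrow> ennreal) \<Rightarrow> ennreal" where
  "lpq p q h \<equiv> (\<integral>\<^sup>+x. ennpowr (lq_norm UNIV q (\<lambda>n. h n x)) p \<partial>M)"

text \<open>Monotone convergence along the scales from -N to N, possible because the constant for
  finite sets of scales is uniform in them.\<close>

lemma lq_norm_ball_avg:
  assumes p: "1 < p" and q: "1 < q"
  obtains K where "0 < K"
    "\<And>(h :: int \<Rightarrow> 'a \<Rightarrow> ennreal) R. (\<And>j. h j \<in> borel_measurable M) \<Longrightarrow> 0 < R \<Longrightarrow>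
      lpq p q (\<lambda>n. ball_avg M (R * 2 powi (- n)) (h n)) \<le>
        ennreal K * lpq p q h"
proof -
  obtain K where K: "0 < K" "\<And>(J :: int set) (h :: int \<Rightarrow> 'a \<Rightarrow> ennreal) R. finite J \<Longrightarrow>
      (\<And>j. h j \<in> borel_measurable M) \<Longrightarrow> 0 < R \<Longrightarrow>
      (\<integral>\<^sup>+x. ennpowr (lq_norm J q (\<lambda>n. ball_avg M (R * 2 powi (- n)) (h n) x)) p \<partial>M) \<le>
        ennreal K * (\<integral>\<^sup>+x. ennpowr (lq_norm J q (\<lambda>n. h n x)) p \<partial>M)"
    using lq_norm_ball_avg_finite[OF p q] by blast
  show thesis
  proof (rule that[OF K(1)])
    fix h :: "int \<Rightarrow> 'a \<Rightarrow> ennreal" and R :: real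
    assume [measurable]: "\<And>j. h j \<in> borel_measurable M" and R: "0 < R"
    define b where "b n x = ball_avg M (R * 2 powi (- n)) (h n) x" for n x
    define L where "L N x = ennpowr (lq_norm {- int N..int N} q (\<lambda>n. b n x)) p" for N x
    have [measurable]: "b n \<in> borel_measurable M" for n unfolding b_def by measurable
    have [measurable]: "L N \<in> borel_measurable M" for N
      unfolding L_def by (intro borel_measurable_ennpowr borel_measurable_lq_norm q) auto
    have "(\<integral>\<^sup>+x. ennpowr (lq_norm UNIV q (\<lambda>n. b n x)) p \<partial>M) = (\<integral>\<^sup>+x. (SUP N. L N x) \<partial>M)"
      using p q by (simp add: L_def lq_norm_UNIV_SUP ennpowr_SUP)
    also have "\<dots> = (SUP N. \<integral>\<^sup>+x. L N x \<partial>M)"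
    proof (rule nn_integral_monotone_convergence_SUP)
      show "incseq L"
        unfolding L_def using p q by (intro monoI le_funI ennpowr_mono lq_norm_mono_set) auto
    qed auto
    also have "\<dots> \<le> ennreal K * lpq p q h"
    proof (rule SUP_least)
      fix N
      have "(\<integral>\<^sup>+x. L N x \<partial>M) \<le> ennreal K * (\<integral>\<^sup>+x. ennpowr (lq_norm {- int N..int N} q (\<lambda>n. h n x)) p \<partial>M)"
        unfolding L_def b_def using R by (intro K) auto
      also have "\<dots> \<le> ennreal K * lpq p q h"
        using p q by (intro mult_left_mono nn_integral_mono ennpowr_mono lq_norm_mono_set) auto
      finally show "(\<integral>\<^sup>+x. L N x \<partial>M) \<le> \<dots>" .
    qed
    finally show "lpq p q (\<lambda>n. ball_avg M (R * 2 powi (- n)) (h n)) \<le>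
        ennreal K * lpq p q h"
      by (simp add: b_def)
  qed
qed

end

section \<open>Dyadic convolution\<close>

abbreviation decay :: "real \<Rightarrow> int \<Rightarrow> real" where
  "decay \<gamma> n \<equiv> 2 powr (- \<gamma> * \<bar>real_of_int n\<bar>)"

text \<open>Two geometric series, one for k \<ge> n and one for k < n; on each side the distance of
  k from n determines k.\<close>

lemma sum_two_powr_abs_diff_le:
  assumes "0 < \<gamma>"
  obtains W :: real where "0 < W"
    "\<And>F (n :: int). finite F \<Longrightarrow> (\<Sum>k\<in>F. decay \<gamma> (n - k)) \<le> W"
proof -
  define \<rho> :: real where "\<rho> = 2 powr (- \<gamma>)"
  have \<rho>: "0 < \<rho>" "\<rho> < 1" using assms by (auto simp: \<rho>_def powr_less_one)
  have half: "(\<Sum>k\<in>F. decay \<gamma> (n - k)) \<le> (\<Sum>i. \<rho> ^ i)"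
    if "finite F" "inj_on (\<lambda>k. nat \<bar>n - k\<bar>) F" for F :: "int set" and n
  proof -
    have "(\<Sum>k\<in>F. decay \<gamma> (n - k)) = (\<Sum>k\<in>F. \<rho> ^ nat \<bar>n - k\<bar>)"
      by (intro sum.cong) (auto simp: \<rho>_def powr_powr simp flip: powr_realpow)
    also have "\<dots> = (\<Sum>i\<in>(\<lambda>k. nat \<bar>n - k\<bar>) ` F. \<rho> ^ i)"
      using that by (simp add: sum.reindex)
    also have "\<dots> \<le> (\<Sum>i. \<rho> ^ i)"
      using that \<rho> by (intro sum_le_suminf summable_geometric) auto
    finally show ?thesis .
  qed
  show thesis
  proof
    show "0 < 2 * (\<Sum>i. \<rho> ^ i)"
      using \<rho> by (simp add: suminf_geometric)
    fix F :: "int set" and n assume F: "finite F"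
    have "(\<Sum>k\<in>F. decay \<gamma> (n - k)) =
        (\<Sum>k\<in>F \<inter> {n..}. decay \<gamma> (n - k)) +
        (\<Sum>k\<in>F \<inter> {..<n}. decay \<gamma> (n - k))"
      using F by (subst sum.union_disjoint[symmetric]) (auto intro!: arg_cong[where f = "sum _"])
    also have "\<dots> \<le> (\<Sum>i. \<rho> ^ i) + (\<Sum>i. \<rho> ^ i)"
      using F by (intro add_mono half) (auto simp: inj_on_def)
    finally show "(\<Sum>k\<in>F. decay \<gamma> (n - k)) \<le> 2 * (\<Sum>i. \<rho> ^ i)" by simp
  qed
qed

text \<open>With a supremum in place of the convolution sum, the t-th power passes inside and is at
  most the sum of the t-th powers, so an exchange of two sums does the work of Young's convolution
  inequality. Where a genuine sum over scales occurs, half of the decay is spent on summing and half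
  is kept for this supremum.\<close>

lemma lq_norm_SUP_geometric_le:
  assumes "0 < \<gamma>" and q: "1 < q"
  obtains K :: real where "0 < K"
    "\<And>a. lq_norm UNIV q (\<lambda>k. SUP n. ennreal (decay \<gamma> (n - k)) * a n) \<le>
      ennreal K * lq_norm UNIV q a"
proof (cases "q = top")
  case True
  show thesis
  proof
    fix a :: "int \<Rightarrow> ennreal"
    have "ennreal (decay \<gamma> (n - k)) * a n \<le> (SUP k. a k)" for n k
    proof -
      have "decay \<gamma> (n - k) \<le> 2 powr 0"
        using assms by (intro powr_mono) auto
      then have "ennreal (decay \<gamma> (n - k)) * a n \<le> 1 * (SUP k. a k)"
        by (intro mult_mono SUP_upper) (auto simp flip: ennreal_1)
      then show ?thesis by simp
    qed
    then show "lq_norm UNIV q (\<lambda>k. SUP n. ennreal (decay \<gamma> (n - k)) * a n) \<le>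
        ennreal 1 * lq_norm UNIV q a"
      unfolding True lq_norm_top by (auto intro!: SUP_least)
  qed simp
next
  case False
  define t where "t = enn2real q"
  have t: "1 < t" using enn2real_gt_1[OF q False] by (simp add: t_def)
  obtain W :: real where W: "0 < W"
    "\<And>F (n :: int). finite F \<Longrightarrow> (\<Sum>k\<in>F. decay (\<gamma> * t) (n - k)) \<le> W"
    using sum_two_powr_abs_diff_le[of "\<gamma> * t"] assms t by auto
  show thesis
  proof
    show "0 < W powr (1 / t)" using W by simp
    fix a :: "int \<Rightarrow> ennreal"
    define w where "w n k = ennreal (decay (\<gamma> * t) (n - k))" for n k
    define A where "A = (\<Sum>\<^sub>\<infinity>n. ennpowr (a n) t)"
    have "(\<Sum>\<^sub>\<infinity>k. ennpowr (SUP n. ennreal (decay \<gamma> (n - k)) * a n) t) \<le> ennreal W * A"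
    proof (rule infsum_ennreal_le)
      fix F :: "int set" assume F: "finite F"
      have "(\<Sum>k\<in>F. ennpowr (SUP n. ennreal (decay \<gamma> (n - k)) * a n) t) \<le>
          (\<Sum>k\<in>F. SUP N::nat. \<Sum>n\<in>{- int N..int N}. w n k * ennpowr (a n) t)"
      proof (intro sum_mono)
        fix k
        have "ennpowr (SUP n. ennreal (decay \<gamma> (n - k)) * a n) t =
            (SUP n. w n k * ennpowr (a n) t)"
          using t by (simp add: ennpowr_SUP ennpowr_mult ennpowr_ennreal powr_powr w_def mult_ac)
        also have "\<dots> \<le> (\<Sum>\<^sub>\<infinity>n. w n k * ennpowr (a n) t)"
          using sum_le_infsum_ennreal[of "{n}" UNIV "\<lambda>n. w n k * ennpowr (a n) t" for n]
          by (intro SUP_least) auto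
        finally show "ennpowr (SUP n. ennreal (decay \<gamma> (n - k)) * a n) t \<le>
            (SUP N::nat. \<Sum>n\<in>{- int N..int N}. w n k * ennpowr (a n) t)"
          by (simp add: infsum_ennreal_int_SUP)
      qed
      also have "\<dots> = (SUP N::nat. \<Sum>k\<in>F. \<Sum>n\<in>{- int N..int N}. w n k * ennpowr (a n) t)"
        by (rule ennreal_SUP_sum[symmetric]) (auto intro!: incseq_SucI sum_mono2)
      also have "\<dots> \<le> ennreal W * A"
      proof (rule SUP_least)
        fix N :: nat
        have "(\<Sum>k\<in>F. \<Sum>n\<in>{- int N..int N}. w n k * ennpowr (a n) t) =
            (\<Sum>n\<in>{- int N..int N}. (\<Sum>k\<in>F. w n k) * ennpowr (a n) t)"
          by (subst sum.swap) (simp add: sum_distrib_right)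
        also have "\<dots> \<le> (\<Sum>n\<in>{- int N..int N}. ennreal W * ennpowr (a n) t)"
          unfolding w_def using W F by (intro sum_mono mult_right_mono) (auto intro!: ennreal_leI)
        also have "\<dots> \<le> ennreal W * A"
          unfolding A_def sum_distrib_left[symmetric] by (intro mult_left_mono sum_le_infsum_ennreal) auto
        finally show "(\<Sum>k\<in>F. \<Sum>n\<in>{- int N..int N}. w n k * ennpowr (a n) t) \<le> ennreal W * A" .
      qed
      finally show "(\<Sum>k\<in>F. ennpowr (SUP n. ennreal (decay \<gamma> (n - k)) * a n) t) \<le> ennreal W * A" .
    qed
    then have "lq_norm UNIV q (\<lambda>k. SUP n. ennreal (decay \<gamma> (n - k)) * a n) \<le>
        ennpowr (ennreal W * A) (1 / t)"
      unfolding lq_norm_finite_exponent[OF False] t_def[symmetric] using t by (rule_tac ennpowr_mono) auto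
    also have "\<dots> = ennreal (W powr (1 / t)) * lq_norm UNIV q a"
      using W by (simp add: lq_norm_finite_exponent[OF False] A_def t_def ennpowr_mult ennpowr_ennreal)
    finally show "lq_norm UNIV q (\<lambda>k. SUP n. ennreal (decay \<gamma> (n - k)) * a n) \<le>
        ennreal (W powr (1 / t)) * lq_norm UNIV q a" .
  qed
qed

lemma ennpowr_mixed_norm:
  assumes "p \<noteq> 0" "\<Omega> \<inter> space M \<in> sets M"
  shows "ennpowr (mixed_norm M \<Omega> I p q g) p =
    (\<integral>\<^sup>+x. ennpowr (lq_norm I q (\<lambda>k. g k x)) p * indicator \<Omega> x \<partial>M)"
  using assms by (simp add: mixed_norm_def nn_integral_restrict_space)

section \<open>Lipschitz averages\<close>

text \<open>A Lipschitz cutoff: 1 at distances up to 2^(-n), 0 from 2 * 2^(-n) on, with Lipschitz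
  constant 2^n.\<close>

definition bump :: "int \<Rightarrow> 'a::metric_space \<Rightarrow> 'a \<Rightarrow> real" where
  "bump n x y = max 0 (min 1 (2 - 2 powi n * dist x y))"

text \<open>The volume is taken at y as in the kernel of the potential, so x enters only through the
  Lipschitz factor. The result dominates one scale of the potential and is continuous once the
  weighted integral of f is finite.\<close>

definition bump_avg :: "'a::metric_space measure \<Rightarrow> int \<Rightarrow> ('a \<Rightarrow> ennreal) \<Rightarrow> 'a \<Rightarrow> ennreal" where
  "bump_avg M n f x =
     (\<integral>\<^sup>+y. ennreal (bump n x y) * (f y / emeasure M (ball y (2 powi (- n)))) \<partial>M)"

lemma power_int_minus_mult: "(2::real) powi n * 2 powi (- n) = 1"
  by (simp add: power_int_minus)

lemma bump_eq_1: "dist x y < 2 powi (- n) \<Longrightarrow> bump n x y = 1"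
proof -
  assume "dist x y < 2 powi (- n)"
  then have "2 powi n * dist x y \<le> 2 powi n * 2 powi (- n)"
    by (intro mult_left_mono) auto
  then show ?thesis unfolding power_int_minus_mult by (simp add: bump_def)
qed

lemma bump_eq_0: "2 * 2 powi (- n) \<le> dist x y \<Longrightarrow> bump n x y = 0"
proof -
  assume "2 * 2 powi (- n) \<le> dist x y"
  then have "2 powi n * (2 * 2 powi (- n)) \<le> 2 powi n * dist x y"
    by (intro mult_left_mono) auto
  then show ?thesis
    using power_int_minus_mult[of n] by (simp add: bump_def mult.left_commute)
qed

lemma bump_bounds: "0 \<le> bump n x y" "bump n x y \<le> 1"
  by (simp_all add: bump_def)

text \<open>Off the first ball the left side is 0; on it an indicator is 1 and the Lipschitz bound
  applies, capped at 1 since \<open>bump\<close> lies between 0 and 1. The indicators keep the error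
  local, so that integration turns it into averages near x and x'.\<close>

lemma bump_diff_le:
  "bump n x y \<le> bump n x' y + min 1 (2 powi n * dist x x') *
     (indicator (ball x (2 * 2 powi (- n))) y + indicator (ball x' (2 * 2 powi (- n))) y)"
proof (cases "y \<in> ball x (2 * 2 powi (- n))")
  case False
  then show ?thesis
    using bump_eq_0[of n x y] by (auto simp: bump_bounds not_less intro!: add_nonneg_nonneg mult_nonneg_nonneg)
next
  case True
  have "bump n x y - bump n x' y \<le> min 1 (2 powi n * dist x x')"
  proof -
    have "2 powi n * dist x' y \<le> 2 powi n * (dist x y + dist x x')"
      using dist_triangle3[of x' y x] by (intro mult_left_mono) (auto simp: dist_commute)
    then have "2 powi n * dist x' y \<le> 2 powi n * dist x y + 2 powi n * dist x x'"
      by (simp add: distrib_left)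
    moreover have "0 \<le> 2 powi n * dist x x'" by simp
    moreover have "max 0 (min 1 (2 - A)) - max 0 (min 1 (2 - A')) \<le> min 1 B"
      if "A' \<le> A + B" "0 \<le> B" for A A' B :: real
      using that by (simp add: max_def min_def)
    ultimately show ?thesis
      unfolding bump_def by blast
  qed
  moreover have "min 1 (2 powi n * dist x x') * 1 \<le> min 1 (2 powi n * dist x x') *
     (indicator (ball x (2 * 2 powi (- n))) y + indicator (ball x' (2 * 2 powi (- n))) y)"
    using True by (intro mult_left_mono) auto
  ultimately show ?thesis by linarith
qed

text \<open>Two regimes at distance d about 2^(-k). For n \<le> k the factor 2^n d leaves the rate 1
  - \<beta>; for n > k the factor 1 leaves the rate \<beta>. The constant 2 covers 2^\<beta>, lost
  because d may be as small as 2^(-k-1).\<close>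

lemma scale_weight_le:
  fixes d \<beta> :: real and n k :: int
  assumes \<beta>: "0 < \<beta>" "\<beta> < 1" and d: "2 powi (- k - 1) \<le> d" "d < 2 powi (- k)"
    and \<gamma>: "\<gamma> \<le> \<beta>" "\<gamma> \<le> 1 - \<beta>" "0 < \<gamma>"
  shows "2 powr (- \<beta> * n) * min 1 (2 powi n * d) \<le> d powr \<beta> * (2 * decay \<gamma> (n - k))"
proof -
  have d0: "0 < d" using d(1) by (rule less_le_trans[rotated]) simp
  have d': "2 powr (- real_of_int k - 1) \<le> d" "d < 2 powr (- real_of_int k)"
    using d by (simp_all add: powr_real_of_int' powr_diff power_int_diff flip: of_int_minus)
  show ?thesis
  proof (cases "n \<le> k")
    case True
    have "2 powr (- \<beta> * n) * min 1 (2 powi n * d) \<le> 2 powr (- \<beta> * n) * (2 powr n * d)"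
      by (intro mult_left_mono) (auto simp: powr_real_of_int')
    also have "\<dots> = d powr \<beta> * (2 powr ((1 - \<beta>) * n) * d powr (1 - \<beta>))"
      using d0 by (simp add: powr_diff left_diff_distrib powr_minus field_simps)
    also have "\<dots> \<le> d powr \<beta> * (2 powr ((1 - \<beta>) * n) * (2 powr (- real_of_int k)) powr (1 - \<beta>))"
      using d0 d' \<beta> by (intro mult_left_mono powr_mono2) auto
    also have "\<dots> = d powr \<beta> * decay (1 - \<beta>) (n - k)"
      using True by (simp add: powr_powr algebra_simps flip: powr_add)
    also have "\<dots> \<le> d powr \<beta> * (2 * decay \<gamma> (n - k))"
    proof (intro mult_left_mono)
      have "decay (1 - \<beta>) (n - k) \<le> decay \<gamma> (n - k)"
        using \<gamma> by (intro powr_mono mult_right_mono) auto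
      then show "decay (1 - \<beta>) (n - k) \<le> 2 * decay \<gamma> (n - k)"
        by (smt (verit) powr_ge_zero)
    qed auto
    finally show ?thesis .
  next
    case False
    have "2 powr (- \<beta> * n) * min 1 (2 powi n * d) \<le> 2 powr (- \<beta> * n) * 1"
      by (intro mult_left_mono) auto
    also have "\<dots> = (2 powr (- real_of_int k - 1)) powr \<beta> * (2 powr \<beta> * decay \<beta> (n - k))"
      using False by (simp add: powr_powr algebra_simps flip: powr_add)
    also have "\<dots> \<le> d powr \<beta> * (2 * decay \<gamma> (n - k))"
    proof (rule mult_mono)
      show "(2 powr (- real_of_int k - 1)) powr \<beta> \<le> d powr \<beta>"
        using d' \<beta> by (intro powr_mono2) auto
      have "2 powr \<beta> \<le> 2" using \<beta> powr_mono[of \<beta> 1 2] by simp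
      moreover have "decay \<beta> (n - k) \<le> decay \<gamma> (n - k)"
        using \<gamma> by (intro powr_mono mult_right_mono) auto
      ultimately show "2 powr \<beta> * decay \<beta> (n - k) \<le>
          2 * decay \<gamma> (n - k)"
        by (intro mult_mono) auto
    qed auto
    finally show ?thesis .
  qed
qed

context doubling_space
begin

lemma bump_measurable [measurable]: "(\<lambda>y. ennreal (bump n x y)) \<in> borel_measurable M"
  unfolding bump_def by (intro borel_measurable_imp_measurable borel_measurable_continuous_onI continuous_intros measurable_compose[OF _ measurable_ennreal])

lemma near_integral_le_ball_avg:
  assumes [measurable]: "f \<in> borel_measurable M" and r: "0 < r"
  shows "(\<integral>\<^sup>+y. f y / vol y r * indicator (ball x (2 * r)) y \<partial>M) \<le>
    ennreal (c\<^sup>2) * ball_avg M (2 * r) f x"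
proof -
  have "(\<integral>\<^sup>+y. f y / vol y r * indicator (ball x (2 * r)) y \<partial>M) \<le>
      (\<integral>\<^sup>+y. ennreal (c\<^sup>2) / vol x (2 * r) * (f y * indicator (ball x (2 * r)) y) \<partial>M)"
  proof (intro nn_integral_mono)
    fix y
    show "f y / vol y r * indicator (ball x (2 * r)) y \<le>
        ennreal (c\<^sup>2) / vol x (2 * r) * (f y * indicator (ball x (2 * r)) y)"
    proof (cases "y \<in> ball x (2 * r)")
      case True
      then have "vol x (2 * r) \<le> ennreal (c ^ 2) * vol y r"
        using r by (intro emeasure_ball_le_power) (auto simp: dist_commute)
      then have "1 / vol y r \<le> ennreal (c\<^sup>2) * (1 / vol x (2 * r))"
        using r c_gt_1 by (intro inverse_emeasure_le) auto
      then have "f y * (1 / vol y r) \<le> f y * (ennreal (c\<^sup>2) * (1 / vol x (2 * r)))"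
        by (intro mult_left_mono) auto
      then show ?thesis
        using True by (simp add: ennreal_times_divide mult.commute)
    qed simp
  qed
  also have "\<dots> = ennreal (c\<^sup>2) * ball_avg M (2 * r) f x"
    by (subst nn_integral_cmult) (auto simp: ball_avg_eq ennreal_times_divide ennreal_divide_times)
  finally show ?thesis .
qed

lemma bump_avg_diff_le:
  assumes [measurable]: "f \<in> borel_measurable M"
  shows "bump_avg M n f x \<le> bump_avg M n f x' + ennreal (min 1 (2 powi n * dist x x')) *
    ((\<integral>\<^sup>+y. f y / vol y (2 powi (- n)) * indicator (ball x (2 * 2 powi (- n))) y \<partial>M) +
     (\<integral>\<^sup>+y. f y / vol y (2 powi (- n)) * indicator (ball x' (2 * 2 powi (- n))) y \<partial>M))"
proof -
  define g where "g y = f y / vol y (2 powi (- n))" for y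
  have [measurable]: "g \<in> borel_measurable M" unfolding g_def by measurable
  define \<delta> where "\<delta> = min 1 (2 powi n * dist x x')"
  have \<delta>: "0 \<le> \<delta>" by (simp add: \<delta>_def)
  have "(\<integral>\<^sup>+y. ennreal (bump n x y) * g y \<partial>M) \<le>
      (\<integral>\<^sup>+y. ennreal (bump n x' y) * g y + ennreal \<delta> *
        (g y * indicator (ball x (2 * 2 powi (- n))) y + g y * indicator (ball x' (2 * 2 powi (- n))) y) \<partial>M)"
  proof (intro nn_integral_mono)
    fix y
    define i :: "'a \<Rightarrow> real" where "i z = indicator (ball z (2 * 2 powi (- n))) y" for z
    have i: "0 \<le> i z" "ennreal (i z) = indicator (ball z (2 * 2 powi (- n))) y" for z
      by (auto simp: i_def indicator_def)
    have "ennreal (bump n x y) \<le> ennreal (bump n x' y + \<delta> * (i x + i x'))"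
      unfolding \<delta>_def i_def by (intro ennreal_leI bump_diff_le)
    also have "\<dots> = ennreal (bump n x' y) + ennreal \<delta> * (ennreal (i x) + ennreal (i x'))"
      using \<delta> by (simp add: ennreal_plus ennreal_mult i(1) bump_bounds(1))
    finally have "ennreal (bump n x y) * g y \<le>
        (ennreal (bump n x' y) + ennreal \<delta> * (ennreal (i x) + ennreal (i x'))) * g y"
      by (intro mult_right_mono) auto
    then show "ennreal (bump n x y) * g y \<le> ennreal (bump n x' y) * g y + ennreal \<delta> *
        (g y * indicator (ball x (2 * 2 powi (- n))) y + g y * indicator (ball x' (2 * 2 powi (- n))) y)"
      unfolding i by (simp add: distrib_left distrib_right mult_ac)
  qed
  also have "\<dots> = (\<integral>\<^sup>+y. ennreal (bump n x' y) * g y \<partial>M) + ennreal \<delta> *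
        ((\<integral>\<^sup>+y. g y * indicator (ball x (2 * 2 powi (- n))) y \<partial>M) +
         (\<integral>\<^sup>+y. g y * indicator (ball x' (2 * 2 powi (- n))) y \<partial>M))"
    by (simp add: nn_integral_add nn_integral_cmult)
  finally show ?thesis
    by (simp add: bump_avg_def g_def \<delta>_def)
qed

lemma bump_avg_zero_outside:
  assumes "\<And>y. y \<notin> ball x0 r0 \<Longrightarrow> f y = 0" "r0 + 2 * 2 powi (- n) \<le> dist x0 x"
  shows "bump_avg M n f x = 0"
proof -
  have "ennreal (bump n x y) * (f y / vol y (2 powi (- n))) = 0" for y
  proof (cases "y \<in> ball x0 r0")
    case True
    then have "2 * 2 powi (- n) \<le> dist x y"
      using assms(2) dist_triangle[of x0 x y] by (simp add: dist_commute)
    then show ?thesis by (simp add: bump_eq_0)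
  qed (simp add: assms(1))
  then show ?thesis unfolding bump_avg_def by (simp only: nn_integral_const mult_zero_left)
qed

text \<open>On the support of f the weights are bounded, by doubling from scale n up to r0, and f
  \<le> 1 + f^p there. The bound is qualitative: it makes \<open>bump_avg\<close> finite and
  continuous, while its size enters no estimate.\<close>

lemma finite_weighted_integral:
  assumes [measurable]: "f \<in> borel_measurable M" and p: "1 \<le> p" and r0: "0 < r0"
    and f0: "\<And>y. y \<notin> ball x0 r0 \<Longrightarrow> f y = 0" and fin: "(\<integral>\<^sup>+y. ennpowr (f y) p \<partial>M) < top"
  shows "(\<integral>\<^sup>+y. f y / vol y (2 powi (- n)) \<partial>M) < top"
proof -
  obtain k :: nat where "(2 * r0) / 2 powi (- n) < 2 ^ k"
    using real_arch_pow[of 2] by auto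
  then have k: "2 * r0 \<le> 2 ^ k * 2 powi (- n)"
    by (simp add: field_simps)
  define V where "V = ennreal (c ^ k) / vol x0 r0"
  have "(\<integral>\<^sup>+y. f y / vol y (2 powi (- n)) \<partial>M) \<le>
      (\<integral>\<^sup>+y. V * (indicator (ball x0 r0) y + ennpowr (f y) p) \<partial>M)"
  proof (intro nn_integral_mono)
    fix y
    show "f y / vol y (2 powi (- n)) \<le> V * (indicator (ball x0 r0) y + ennpowr (f y) p)"
    proof (cases "y \<in> ball x0 r0")
      case True
      then have "vol x0 r0 \<le> ennreal (c ^ k) * vol y (2 powi (- n))"
        using k by (intro emeasure_ball_le_power) (auto simp: dist_commute)
      then have V: "1 / vol y (2 powi (- n)) \<le> V"
        using r0 c_gt_1 inverse_emeasure_le[of r0 "2 powi (- n)" x0 "c ^ k" y]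
        by (simp add: V_def ennreal_times_divide)
      have "f y \<le> 1 + ennpowr (f y) p"
      proof (cases "f y \<le> 1")
        case False
        then have "ennpowr 1 (p - 1) \<le> ennpowr (f y) (p - 1)"
          using p by (intro ennpowr_mono) auto
        then have "f y * 1 \<le> f y * ennpowr (f y) (p - 1)"
          by (intro mult_left_mono) auto
        then show ?thesis by (simp add: ennpowr_Suc add_increasing)
      qed (simp add: add_increasing2)
      then have "1 / vol y (2 powi (- n)) * f y \<le> V * (1 + ennpowr (f y) p)"
        using V by (intro mult_mono) auto
      then show ?thesis using True by (simp add: ennreal_times_divide ennreal_divide_times)
    qed (simp add: f0)
  qed
  also have "\<dots> = V * (vol x0 r0 + (\<integral>\<^sup>+y. ennpowr (f y) p \<partial>M))"
    by (simp add: nn_integral_cmult nn_integral_add)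
  also have "\<dots> < top"
  proof -
    have "V \<noteq> top"
      using emeasure_ball_pos[OF r0, of x0] by (simp add: V_def ennreal_divide_eq_top_iff)
    then have "V < top" by (simp only: less_top)
    moreover have "vol x0 r0 + (\<integral>\<^sup>+y. ennpowr (f y) p \<partial>M) < top"
      using fin by simp
    ultimately show ?thesis by (simp only: ennreal_mult_less_top simp_thms)
  qed
  finally show ?thesis .
qed

lemma bump_avg_continuous:
  assumes [measurable]: "f \<in> borel_measurable M"
    and fin: "(\<integral>\<^sup>+y. f y / vol y (2 powi (- n)) \<partial>M) < top"
  shows "bump_avg M n f x < top" "continuous_on UNIV (\<lambda>x. enn2real (bump_avg M n f x))"
proof -
  define D where "D = (\<integral>\<^sup>+y. f y / vol y (2 powi (- n)) \<partial>M)"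
  obtain D' where D': "D = ennreal D'" "0 \<le> D'"
    using fin unfolding D_def[symmetric] by (cases D) auto
  have le: "bump_avg M n f x \<le> D" for x
    unfolding bump_avg_def D_def
  proof (intro nn_integral_mono)
    fix y
    have "ennreal (bump n x y) * (f y / vol y (2 powi (- n))) \<le> 1 * (f y / vol y (2 powi (- n)))"
      using bump_bounds by (intro mult_right_mono) (auto simp flip: ennreal_1)
    then show "ennreal (bump n x y) * (f y / vol y (2 powi (- n))) \<le> f y / vol y (2 powi (- n))"
      by simp
  qed
  then show fin_x: "bump_avg M n f x < top" for x
    using fin unfolding D_def[symmetric] by (rule le_less_trans)
  have ind: "(\<integral>\<^sup>+y. f y / vol y (2 powi (- n)) * indicator A y \<partial>M) \<le> D" for A
    unfolding D_def by (intro nn_integral_mono) (auto simp: indicator_def)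
  have diff: "enn2real (bump_avg M n f x) \<le> enn2real (bump_avg M n f x') + 2 powi n * (2 * D') * dist x x'" for x x'
  proof -
    obtain a a' where a: "bump_avg M n f x = ennreal a" "0 \<le> a" "bump_avg M n f x' = ennreal a'" "0 \<le> a'"
      using fin_x[of x] fin_x[of x'] by (metis ennreal_cases less_irrefl)
    have "ennreal a \<le> ennreal a' + ennreal (min 1 (2 powi n * dist x x')) * (D + D)"
      unfolding a(1)[symmetric] a(3)[symmetric]
      by (rule order_trans[OF bump_avg_diff_le[OF assms(1), of n x x']]) (intro add_left_mono mult_left_mono add_mono ind, auto)
    also have "\<dots> = ennreal (a' + min 1 (2 powi n * dist x x') * (2 * D'))"
      using D' a by (simp add: ennreal_plus[symmetric] ennreal_mult[symmetric] del: ennreal_plus)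
    finally have "a \<le> a' + min 1 (2 powi n * dist x x') * (2 * D')"
      using D' a by (subst (asm) ennreal_le_iff) auto
    also have "\<dots> \<le> a' + (2 powi n * dist x x') * (2 * D')"
      using D' by (intro add_left_mono mult_right_mono) auto
    finally show ?thesis using a by (simp add: mult_ac)
  qed
  have "(2 powi n * (2 * D'))-lipschitz_on UNIV (\<lambda>x. enn2real (bump_avg M n f x))"
  proof (rule lipschitz_onI)
    fix x y
    show "dist (enn2real (bump_avg M n f x)) (enn2real (bump_avg M n f y)) \<le> 2 powi n * (2 * D') * dist x y"
      using diff[of x y] diff[of y x] by (simp add: dist_real_def abs_le_iff dist_commute)
  qed (use D' in auto)
  then show "continuous_on UNIV (\<lambda>x. enn2real (bump_avg M n f x))"
    by (rule lipschitz_on_continuous_on)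
qed

section \<open>Sums of Lipschitz averages as test functions for the relative capacity\<close>

abbreviation bump_sum :: "real \<Rightarrow> int set \<Rightarrow> (int \<Rightarrow> 'a \<Rightarrow> ennreal) \<Rightarrow> 'a \<Rightarrow> ennreal" where
  "bump_sum \<beta> J f x \<equiv> (\<Sum>n\<in>J. ennreal (2 powr (- \<beta> * real_of_int n)) * bump_avg M n (f n) x)"

lemma relative_capacity_le:
  fixes \<phi> :: "'a \<Rightarrow> real"
  assumes "0 < p" "\<Omega> \<in> sets M" "continuous_on UNIV \<phi>" "\<And>x. x \<in> E \<Longrightarrow> 1 \<le> \<phi> x" "\<And>x. x \<notin> U \<Longrightarrow> \<phi> x = 0"
    and "g \<in> hajlasz_gradients M \<beta> \<Omega> \<phi>"
  shows "relative_capacity M \<beta> p q E U \<Omega> \<le>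
    (\<integral>\<^sup>+x. ennpowr (lq_norm UNIV q (\<lambda>k. g k x)) p * indicator \<Omega> x \<partial>M)"
proof -
  have "relative_capacity M \<beta> p q E U \<Omega> \<le> ennpowr (hajlasz_seminorm M \<beta> p q \<Omega> \<phi>) p"
    unfolding relative_capacity_def using assms by (intro INF_lower) auto
  also have "\<dots> \<le> ennpowr (mixed_norm M \<Omega> UNIV p q g) p"
    unfolding hajlasz_seminorm_def using assms by (intro ennpowr_mono INF_lower) auto
  also have "\<dots> = (\<integral>\<^sup>+x. ennpowr (lq_norm UNIV q (\<lambda>k. g k x)) p * indicator \<Omega> x \<partial>M)"
    using assms by (intro ennpowr_mixed_norm) auto
  finally show ?thesis .
qed

lemma abs_diff_le_ennreal:
  assumes "ennreal a \<le> ennreal b + D" "ennreal b \<le> ennreal a + D" "0 \<le> a" "0 \<le> b"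
  shows "ennreal \<bar>a - b\<bar> \<le> D"
proof (cases D)
  case (real D')
  with assms have "a \<le> b + D'" "b \<le> a + D'"
    by (auto simp: ennreal_le_iff simp flip: ennreal_plus)
  then show ?thesis using real by (auto intro!: ennreal_leI)
qed simp

text \<open>The decay of rate \<gamma> is the square of \<open>w n\<close>, which has rate \<gamma>
  / 2: one factor stays under the supremum \<open>s\<close>, the other sums to at most W. The
  constant 2 is that of \<open>scale_weight_le\<close>, and c^2 that of
  \<open>near_integral_le_ball_avg\<close>.\<close>

lemma bump_sum_diff_le:
  fixes \<beta> \<gamma> W :: real and k :: int and f :: "int \<Rightarrow> 'a \<Rightarrow> ennreal"
  assumes f: "\<And>n. f n \<in> borel_measurable M" and J: "finite (J :: int set)"
    and \<beta>: "0 < \<beta>" "\<beta> < 1" and \<gamma>: "\<gamma> \<le> \<beta>" "\<gamma> \<le> 1 - \<beta>" "0 < \<gamma>"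
    and d: "2 powi (- k - 1) \<le> dist x x'" "dist x x' < 2 powi (- k)"
    and W: "(\<Sum>n\<in>J. decay (\<gamma> / 2) (k - n)) \<le> W"
  defines "s \<equiv> \<lambda>z. SUP n. ennreal (decay (\<gamma> / 2) (n - k)) * ball_avg M (2 * 2 powi (- n)) (f n) z"
  shows "bump_sum \<beta> J f x \<le>
    bump_sum \<beta> J f x' +
    ennreal (dist x x' powr \<beta>) * (ennreal (2 * c\<^sup>2 * W) * s x + ennreal (2 * c\<^sup>2 * W) * s x')"
proof -
  define A where "A n z = ball_avg M (2 * 2 powi (- n)) (f n) z" for n z
  define w where "w n = decay (\<gamma> / 2) (n - k)" for n
  define D where "D = dist x x' powr \<beta> * (2 * c\<^sup>2)"
  have D: "0 \<le> D" by (simp add: D_def)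
  have w: "0 \<le> w n" for n by (simp add: w_def)
  have W0: "0 \<le> W" using W by (rule order_trans[rotated]) (auto intro: sum_nonneg)
  have "bump_sum \<beta> J f x \<le>
     (\<Sum>n\<in>J. ennreal (2 powr (- \<beta> * n)) * bump_avg M n (f n) x' + ennreal (D * w n) * (s x + s x'))"
  proof (intro sum_mono)
    fix n assume "n \<in> J"
    define \<delta> where "\<delta> = min 1 (2 powi n * dist x x')"
    have \<delta>: "0 \<le> \<delta>" by (simp add: \<delta>_def)
    have "bump_avg M n (f n) x \<le> bump_avg M n (f n) x' +
        ennreal \<delta> * (ennreal (c\<^sup>2) * A n x + ennreal (c\<^sup>2) * A n x')"
      unfolding \<delta>_def A_def
      by (rule order_trans[OF bump_avg_diff_le[OF f, of n n x x']])
        (intro add_left_mono mult_left_mono add_mono near_integral_le_ball_avg f, auto)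
    then have "ennreal (2 powr (- \<beta> * n)) * bump_avg M n (f n) x \<le> ennreal (2 powr (- \<beta> * n)) *
        (bump_avg M n (f n) x' + ennreal \<delta> * (ennreal (c\<^sup>2) * A n x + ennreal (c\<^sup>2) * A n x'))"
      by (intro mult_left_mono) auto
    also have "\<dots> = ennreal (2 powr (- \<beta> * n)) * bump_avg M n (f n) x' +
        ennreal (2 powr (- \<beta> * n) * \<delta> * c\<^sup>2) * (A n x + A n x')"
      using \<delta> by (simp add: ennreal_mult distrib_left distrib_right mult_ac)
    also have "ennreal (2 powr (- \<beta> * n) * \<delta> * c\<^sup>2) * (A n x + A n x') \<le>
        ennreal (D * w n * w n) * (A n x + A n x')"
    proof (intro mult_right_mono ennreal_leI)
      have "2 powr (- \<beta> * n) * \<delta> \<le> dist x x' powr \<beta> * (2 * decay \<gamma> (n - k))"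
        unfolding \<delta>_def using \<beta> d \<gamma> by (rule scale_weight_le)
      also have "decay \<gamma> (n - k) = w n * w n"
        by (simp add: w_def flip: powr_add)
      finally have "2 powr (- \<beta> * n) * \<delta> * c\<^sup>2 \<le> dist x x' powr \<beta> * (2 * (w n * w n)) * c\<^sup>2"
        by (intro mult_right_mono) auto
      then show "2 powr (- \<beta> * n) * \<delta> * c\<^sup>2 \<le> D * w n * w n"
        by (simp add: D_def mult_ac)
    qed auto
    also have "ennreal (D * w n * w n) * (A n x + A n x') =
        ennreal (D * w n) * (ennreal (w n) * A n x + ennreal (w n) * A n x')"
      using D w by (simp add: ennreal_mult distrib_left mult_ac)
    also have "\<dots> \<le> ennreal (D * w n) * (s x + s x')"
      unfolding s_def A_def w_def by (intro mult_left_mono add_mono SUP_upper) auto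
    finally show "ennreal (2 powr (- \<beta> * n)) * bump_avg M n (f n) x \<le>
        ennreal (2 powr (- \<beta> * n)) * bump_avg M n (f n) x' + ennreal (D * w n) * (s x + s x')"
      by (simp add: add_left_mono)
  qed
  also have "\<dots> = bump_sum \<beta> J f x' +
      (\<Sum>n\<in>J. ennreal (D * w n)) * (s x + s x')"
    by (simp add: sum.distrib sum_distrib_right)
  also have "(\<Sum>n\<in>J. ennreal (D * w n)) = ennreal (D * (\<Sum>n\<in>J. w n))"
    using D w by (simp add: sum_ennreal sum_distrib_left)
  also have "\<dots> \<le> ennreal (D * W)"
  proof (intro ennreal_leI mult_left_mono D)
    show "(\<Sum>n\<in>J. w n) \<le> W"
      using W by (simp add: w_def abs_minus_commute)
  qed
  also have "ennreal (D * W) * (s x + s x') =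
      ennreal (dist x x' powr \<beta>) * (ennreal (2 * c\<^sup>2 * W) * s x + ennreal (2 * c\<^sup>2 * W) * s x')"
    using W0 by (simp add: D_def ennreal_mult distrib_left distrib_right mult_ac)
  finally show ?thesis by (simp add: mult_right_mono add_left_mono)
qed

text \<open>The test function is the bump sum itself. Its part of scale n vanishes beyond distance 2
  * 2^(-n) from the support of f, which explains the condition on s. The gradient inequality holds
  for all pairs of points, so the exceptional set is empty.\<close>

lemma relative_capacity_le_bump_sum:
  fixes p \<beta> :: real and q :: ennreal
  assumes p: "1 < p" and q: "1 < q" and \<beta>: "0 < \<beta>" "\<beta> < 1"
  obtains K :: real where "0 < K"
    "\<And>(J :: int set) (f :: int \<Rightarrow> 'a \<Rightarrow> ennreal) x0 r0 s E \<Omega>.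
      finite J \<Longrightarrow> (\<And>n. f n \<in> borel_measurable M) \<Longrightarrow> (\<And>n y. n \<notin> J \<Longrightarrow> f n y = 0) \<Longrightarrow>
      0 < r0 \<Longrightarrow> (\<And>n y. y \<notin> ball x0 r0 \<Longrightarrow> f n y = 0) \<Longrightarrow>
      (\<And>n. n \<in> J \<Longrightarrow> r0 + 2 * 2 powi (- n) \<le> s) \<Longrightarrow> \<Omega> \<in> sets M \<Longrightarrow>
      (\<And>x. x \<in> E \<Longrightarrow> 1 \<le> bump_sum \<beta> J f x) \<Longrightarrow>
      relative_capacity M \<beta> p q E (ball x0 s) \<Omega> \<le>
        ennreal K * lpq p q f"
proof -
  \<comment> \<open>The slower of the two decay rates, that of the coarse scales and that of the
    fine ones.\<close>
  define \<gamma> where "\<gamma> = min \<beta> (1 - \<beta>)"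
  have \<gamma>: "\<gamma> \<le> \<beta>" "\<gamma> \<le> 1 - \<beta>" "0 < \<gamma>" using \<beta> by (auto simp: \<gamma>_def)
  obtain W :: real where W: "0 < W"
    "\<And>F (n :: int). finite F \<Longrightarrow> (\<Sum>k\<in>F. decay (\<gamma> / 2) (n - k)) \<le> W"
    using sum_two_powr_abs_diff_le[of "\<gamma> / 2"] \<gamma> by auto
  obtain K1 :: real where K1: "0 < K1"
    "\<And>a. lq_norm UNIV q (\<lambda>k. SUP n. ennreal (decay (\<gamma> / 2) (n - k)) * a n) \<le>
      ennreal K1 * lq_norm UNIV q a"
    using lq_norm_SUP_geometric_le[of "\<gamma> / 2" q] \<gamma> q by auto
  obtain K2 where K2: "0 < K2"
    "\<And>(h :: int \<Rightarrow> 'a \<Rightarrow> ennreal) R. (\<And>j. h j \<in> borel_measurable M) \<Longrightarrow> 0 < R \<Longrightarrow>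
      lpq p q (\<lambda>n. ball_avg M (R * 2 powi (- n)) (h n)) \<le>
        ennreal K2 * lpq p q h"
    using lq_norm_ball_avg[OF p q] by blast
  define C where "C = 2 * c\<^sup>2 * W"
  have C: "0 < C" using W c_gt_1 by (simp add: C_def)
  define K where "K = (C * K1) powr p * K2"
  have K: "0 < K" using C K1 K2 by (simp add: K_def)
  show thesis
  proof (rule that[OF K])
    fix J :: "int set" and f :: "int \<Rightarrow> 'a \<Rightarrow> ennreal" and x0 :: 'a and r0 s :: real and E \<Omega> :: "'a set"
    assume J: "finite J" and f [measurable]: "\<And>n. f n \<in> borel_measurable M"
      and fJ: "\<And>n y. n \<notin> J \<Longrightarrow> f n y = 0" and r0: "0 < r0"
      and supp: "\<And>n y. y \<notin> ball x0 r0 \<Longrightarrow> f n y = 0"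
      and s: "\<And>n. n \<in> J \<Longrightarrow> r0 + 2 * 2 powi (- n) \<le> s" and \<Omega>: "\<Omega> \<in> sets M"
      and E: "\<And>x. x \<in> E \<Longrightarrow> 1 \<le> bump_sum \<beta> J f x"
    define Q where "Q = lpq p q f"
    show "relative_capacity M \<beta> p q E (ball x0 s) \<Omega> \<le>
        ennreal K * lpq p q f"
    proof (cases "Q = top")
      case True
      then show ?thesis using K by (simp add: Q_def ennreal_mult_top)
    next
      case False
      have fin_p: "(\<integral>\<^sup>+y. ennpowr (f n y) p \<partial>M) < top" for n
      proof -
        have "(\<integral>\<^sup>+y. ennpowr (f n y) p \<partial>M) \<le> Q"
          unfolding Q_def using p q by (intro nn_integral_mono ennpowr_mono) (auto intro: le_lq_norm)
        then show ?thesis using False by (auto simp: less_top intro: le_less_trans)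
      qed
      have fin: "(\<integral>\<^sup>+y. f n y / vol y (2 powi (- n)) \<partial>M) < top" for n
        using p r0 supp fin_p by (intro finite_weighted_integral[of _ p r0 x0]) auto
      define \<phi> where "\<phi> x = (\<Sum>n\<in>J. 2 powr (- \<beta> * n) * enn2real (bump_avg M n (f n) x))" for x
      have \<phi>_nonneg: "0 \<le> \<phi> x" for x unfolding \<phi>_def by (intro sum_nonneg) auto
      have \<phi>: "ennreal (\<phi> x) = bump_sum \<beta> J f x" for x
      proof -
        have "ennreal (\<phi> x) = (\<Sum>n\<in>J. ennreal (2 powr (- \<beta> * n) * enn2real (bump_avg M n (f n) x)))"
          unfolding \<phi>_def by (rule sum_ennreal[symmetric]) auto
        then show ?thesis
          using bump_avg_continuous(1)[OF f fin] by (simp add: ennreal_mult)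
      qed
      define A where "A k x = (SUP n. ennreal (decay (\<gamma> / 2) (n - k)) *
        ball_avg M (2 * 2 powi (- n)) (f n) x)" for k x
      define g where "g k x = ennreal C * A k x" for k x
      have [measurable]: "A k \<in> borel_measurable M" for k unfolding A_def by measurable
      have [measurable]: "g k \<in> borel_measurable M" for k unfolding g_def by measurable
      have diff: "ennreal (\<phi> x) \<le> ennreal (\<phi> y) + ennreal (dist x y powr \<beta>) * (g k x + g k y)"
        if "2 powi (- k - 1) \<le> dist x y" "dist x y < 2 powi (- k)" for k x y
        unfolding \<phi> g_def A_def C_def using that J \<beta> \<gamma> W by (intro bump_sum_diff_le f) auto
      have "relative_capacity M \<beta> p q E (ball x0 s) \<Omega> \<le>
          (\<integral>\<^sup>+x. ennpowr (lq_norm UNIV q (\<lambda>k. g k x)) p * indicator \<Omega> x \<partial>M)"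
      proof (rule relative_capacity_le)
        show "continuous_on UNIV \<phi>"
          unfolding \<phi>_def by (intro continuous_intros bump_avg_continuous f fin)
        show "1 \<le> \<phi> x" if "x \<in> E" for x
          using E[OF that] \<phi>_nonneg[of x] unfolding \<phi>[symmetric] by (simp flip: ennreal_1)
        show "\<phi> x = 0" if "x \<notin> ball x0 s" for x
          unfolding \<phi>_def
        proof (intro sum.neutral ballI)
          fix n assume "n \<in> J"
          then have "r0 + 2 * 2 powi (- n) \<le> dist x0 x" using s that by fastforce
          then have "bump_avg M n (f n) x = 0"
            using supp by (intro bump_avg_zero_outside) auto
          then show "2 powr (- \<beta> * n) * enn2real (bump_avg M n (f n) x) = 0" by simp
        qed
        show "g \<in> hajlasz_gradients M \<beta> \<Omega> \<phi>"
          unfolding hajlasz_gradients_def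
        proof (intro CollectI conjI allI bexI[of _ "{}"] ballI impI)
          fix k
          show "g k \<in> borel_measurable (restrict_space M \<Omega>)"
            by (rule measurable_restrict_space1) measurable
          fix x y :: 'a assume "2 powi (- k - 1) \<le> dist x y \<and> dist x y < 2 powi (- k)"
          then show "ennreal \<bar>\<phi> x - \<phi> y\<bar> \<le> ennreal (dist x y powr \<beta>) * (g k x + g k y)"
            using diff[of k x y] diff[of k y x] \<phi>_nonneg
            by (intro abs_diff_le_ennreal) (auto simp: dist_commute add.commute)
        qed auto
      qed (use p \<Omega> in auto)
      also have "\<dots> \<le> (\<integral>\<^sup>+x. ennreal ((C * K1) powr p) *
          ennpowr (lq_norm UNIV q (\<lambda>n. ball_avg M (2 * 2 powi (- n)) (f n) x)) p \<partial>M)"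
      proof (intro nn_integral_mono)
        fix x
        define L where "L = lq_norm UNIV q (\<lambda>n. ball_avg M (2 * 2 powi (- n)) (f n) x)"
        have "lq_norm UNIV q (\<lambda>k. g k x) \<le> ennreal C * (ennreal K1 * L)"
          unfolding g_def lq_norm_cmult[OF q] A_def L_def by (intro mult_left_mono K1) auto
        also have "\<dots> = ennreal (C * K1) * L"
          using C K1 by (simp add: ennreal_mult mult.assoc)
        finally have "ennpowr (lq_norm UNIV q (\<lambda>k. g k x)) p \<le> ennpowr (ennreal (C * K1) * L) p"
          using p by (rule_tac ennpowr_mono) auto
        also have "\<dots> = ennreal ((C * K1) powr p) * ennpowr L p"
          using C K1 by (simp add: ennpowr_mult ennpowr_ennreal)
        finally show "ennpowr (lq_norm UNIV q (\<lambda>k. g k x)) p * indicator \<Omega> x \<le>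
            ennreal ((C * K1) powr p) * ennpowr L p"
          by (auto simp: indicator_def)
      qed
      also have "\<dots> = ennreal ((C * K1) powr p) *
          lpq p q (\<lambda>n. ball_avg M (2 * 2 powi (- n)) (f n))"
        by (intro nn_integral_cmult borel_measurable_ennpowr borel_measurable_lq_norm_UNIV q) measurable
      also have "\<dots> \<le> ennreal ((C * K1) powr p) * (ennreal K2 * Q)"
        unfolding Q_def by (intro mult_left_mono K2 f) auto
      finally show ?thesis
        using K2 by (simp add: K_def Q_def ennreal_mult mult.assoc)
    qed
  qed
qed

end

section \<open>Relative capacity from potentials\<close>

lemma dyadic_scale:
  fixes r :: real
  assumes "0 < r"
  obtains m :: int where "2 powi (- m) \<le> r" "r < 2 * 2 powi (- m)"
proof
  define j where "j = \<lfloor>log 2 r\<rfloor>"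
  have "2 powr (real_of_int j) \<le> 2 powr (log 2 r)" "2 powr (log 2 r) < 2 powr (real_of_int j + 1)"
    unfolding j_def by (intro powr_mono powr_less_mono; linarith)+
  then show "2 powi (- (- j)) \<le> r" "r < 2 * 2 powi (- (- j))"
    using assms by (simp_all add: powr_add powr_real_of_int')
qed

lemma lq_norm_singleton_support:
  assumes "1 < q"
  shows "lq_norm UNIV q (\<lambda>n. if n = m then a else 0) = a"
proof -
  have "lq_norm UNIV q (\<lambda>n. if n = m then a else 0) = lq_norm {m} q (\<lambda>_. a)"
    using lq_norm_restrict[OF assms, of "{m}" "\<lambda>_. a"] by simp
  also have "\<dots> = a"
    using enn2real_gt_1[OF assms] by (cases "q = top") (simp_all add: lq_norm_top lq_norm_finite_exponent)
  finally show ?thesis .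
qed

context doubling_space
begin

abbreviation scale_potential :: "int \<Rightarrow> ('a \<Rightarrow> ennreal) \<Rightarrow> 'a \<Rightarrow> ennreal" where
  "scale_potential n f x \<equiv>
     (\<integral>\<^sup>+y. indicator (ball y (2 powi (- n))) x / vol y (2 powi (- n)) * f y \<partial>M)"

lemma scale_potential_le_ball_avg:
  assumes [measurable]: "f \<in> borel_measurable M"
  shows "scale_potential n f x \<le> ennreal c * ball_avg M (2 powi (- n)) f x"
proof -
  define r where "r = (2::real) powi (- n)"
  have r: "0 < r" by (simp add: r_def)
  have "(\<integral>\<^sup>+y. indicator (ball y r) x / vol y r * f y \<partial>M) \<le>
      (\<integral>\<^sup>+y. ennreal c / vol x r * (f y * indicator (ball x r) y) \<partial>M)"
  proof (intro nn_integral_mono)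
    fix y
    show "indicator (ball y r) x / vol y r * f y \<le>
        ennreal c / vol x r * (f y * indicator (ball x r) y)"
    proof (cases "dist x y < r")
      case True
      then have "1 / vol y r \<le> ennreal c * (1 / vol x r)"
        using r c_gt_1 by (intro inverse_emeasure_le emeasure_ball_le_near) auto
      then have "1 / vol y r * f y \<le> ennreal c * (1 / vol x r) * f y"
        by (intro mult_right_mono) auto
      then show ?thesis
        using True by (simp add: dist_commute ennreal_times_divide)
    qed (auto simp: dist_commute)
  qed
  also have "\<dots> = ennreal c * ball_avg M r f x"
    by (subst nn_integral_cmult) (auto simp: ball_avg_eq ennreal_times_divide ennreal_divide_times)
  finally show ?thesis by (simp add: r_def)
qed

lemma scale_potential_le_bump_avg:
  assumes "\<And>y. dist x y < 2 powi (- n) \<Longrightarrow> f y \<le> f' y"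
  shows "scale_potential n f x \<le> bump_avg M n f' x"
  unfolding bump_avg_def
proof (intro nn_integral_mono)
  fix y
  show "indicator (ball y (2 powi (- n))) x / vol y (2 powi (- n)) * f y \<le>
      ennreal (bump n x y) * (f' y / vol y (2 powi (- n)))"
  proof (cases "dist x y < 2 powi (- n)")
    case True
    then show ?thesis
      using assms[OF True]
      by (simp add: bump_eq_1 dist_commute ennreal_divide_times divide_right_mono_ennreal)
  qed (simp add: dist_commute)
qed

lemma ball_avg_le_Lp:
  assumes [measurable]: "f \<in> borel_measurable M" and "1 \<le> p" "0 < r"
    and le: "(\<integral>\<^sup>+y. ennpowr (f y) p \<partial>M) \<le> \<Phi>"
  shows "ennpowr (ball_avg M r f x) p \<le> ennreal (2 powr p) * (\<Phi> / vol x r)"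
proof -
  have "ennpowr (ball_avg M r f x) p \<le> ennreal (2 powr p) * ball_avg M r (\<lambda>y. ennpowr (f y) p) x"
    using assms by (intro ennpowr_ball_avg_le) auto
  also have "\<dots> \<le> ennreal (2 powr p) * (\<Phi> / vol x r)"
  proof (intro mult_left_mono)
    have "(\<integral>\<^sup>+y. ennpowr (f y) p * indicator (ball x r) y \<partial>M) \<le> (\<integral>\<^sup>+y. ennpowr (f y) p \<partial>M)"
      by (intro nn_integral_mono) (auto simp: indicator_def)
    then have "(\<integral>\<^sup>+y. ennpowr (f y) p * indicator (ball x r) y \<partial>M) \<le> \<Phi>"
      using le by (rule order_trans)
    then show "ball_avg M r (\<lambda>y. ennpowr (f y) p) x \<le> \<Phi> / vol x r"
      by (simp add: ball_avg_eq divide_right_mono_ennreal)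
  qed auto
  finally show ?thesis .
qed

lemma large_scale_potential_le:
  fixes \<beta> p \<sigma> :: real
  assumes p: "1 < p" and \<sigma>: "\<beta> * p < \<sigma>" and C\<sigma>: "0 < C\<sigma>"
  obtains K :: real where "0 < K"
    "\<And>(f :: int \<Rightarrow> 'a \<Rightarrow> ennreal) x \<Phi> m I.
      (\<And>n. f n \<in> borel_measurable M) \<Longrightarrow> (\<And>n. (\<integral>\<^sup>+y. ennpowr (f n y) p \<partial>M) \<le> \<Phi>) \<Longrightarrow>
      I \<subseteq> {..<m} \<Longrightarrow> (\<And>n. n \<in> I \<Longrightarrow>
        vol x (2 powi (- m)) / vol x (2 powi (- n)) \<le>
          ennreal (C\<sigma> * (2 powi (- m) / 2 powi (- n)) powr \<sigma>)) \<Longrightarrow>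
      (\<Sum>\<^sub>\<infinity>n\<in>I. ennreal (2 powr (- \<beta> * real_of_int n)) * scale_potential n (f n) x) \<le>
        ennreal (K * 2 powr (- \<beta> * real_of_int m)) * ennpowr (\<Phi> / vol x (2 powi (- m))) (1 / p)"
proof -
  \<comment> \<open>The exponent gained by each coarser scale; it is positive exactly because
    \<beta> p < \<sigma>.\<close>
  define \<gamma> where "\<gamma> = \<sigma> / p - \<beta>"
  have \<gamma>: "0 < \<gamma>" using p \<sigma> by (simp add: \<gamma>_def field_simps)
  obtain W :: real where W: "0 < W"
    "\<And>F (n :: int). finite F \<Longrightarrow> (\<Sum>k\<in>F. decay \<gamma> (n - k)) \<le> W"
    using sum_two_powr_abs_diff_le[OF \<gamma>] by auto
  define C where "C = c * (2 * C\<sigma> powr (1 / p))"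
  have C: "0 < C" using c_gt_1 C\<sigma> by (simp add: C_def)
  have "0 < C * W" using C W by simp
  then show thesis
  proof (rule that)
    fix f :: "int \<Rightarrow> 'a \<Rightarrow> ennreal" and x \<Phi> and m :: int and I
    assume f [measurable]: "\<And>n. f n \<in> borel_measurable M" and \<Phi>: "\<And>n. (\<integral>\<^sup>+y. ennpowr (f n y) p \<partial>M) \<le> \<Phi>"
      and I: "I \<subseteq> {..<m}"
      and qrd: "\<And>n. n \<in> I \<Longrightarrow>
        vol x (2 powi (- m)) / vol x (2 powi (- n)) \<le>
          ennreal (C\<sigma> * (2 powi (- m) / 2 powi (- n)) powr \<sigma>)"
    define \<mu> where "\<mu> n = vol x (2 powi (- n))" for n
    define V where "V = ennpowr (\<Phi> / \<mu> m) (1 / p)"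
    have \<mu>: "\<mu> n \<noteq> 0" "\<mu> n < top" for n by (auto simp: \<mu>_def)
    have term_le: "ennreal (2 powr (- \<beta> * n)) * scale_potential n (f n) x \<le>
        ennreal (C * 2 powr (- \<beta> * m)) * V * ennreal (decay \<gamma> (m - n))"
      if n: "n \<in> I" for n
    proof -
      have nm: "n < m" using n I by auto
      define D where "D = C\<sigma> * 2 powr (\<sigma> * (real_of_int n - real_of_int m))"
      have D: "0 < D" using C\<sigma> by (simp add: D_def)
      have "2 powi (- m) / 2 powi (- n) = (2::real) powr (real_of_int n - real_of_int m)"
        by (simp add: powr_diff powr_real_of_int' power_int_minus field_simps)
      then have "\<mu> m / \<mu> n \<le> ennreal D"
        using qrd[OF n] by (simp add: \<mu>_def D_def powr_powr mult.commute)
      then have "1 / \<mu> n \<le> ennreal D * (1 / \<mu> m)"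
      proof -
        have "1 / \<mu> n = \<mu> m / \<mu> n * (1 / \<mu> m)"
          using \<mu>[of m] by (simp add: ennreal_divide_times divide_eq_1_ennreal ennreal_times_divide mult.commute)
        then show ?thesis
          using \<open>\<mu> m / \<mu> n \<le> ennreal D\<close> by (metis mult_right_mono zero_le)
      qed
      then have "\<Phi> * (1 / \<mu> n) \<le> \<Phi> * (ennreal D * (1 / \<mu> m))"
        by (intro mult_left_mono) auto
      then have \<Phi>_le: "\<Phi> / \<mu> n \<le> ennreal D * (\<Phi> / \<mu> m)"
        by (simp add: ennreal_times_divide mult.commute)
      have "ennpowr (ball_avg M (2 powi (- n)) (f n) x) p \<le> ennreal (2 powr p) * (\<Phi> / \<mu> n)"
        unfolding \<mu>_def using p \<Phi> by (intro ball_avg_le_Lp) auto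
      also have "\<dots> \<le> ennreal (2 powr p) * (ennreal D * (\<Phi> / \<mu> m))"
        by (intro mult_left_mono \<Phi>_le) auto
      finally have "ennpowr (ennpowr (ball_avg M (2 powi (- n)) (f n) x) p) (1 / p) \<le>
          ennpowr (ennreal (2 powr p) * (ennreal D * (\<Phi> / \<mu> m))) (1 / p)"
        using p by (rule_tac ennpowr_mono) auto
      also have "ennpowr (ennpowr (ball_avg M (2 powi (- n)) (f n) x) p) (1 / p) = ball_avg M (2 powi (- n)) (f n) x"
        using p by simp
      also have "ennpowr (ennreal (2 powr p) * (ennreal D * (\<Phi> / \<mu> m))) (1 / p) =
          ennreal (2 * D powr (1 / p)) * V"
        using p D by (simp add: ennpowr_mult ennpowr_ennreal powr_powr V_def ennreal_mult mult.assoc)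
      finally have avg: "ball_avg M (2 powi (- n)) (f n) x \<le> ennreal (2 * D powr (1 / p)) * V" .
      have D_p: "D powr (1 / p) = C\<sigma> powr (1 / p) * 2 powr ((\<sigma> / p) * (real_of_int n - real_of_int m))"
        using C\<sigma> by (simp add: D_def powr_mult powr_powr)
      have "ennreal (2 powr (- \<beta> * n)) * scale_potential n (f n) x \<le>
          ennreal (2 powr (- \<beta> * n)) * (ennreal c * (ennreal (2 * D powr (1 / p)) * V))"
        by (intro mult_left_mono order_trans[OF scale_potential_le_ball_avg[OF f]] avg) auto
      also have "\<dots> = ennreal (2 powr (- \<beta> * n) * (c * (2 * D powr (1 / p)))) * V"
        using c_gt_1 by (simp add: ennreal_mult mult.assoc)
      also have "2 powr (- \<beta> * n) * (c * (2 * D powr (1 / p))) =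
          C * 2 powr (- \<beta> * m) * decay \<gamma> (m - n)"
      proof -
        have "2 powr (- \<beta> * n) * 2 powr ((\<sigma> / p) * (real_of_int n - real_of_int m)) =
            2 powr (- \<beta> * m) * decay \<gamma> (m - n)"
          using nm by (simp add: \<gamma>_def algebra_simps flip: powr_add)
        then show ?thesis by (simp add: D_p C_def mult_ac)
      qed
      also have "ennreal (C * 2 powr (- \<beta> * m) * decay \<gamma> (m - n)) * V =
          ennreal (C * 2 powr (- \<beta> * m)) * V * ennreal (decay \<gamma> (m - n))"
        using C by (simp add: ennreal_mult mult_ac)
      finally show ?thesis .
    qed
    have "(\<Sum>\<^sub>\<infinity>n\<in>I. ennreal (2 powr (- \<beta> * n)) * scale_potential n (f n) x) \<le>
        ennreal (C * 2 powr (- \<beta> * m)) * V * ennreal W"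
    proof (rule infsum_ennreal_le)
      fix F assume F: "finite F" "F \<subseteq> I"
      then have "(\<Sum>n\<in>F. ennreal (2 powr (- \<beta> * n)) * scale_potential n (f n) x) \<le>
          (\<Sum>n\<in>F. ennreal (C * 2 powr (- \<beta> * m)) * V * ennreal (decay \<gamma> (m - n)))"
        by (intro sum_mono term_le) auto
      also have "\<dots> = ennreal (C * 2 powr (- \<beta> * m)) * V * ennreal (\<Sum>n\<in>F. decay \<gamma> (m - n))"
        by (simp add: sum_ennreal flip: sum_distrib_left)
      also have "\<dots> \<le> ennreal (C * 2 powr (- \<beta> * m)) * V * ennreal W"
        using F W by (intro mult_left_mono ennreal_leI) auto
      finally show "(\<Sum>n\<in>F. ennreal (2 powr (- \<beta> * n)) * scale_potential n (f n) x) \<le> \<dots>" .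
    qed
    also have "\<dots> = ennreal (C * W * 2 powr (- \<beta> * m)) * V"
      using C W by (simp add: ennreal_mult mult_ac)
    finally show "(\<Sum>\<^sub>\<infinity>n\<in>I. ennreal (2 powr (- \<beta> * real_of_int n)) * scale_potential n (f n) x) \<le>
        ennreal (C * W * 2 powr (- \<beta> * real_of_int m)) * ennpowr (\<Phi> / vol x (2 powi (- m))) (1 / p)"
      by (simp add: V_def \<mu>_def)
  qed
qed

text \<open>One scale suffices, with \<open>f m\<close> constant on the ball of radius 3 r / 2. This
  radius exceeds r + 2^(-m), so the balls of radius 2^(-m) about points of E stay inside, and 3 r /
  2 + 2 * 2^(-m) \<le> 2 r keeps the support in 2B.\<close>

lemma relative_capacity_le_ball:
  fixes p \<beta> :: real and q :: ennreal
  assumes p: "1 < p" and q: "1 < q" and \<beta>: "0 < \<beta>" "\<beta> < 1"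
  obtains K :: real where "0 < K"
    "\<And>(m :: int) x0 r E \<Omega>. 0 < r \<Longrightarrow> 2 powi (- m) \<le> r / 4 \<Longrightarrow> E \<subseteq> cball x0 r \<Longrightarrow> \<Omega> \<in> sets M \<Longrightarrow>
      relative_capacity M \<beta> p q E (ball x0 (2 * r)) \<Omega> \<le>
        ennreal (K * 2 powr (\<beta> * p * m)) * vol x0 (3 * r / 2)"
proof -
  obtain K :: real where K: "0 < K"
    "\<And>(J :: int set) (f :: int \<Rightarrow> 'a \<Rightarrow> ennreal) x0 r0 s E \<Omega>.
      finite J \<Longrightarrow> (\<And>n. f n \<in> borel_measurable M) \<Longrightarrow> (\<And>n y. n \<notin> J \<Longrightarrow> f n y = 0) \<Longrightarrow>
      0 < r0 \<Longrightarrow> (\<And>n y. y \<notin> ball x0 r0 \<Longrightarrow> f n y = 0) \<Longrightarrow>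
      (\<And>n. n \<in> J \<Longrightarrow> r0 + 2 * 2 powi (- n) \<le> s) \<Longrightarrow> \<Omega> \<in> sets M \<Longrightarrow>
      (\<And>x. x \<in> E \<Longrightarrow> 1 \<le> bump_sum \<beta> J f x) \<Longrightarrow>
      relative_capacity M \<beta> p q E (ball x0 s) \<Omega> \<le>
        ennreal K * lpq p q f"
    using relative_capacity_le_bump_sum[OF p q \<beta>] by blast
  have K': "0 < K * c powr p" using K c_gt_1 by simp
  show thesis
  proof (rule that[OF K'])
    fix m :: int and x0 :: 'a and r :: real and E \<Omega> :: "'a set"
    assume r: "0 < r" and m: "2 powi (- m) \<le> r / 4" and E: "E \<subseteq> cball x0 r" and \<Omega>: "\<Omega> \<in> sets M"
    define \<rho> where "\<rho> = (2::real) powi (- m)"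
    have \<rho>: "0 < \<rho>" by (simp add: \<rho>_def)
    \<comment> \<open>The factor c compensates for the volume being taken at y instead of x;
      2^(\<beta> m) cancels the weight of scale m.\<close>
    define t where "t = c * 2 powr (\<beta> * m)"
    have t: "0 < t" using c_gt_1 by (simp add: t_def)
    define f where "f n y = (if n = m then ennreal t * indicator (ball x0 (3 * r / 2)) y else 0)" for n y
    have "relative_capacity M \<beta> p q E (ball x0 (2 * r)) \<Omega> \<le>
        ennreal K * lpq p q f"
    proof (rule K(2)[of "{m}" f "3 * r / 2" x0])
      show "f n \<in> borel_measurable M" for n
        by (cases "n = m") (auto simp: f_def[abs_def])
      show "1 \<le> (\<Sum>n\<in>{m}. ennreal (2 powr (- \<beta> * n)) * bump_avg M n (f n) x)" if x: "x \<in> E" for x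
      proof -
        have "ennreal (t / c) = ennreal (t / c) * (vol x \<rho> / vol x \<rho>)"
          using \<rho> by simp
        also have "\<dots> = ennreal (t / c) / vol x \<rho> * vol x \<rho>"
          by (simp add: ennreal_times_divide ennreal_divide_times)
        also have "\<dots> = (\<integral>\<^sup>+y. ennreal (t / c) / vol x \<rho> * indicator (ball x \<rho>) y \<partial>M)"
          by (simp add: nn_integral_cmult_indicator)
        also have "\<dots> \<le> bump_avg M m (f m) x"
          unfolding bump_avg_def
        proof (intro nn_integral_mono)
          fix y
          show "ennreal (t / c) / vol x \<rho> * indicator (ball x \<rho>) y \<le>
              ennreal (bump m x y) * (f m y / vol y (2 powi (- m)))"
          proof (cases "dist x y < \<rho>")
            case True
            have "y \<in> ball x0 (3 * r / 2)"
            proof -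
              have "dist x0 x \<le> r" using E x by auto
              then show ?thesis
                using True m r dist_triangle[of x0 y x] by (simp add: \<rho>_def)
            qed
            then have "f m y = ennreal t" by (simp add: f_def)
            moreover have "bump m x y = 1" using True by (intro bump_eq_1) (simp add: \<rho>_def)
            moreover have "1 / vol x \<rho> \<le> ennreal c * (1 / vol y \<rho>)"
              using True \<rho> c_gt_1 by (intro inverse_emeasure_le emeasure_ball_le_near) (auto simp: dist_commute)
            then have "ennreal (t / c) * (1 / vol x \<rho>) \<le>
                ennreal (t / c) * (ennreal c * (1 / vol y \<rho>))"
              by (intro mult_left_mono) auto
            moreover have "ennreal (t / c) * (ennreal c * (1 / vol y \<rho>)) =
                ennreal t / vol y \<rho>"
              using t c_gt_1 by (simp add: ennreal_times_divide flip: mult.assoc ennreal_mult)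
            ultimately show ?thesis
              using True by (simp add: \<rho>_def ennreal_times_divide)
          qed simp
        qed
        finally have "ennreal (2 powr (\<beta> * m)) \<le> bump_avg M m (f m) x"
          using c_gt_1 by (simp add: t_def)
        then have "ennreal (2 powr (- \<beta> * m)) * ennreal (2 powr (\<beta> * m)) \<le> ennreal (2 powr (- \<beta> * m)) * bump_avg M m (f m) x"
          by (intro mult_left_mono) auto
        then show ?thesis by (simp flip: ennreal_mult powr_add)
      qed
    qed (use r m \<Omega> in \<open>auto simp: f_def\<close>)
    also have "lpq p q f =
        (\<integral>\<^sup>+x. ennreal (t powr p) * indicator (ball x0 (3 * r / 2)) x \<partial>M)"
      using t by (intro nn_integral_cong)
        (auto simp: f_def lq_norm_singleton_support[OF q] ennpowr_mult ennpowr_ennreal indicator_def)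
    also have "\<dots> = ennreal (t powr p) * vol x0 (3 * r / 2)"
      by (simp add: nn_integral_cmult_indicator)
    also have "t powr p = c powr p * 2 powr (\<beta> * p * m)"
      using c_gt_1 by (simp add: t_def powr_mult powr_powr mult_ac)
    finally show "relative_capacity M \<beta> p q E (ball x0 (2 * r)) \<Omega> \<le>
        ennreal (K * c powr p * 2 powr (\<beta> * p * m)) * vol x0 (3 * r / 2)"
      using K by (simp add: ennreal_mult mult.assoc)
  qed
qed

section \<open>Admissible scales, compactness and the upper bound for the relative capacity\<close>

lemma ediam_pos: "0 < ediam (UNIV :: 'a set)"
proof -
  obtain x y :: 'a where "x \<noteq> y" using two_points by blast
  then have "0 < ennreal (dist x y)" by simp
  also have "\<dots> \<le> ediam (UNIV :: 'a set)"
    unfolding ediam_def by (rule SUP_upper2[of x]) (auto intro: SUP_upper2[of y])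
  finally show ?thesis .
qed

text \<open>One description for both cases of the definition. For a finite diameter the condition on
  n is upward closed, satisfiable since the diameter is positive, and bounded below since it is
  finite, so \<open>LEAST\<close> is a true minimum; for an infinite one every integer satisfies
  it.\<close>

lemma mem_levels_iff: "n \<in> levels (UNIV :: 'a set) \<longleftrightarrow> ennreal (2 powi (- n)) \<le> 2 * ediam (UNIV :: 'a set)"
proof (cases "ediam (UNIV :: 'a set)")
  case (real d)
  have d: "0 < 2 * d" using ediam_pos real by simp
  have eq: "2 * ediam (UNIV :: 'a set) = ennreal (2 * d)"
    using real by (simp add: ennreal_mult)
  obtain m :: int where m: "2 powi (- m) \<le> 2 * d" "2 * d < 2 * 2 powi (- m)"
    using dyadic_scale[OF d] by blast
  have iff: "ennreal (2 powi (- k)) \<le> 2 * ediam (UNIV :: 'a set) \<longleftrightarrow> m \<le> k" for k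
  proof
    assume "ennreal (2 powi (- k)) \<le> 2 * ediam (UNIV :: 'a set)"
    then have *: "2 powi (- k) \<le> 2 * d" using d by (simp only: eq ennreal_le_iff)
    show "m \<le> k"
    proof (rule ccontr)
      assume "\<not> m \<le> k"
      then have "(2::real) powi (1 - m) \<le> 2 powi (- k)" by (intro power_int_increasing) auto
      also have "(2::real) powi (1 - m) = 2 * 2 powi (- m)"
        using power_int_add[of "2::real" 1 "- m"] by simp
      finally show False using m * by linarith
    qed
  next
    assume "m \<le> k"
    then have "(2::real) powi (- k) \<le> 2 powi (- m)" by (intro power_int_increasing) auto
    then show "ennreal (2 powi (- k)) \<le> 2 * ediam (UNIV :: 'a set)"
      unfolding eq using m by (intro ennreal_leI) linarith
  qed
  have "(LEAST n::int. ennreal (2 powi (- n)) \<le> 2 * ediam (UNIV :: 'a set)) = m"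
    unfolding iff by (rule Least_equality) auto
  then show ?thesis using real iff[of n] by (simp add: levels_def)
qed (simp add: levels_def ennreal_mult_top)

text \<open>Finite partial sums are continuous, so the sets where they exceed t are open and, by the
  strict inequality, cover E. As the sums increase with the set of scales, the union of the sets in
  a finite subcover serves all points.\<close>

lemma compact_finite_bump_sum:
  fixes f :: "int \<Rightarrow> 'a \<Rightarrow> ennreal" and \<beta> :: real
  assumes E: "compact E" and f: "\<And>n. f n \<in> borel_measurable M"
    and fin: "\<And>n. (\<integral>\<^sup>+y. f n y / vol y (2 powi (- n)) \<partial>M) < top"
    and le: "\<And>x. x \<in> E \<Longrightarrow> ennreal t < (\<Sum>\<^sub>\<infinity>n\<in>I. ennreal (2 powr (- \<beta> * n)) * bump_avg M n (f n) x)"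
    and t: "0 \<le> t"
  obtains J where "finite J" "J \<subseteq> I"
    "\<And>x. x \<in> E \<Longrightarrow> ennreal t \<le> bump_sum \<beta> J f x"
proof -
  define \<psi> where "\<psi> J x = (\<Sum>n\<in>J. 2 powr (- \<beta> * n) * enn2real (bump_avg M n (f n) x))" for J :: "int set" and x
  have \<psi>: "ennreal (\<psi> J x) = bump_sum \<beta> J f x" for J x
  proof -
    have "ennreal (\<psi> J x) = (\<Sum>n\<in>J. ennreal (2 powr (- \<beta> * n) * enn2real (bump_avg M n (f n) x)))"
      unfolding \<psi>_def by (rule sum_ennreal[symmetric]) auto
    then show ?thesis
      using bump_avg_continuous(1)[OF f fin] by (simp add: ennreal_mult)
  qed
  define U where "U J = {x. t < \<psi> J x}" for J
  have open_U: "open (U J)" for J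
    unfolding U_def \<psi>_def
    by (intro open_Collect_less continuous_intros bump_avg_continuous f fin)
  have "E \<subseteq> (\<Union>J\<in>{J. finite J \<and> J \<subseteq> I}. U J)"
  proof
    fix x assume "x \<in> E"
    then have "ennreal t < (SUP J\<in>{J. finite J \<and> J \<subseteq> I}. \<Sum>n\<in>J. ennreal (2 powr (- \<beta> * n)) * bump_avg M n (f n) x)"
      using le[of x] by (simp add: nonneg_infsum_complete)
    then obtain J where "finite J" "J \<subseteq> I" "ennreal t < ennreal (\<psi> J x)"
      unfolding less_SUP_iff \<psi>[symmetric] by blast
    then show "x \<in> (\<Union>J\<in>{J. finite J \<and> J \<subseteq> I}. U J)"
      using t by (auto simp: U_def ennreal_less_iff)
  qed
  then obtain \<F> where \<F>: "\<F> \<subseteq> {J. finite J \<and> J \<subseteq> I}" "finite \<F>" "E \<subseteq> (\<Union>J\<in>\<F>. U J)"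
    using compactE_image[OF E, of "{J. finite J \<and> J \<subseteq> I}" U] open_U by metis
  show thesis
  proof (rule that[of "\<Union>\<F>"])
    show fin_U: "finite (\<Union>\<F>)" using \<F> by auto
    show "\<Union>\<F> \<subseteq> I" using \<F> by auto
    fix x assume "x \<in> E"
    then obtain J where J: "J \<in> \<F>" "t < \<psi> J x" using \<F> by (auto simp: U_def)
    then have "ennreal t \<le> ennreal (\<psi> J x)" by (intro ennreal_leI) auto
    also have "\<dots> \<le> bump_sum \<beta> (\<Union>\<F>) f x"
      unfolding \<psi> using J fin_U by (intro sum_mono2) auto
    finally show "ennreal t \<le> \<dots>" .
  qed
qed

lemma bump_avg_cmult:
  assumes [measurable]: "f \<in> borel_measurable M"
  shows "bump_avg M n (\<lambda>y. a * f y) x = a * bump_avg M n f x"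
proof -
  have "bump_avg M n (\<lambda>y. a * f y) x =
      (\<integral>\<^sup>+y. a * (ennreal (bump n x y) * (f y / vol y (2 powi (- n)))) \<partial>M)"
    unfolding bump_avg_def by (intro nn_integral_cong) (simp add: ennreal_times_divide mult_ac)
  also have "\<dots> = a * bump_avg M n f x"
    unfolding bump_avg_def by (rule nn_integral_cmult) measurable
  finally show ?thesis .
qed

lemma relative_capacity_le_potential:
  fixes p \<beta> \<sigma> :: real and q :: ennreal
  assumes p: "1 < p" and q: "1 < q" and \<beta>: "0 < \<beta>" "\<beta> < 1"
    and \<sigma>: "\<beta> * p < \<sigma>" and qrd: "quantitative_reverse_doubling M \<sigma>"
  obtains K :: real where "0 < K"
    "\<And>f x0 r E \<Omega>. 0 < r \<Longrightarrow> compact E \<Longrightarrow> E \<subseteq> cball x0 r \<Longrightarrow> \<Omega> \<in> sets M \<Longrightarrow>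
      (\<And>n. n \<in> levels (UNIV :: 'a set) \<Longrightarrow> f n \<in> borel_measurable borel) \<Longrightarrow>
      (\<And>x. x \<in> E \<Longrightarrow> 1 \<le> potential M \<beta> f x) \<Longrightarrow>
      relative_capacity M \<beta> p q E (ball x0 (2 * r)) \<Omega> \<le>
        ennreal K * (\<integral>\<^sup>+x. ennpowr (lq_norm (levels (UNIV :: 'a set)) q (\<lambda>n. f n x)) p \<partial>M)"
proof -
  obtain C\<sigma> :: real where C\<sigma>: "0 < C\<sigma>" "\<And>x r R. 0 < r \<Longrightarrow> r < R \<Longrightarrow> ennreal R \<le> 2 * ediam (UNIV :: 'a set) \<Longrightarrow>
      vol x r / vol x R \<le> ennreal (C\<sigma> * (r / R) powr \<sigma>)"
    using qrd unfolding quantitative_reverse_doubling_def by blast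
  obtain K1 :: real where K1: "0 < K1"
    "\<And>(f :: int \<Rightarrow> 'a \<Rightarrow> ennreal) x \<Phi> m I.
      (\<And>n. f n \<in> borel_measurable M) \<Longrightarrow> (\<And>n. (\<integral>\<^sup>+y. ennpowr (f n y) p \<partial>M) \<le> \<Phi>) \<Longrightarrow>
      I \<subseteq> {..<m} \<Longrightarrow> (\<And>n. n \<in> I \<Longrightarrow>
        vol x (2 powi (- m)) / vol x (2 powi (- n)) \<le>
          ennreal (C\<sigma> * (2 powi (- m) / 2 powi (- n)) powr \<sigma>)) \<Longrightarrow>
      (\<Sum>\<^sub>\<infinity>n\<in>I. ennreal (2 powr (- \<beta> * real_of_int n)) * scale_potential n (f n) x) \<le>
        ennreal (K1 * 2 powr (- \<beta> * real_of_int m)) * ennpowr (\<Phi> / vol x (2 powi (- m))) (1 / p)"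
    using large_scale_potential_le[OF p \<sigma> C\<sigma>(1)] by blast
  obtain K2 :: real where K2: "0 < K2"
    "\<And>(m :: int) x0 r E \<Omega>. 0 < r \<Longrightarrow> 2 powi (- m) \<le> r / 4 \<Longrightarrow> E \<subseteq> cball x0 r \<Longrightarrow> \<Omega> \<in> sets M \<Longrightarrow>
      relative_capacity M \<beta> p q E (ball x0 (2 * r)) \<Omega> \<le>
        ennreal (K2 * 2 powr (\<beta> * p * m)) * vol x0 (3 * r / 2)"
    using relative_capacity_le_ball[OF p q \<beta>] by blast
  obtain K3 :: real where K3: "0 < K3"
    "\<And>(J :: int set) (f :: int \<Rightarrow> 'a \<Rightarrow> ennreal) x0 r0 s E \<Omega>.
      finite J \<Longrightarrow> (\<And>n. f n \<in> borel_measurable M) \<Longrightarrow> (\<And>n y. n \<notin> J \<Longrightarrow> f n y = 0) \<Longrightarrow>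
      0 < r0 \<Longrightarrow> (\<And>n y. y \<notin> ball x0 r0 \<Longrightarrow> f n y = 0) \<Longrightarrow>
      (\<And>n. n \<in> J \<Longrightarrow> r0 + 2 * 2 powi (- n) \<le> s) \<Longrightarrow> \<Omega> \<in> sets M \<Longrightarrow>
      (\<And>x. x \<in> E \<Longrightarrow> 1 \<le> bump_sum \<beta> J f x) \<Longrightarrow>
      relative_capacity M \<beta> p q E (ball x0 s) \<Omega> \<le>
        ennreal K3 * lpq p q f"
    using relative_capacity_le_bump_sum[OF p q \<beta>] by blast
  \<comment> \<open>c^5 compares the ball of radius 3 r / 2 at x0 with that of radius 2^(-m) at a
    point of E, and (2 K1)^p comes from a large-scale part of at least 1/2. In \<open>KB\<close>,
    4^p is the price of multiplying the sequence by 4.\<close>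
  define KA where "KA = K2 * c ^ 5 * (2 * K1) powr p"
  define KB where "KB = K3 * 4 powr p"
  have KA: "0 < KA" and KB: "0 < KB" using K1 K2 K3 c_gt_1 by (auto simp: KA_def KB_def)
  show thesis
  proof (rule that[of "KA + KB"])
    show "0 < KA + KB" using KA KB by simp
    fix f :: "int \<Rightarrow> 'a \<Rightarrow> ennreal" and x0 :: 'a and r :: real and E \<Omega> :: "'a set"
    assume r: "0 < r" and E: "compact E" "E \<subseteq> cball x0 r" and \<Omega>: "\<Omega> \<in> sets M"
      and f_borel: "\<And>n. n \<in> levels (UNIV :: 'a set) \<Longrightarrow> f n \<in> borel_measurable borel"
      and pot: "\<And>x. x \<in> E \<Longrightarrow> 1 \<le> potential M \<beta> f x"
    define L where "L = levels (UNIV :: 'a set)"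
    \<comment> \<open>Outside the admissible scales f is arbitrary, possibly not measurable; it is
      replaced by zero there.\<close>
    define h where "h n y = (if n \<in> L then f n y else 0)" for n y
    have h_meas [measurable]: "h n \<in> borel_measurable M" for n
      using f_borel[of n, THEN borel_measurable_imp_measurable]
      by (cases "n \<in> L") (auto simp: h_def[abs_def] L_def)
    define \<Phi> where "\<Phi> = lpq p q h"
    have \<Phi>_eq: "\<Phi> = (\<integral>\<^sup>+x. ennpowr (lq_norm L q (\<lambda>n. f n x)) p \<partial>M)"
      unfolding \<Phi>_def h_def lq_norm_restrict[OF q] ..
    have h_\<Phi>: "(\<integral>\<^sup>+y. ennpowr (h n y) p \<partial>M) \<le> \<Phi>" for n
      unfolding \<Phi>_def using p q by (intro nn_integral_mono ennpowr_mono) (auto intro: le_lq_norm)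
    \<comment> \<open>Radii of scales n \<ge> m are at most r / 4, so these scales act close to the
      ball; r < 8 * 2^(-m) keeps volumes at scale m comparable to that of the ball.\<close>
    obtain m :: int where m: "2 powi (- m) \<le> r / 4" "r / 4 < 2 * 2 powi (- m)"
      using dyadic_scale[of "r / 4"] r by auto
    define u where "u n x = ennreal (2 powr (- \<beta> * n)) * scale_potential n (h n) x" for n :: int and x
    have split: "1 \<le> (\<Sum>\<^sub>\<infinity>n\<in>L \<inter> {..<m}. u n x) + (\<Sum>\<^sub>\<infinity>n\<in>L \<inter> {m..}. u n x)" if "x \<in> E" for x
    proof -
      have "1 \<le> potential M \<beta> f x" using pot[OF that] .
      also have "\<dots> = (\<Sum>\<^sub>\<infinity>n\<in>L. u n x)"
        unfolding potential_def L_def[symmetric] u_def by (intro infsum_cong) (simp add: h_def)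
      also have "\<dots> = (\<Sum>\<^sub>\<infinity>n\<in>(L \<inter> {..<m}) \<union> (L \<inter> {m..}). u n x)"
        by (rule arg_cong[where f = "infsum _"]) auto
      also have "\<dots> = (\<Sum>\<^sub>\<infinity>n\<in>L \<inter> {..<m}. u n x) + (\<Sum>\<^sub>\<infinity>n\<in>L \<inter> {m..}. u n x)"
        by (rule infsum_Un_disjoint) (auto intro: nonneg_summable_on_complete)
      finally show ?thesis .
    qed
    have half: "ennreal (1/2) + ennreal (1/2) = 1" by (subst ennreal_plus[symmetric]) auto
    have "relative_capacity M \<beta> p q E (ball x0 (2 * r)) \<Omega> \<le> ennreal KA * \<Phi> + ennreal KB * \<Phi>"
    proof (cases "\<exists>x\<in>E. ennreal (1/2) \<le> (\<Sum>\<^sub>\<infinity>n\<in>L \<inter> {..<m}. u n x)")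
      case True
      \<comment> \<open>A single such point is enough: it forces the norm of f to dominate a bound
        valid for every subset of the closed ball.\<close>
      then obtain x where x: "x \<in> E" "ennreal (1/2) \<le> (\<Sum>\<^sub>\<infinity>n\<in>L \<inter> {..<m}. u n x)" by blast
      define V where "V = vol x (2 powi (- m))"
      have V: "V \<noteq> 0" "V < top" by (auto simp: V_def)
      have "(\<Sum>\<^sub>\<infinity>n\<in>L \<inter> {..<m}. u n x) \<le>
          ennreal (K1 * 2 powr (- \<beta> * real_of_int m)) * ennpowr (\<Phi> / V) (1 / p)"
        unfolding u_def V_def
      proof (rule K1(2)[OF h_meas h_\<Phi>])
        fix n assume n: "n \<in> L \<inter> {..<m}"
        then have "(2::real) powi (- m) < 2 powi (- n)" by (intro power_int_strict_increasing) auto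
        then show "vol x (2 powi (- m)) / vol x (2 powi (- n)) \<le>
            ennreal (C\<sigma> * (2 powi (- m) / 2 powi (- n)) powr \<sigma>)"
          using n by (intro C\<sigma>) (auto simp: L_def mem_levels_iff)
      qed auto
      with x have "ennreal (1/2) \<le> ennreal (K1 * 2 powr (- \<beta> * real_of_int m)) * ennpowr (\<Phi> / V) (1 / p)"
        by (rule_tac order_trans) auto
      then have "ennpowr (ennreal (1/2)) p \<le> ennpowr (ennreal (K1 * 2 powr (- \<beta> * m)) * ennpowr (\<Phi> / V) (1 / p)) p"
        using p by (rule_tac ennpowr_mono) auto
      then have "ennreal ((1/2) powr p) \<le> ennreal (K1 powr p * 2 powr (- \<beta> * p * m)) * (\<Phi> / V)"
        using p K1(1) ennpowr_ennreal[of "1/2" p]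
        by (simp add: ennpowr_mult ennpowr_ennreal powr_mult powr_powr mult_ac)
      \<comment> \<open>The multiplier isolates 2^(\<beta> p m) V, which up to constants bounds the
        capacity of the ball.\<close>
      then have "ennreal (2 powr p * 2 powr (\<beta> * p * m)) * V * ennreal ((1/2) powr p) \<le>
          ennreal (2 powr p * 2 powr (\<beta> * p * m)) * V * (ennreal (K1 powr p * 2 powr (- \<beta> * p * m)) * (\<Phi> / V))"
        by (intro mult_left_mono) auto
      also have "ennreal (2 powr p * 2 powr (\<beta> * p * m)) * V * ennreal ((1/2) powr p) = ennreal (2 powr (\<beta> * p * m)) * V"
      proof -
        have "2 powr p * 2 powr (\<beta> * p * m) * (1/2) powr p = 2 powr (\<beta> * p * m)"
          by (simp add: powr_divide)
        then show ?thesis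
          by (metis (no_types, lifting) ennreal_mult' mult.assoc mult.commute mult_nonneg_nonneg powr_ge_zero)
      qed
      also have "ennreal (2 powr p * 2 powr (\<beta> * p * m)) * V * (ennreal (K1 powr p * 2 powr (- \<beta> * p * m)) * (\<Phi> / V)) =
          ennreal ((2 powr p * 2 powr (\<beta> * p * m)) * (K1 powr p * 2 powr (- \<beta> * p * m))) * (V * (\<Phi> / V))"
        by (simp add: ennreal_mult mult_ac)
      also have "V * (\<Phi> / V) = \<Phi>"
        using V by (simp add: ennreal_times_divide ennreal_mult_divide_eq mult.commute[of V])
      also have "(2 powr p * 2 powr (\<beta> * p * m)) * (K1 powr p * 2 powr (- \<beta> * p * m)) = (2 * K1) powr p"
        using K1 by (simp add: powr_mult powr_minus)
      finally have V_le: "ennreal (2 powr (\<beta> * p * m)) * V \<le> ennreal ((2 * K1) powr p) * \<Phi>" .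
      have "vol x0 (3 * r / 2) \<le> ennreal (c ^ 5) * V"
        unfolding V_def
      proof (rule emeasure_ball_le_power)
        have "dist x x0 \<le> r" using x E by (auto simp: dist_commute)
        \<comment> \<open>The left side is at most 5 r / 2, which is below 20 * 2^(-m).\<close>
        then show "dist x x0 + 3 * r / 2 \<le> 2 ^ 5 * 2 powi (- m)" using m by simp
      qed auto
      then have "ennreal (K2 * 2 powr (\<beta> * p * m)) * vol x0 (3 * r / 2) \<le>
          ennreal (K2 * 2 powr (\<beta> * p * m)) * (ennreal (c ^ 5) * V)"
        by (intro mult_left_mono) auto
      also have "\<dots> = ennreal (K2 * c ^ 5) * (ennreal (2 powr (\<beta> * p * m)) * V)"
        using K2 c_gt_1 by (simp add: ennreal_mult mult_ac)
      also have "\<dots> \<le> ennreal (K2 * c ^ 5) * (ennreal ((2 * K1) powr p) * \<Phi>)"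
        by (intro mult_left_mono V_le) auto
      also have "\<dots> = ennreal KA * \<Phi>"
        using K2 c_gt_1 by (simp add: KA_def ennreal_mult mult.assoc)
      finally have "relative_capacity M \<beta> p q E (ball x0 (2 * r)) \<Omega> \<le> ennreal KA * \<Phi>"
        using K2(2)[OF r m(1) E(2) \<Omega>] by (rule_tac order_trans)
      then show ?thesis by (simp add: add_increasing2)
    next
      case False
      show ?thesis
      proof (cases "\<Phi> = top")
        case True
        then show ?thesis using KA by (simp add: ennreal_mult_top)
      next
        case \<Phi>_fin: False
        \<comment> \<open>At points of E the cutoff leaves the scale potentials with n \<ge> m
          unchanged. It provides the bounded support needed for finite integrals and for a test
          function that vanishes outside 2B.\<close>
        define h' where "h' n y = h n y * indicator (ball x0 (3 * r / 2)) y" for n y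
        have h'_meas [measurable]: "h' n \<in> borel_measurable M" for n unfolding h'_def by measurable
        have h'_le: "h' n y \<le> h n y" for n y by (auto simp: h'_def indicator_def)
        have fin: "(\<integral>\<^sup>+y. h' n y / vol y (2 powi (- n)) \<partial>M) < top" for n
        proof (rule finite_weighted_integral[of _ p "3 * r / 2" x0])
          have "(\<integral>\<^sup>+y. ennpowr (h' n y) p \<partial>M) \<le> (\<integral>\<^sup>+y. ennpowr (h n y) p \<partial>M)"
            using p by (intro nn_integral_mono ennpowr_mono h'_le) auto
          also have "\<dots> \<le> \<Phi>" by (rule h_\<Phi>)
          also have "\<dots> < top" using \<Phi>_fin by (simp add: less_top)
          finally show "(\<integral>\<^sup>+y. ennpowr (h' n y) p \<partial>M) < top" .
        qed (use p r in \<open>auto simp: h'_def\<close>)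
        \<comment> \<open>Lowering 1/2 to 1/4 makes the inequality strict, as compactness requires;
          the factor 4 in \<open>g\<close> restores admissibility.\<close>
        have "ennreal (1/4) < (\<Sum>\<^sub>\<infinity>n\<in>L \<inter> {m..}. ennreal (2 powr (- \<beta> * n)) * bump_avg M n (h' n) x)"
          if x: "x \<in> E" for x
        proof -
          have "ennreal (1/2) \<le> (\<Sum>\<^sub>\<infinity>n\<in>L \<inter> {m..}. u n x)"
          proof (rule ccontr)
            assume "\<not> ennreal (1/2) \<le> (\<Sum>\<^sub>\<infinity>n\<in>L \<inter> {m..}. u n x)"
            moreover have "(\<Sum>\<^sub>\<infinity>n\<in>L \<inter> {..<m}. u n x) < ennreal (1/2)"
              using False x by (auto simp: not_le)
            ultimately have "(\<Sum>\<^sub>\<infinity>n\<in>L \<inter> {..<m}. u n x) + (\<Sum>\<^sub>\<infinity>n\<in>L \<inter> {m..}. u n x) < ennreal (1/2) + ennreal (1/2)"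
              by (intro add_strict_mono) (auto simp: not_le)
            then show False using split[OF x] unfolding half by simp
          qed
          also have "\<dots> \<le> (\<Sum>\<^sub>\<infinity>n\<in>L \<inter> {m..}. ennreal (2 powr (- \<beta> * n)) * bump_avg M n (h' n) x)"
            unfolding u_def
          proof (intro infsum_ennreal_mono mult_left_mono scale_potential_le_bump_avg)
            fix n y assume n: "n \<in> L \<inter> {m..}" and y: "dist x y < 2 powi (- n)"
            have "(2::real) powi (- n) \<le> 2 powi (- m)" using n by (intro power_int_increasing) auto
            moreover have "dist x0 x \<le> r" using E x by auto
            ultimately have "y \<in> ball x0 (3 * r / 2)"
              using y m r dist_triangle[of x0 y x] by simp
            then show "h n y \<le> h' n y" by (simp add: h'_def)
          qed auto
          finally have "ennreal (1/2) \<le> (\<Sum>\<^sub>\<infinity>n\<in>L \<inter> {m..}. ennreal (2 powr (- \<beta> * n)) * bump_avg M n (h' n) x)" .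
          moreover have "ennreal (1/4) < ennreal (1/2)" by (subst ennreal_less_iff) auto
          ultimately show ?thesis by (rule less_le_trans[rotated])
        qed
        from compact_finite_bump_sum[OF E(1) h'_meas fin this]
        obtain J where J: "finite J" "J \<subseteq> L \<inter> {m..}"
          "\<And>x. x \<in> E \<Longrightarrow> ennreal (1/4) \<le> bump_sum \<beta> J h' x"
          by auto
        define g where "g n y = (if n \<in> J then 4 * h' n y else 0)" for n y
        have g_meas [measurable]: "g n \<in> borel_measurable M" for n
          by (cases "n \<in> J") (auto simp: g_def[abs_def])
        have "relative_capacity M \<beta> p q E (ball x0 (2 * r)) \<Omega> \<le>
            ennreal K3 * lpq p q g"
        proof (rule K3(2)[OF J(1) g_meas])
          show "3 * r / 2 + 2 * 2 powi (- n) \<le> 2 * r" if "n \<in> J" for n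
          proof -
            have "(2::real) powi (- n) \<le> 2 powi (- m)" using that J(2) by (intro power_int_increasing) auto
            then show ?thesis using m by simp
          qed
          show "1 \<le> bump_sum \<beta> J g x" if "x \<in> E" for x
          proof -
            have "4 * ennreal (1/4) \<le> 4 * bump_sum \<beta> J h' x"
              using J(3)[OF that] by (intro mult_left_mono) auto
            also have "\<dots> = bump_sum \<beta> J g x"
              unfolding sum_distrib_left
            proof (intro sum.cong refl)
              fix n assume "n \<in> J"
              then have "g n = (\<lambda>y. 4 * h' n y)" by (simp add: g_def fun_eq_iff)
              then have "bump_avg M n (g n) x = 4 * bump_avg M n (h' n) x"
                by (simp only: bump_avg_cmult h'_meas)
              then show "4 * (ennreal (2 powr (- \<beta> * n)) * bump_avg M n (h' n) x) =
                  ennreal (2 powr (- \<beta> * n)) * bump_avg M n (g n) x"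
                by (simp add: mult_ac)
            qed
            also have "4 * ennreal (1/4) = 1"
              using ennreal_mult[of 4 "1/4"] by simp
            finally show ?thesis .
          qed
        qed (use r \<Omega> in \<open>auto simp: g_def h'_def\<close>)
        also have "lpq p q g \<le>
            (\<integral>\<^sup>+x. ennreal (4 powr p) * ennpowr (lq_norm UNIV q (\<lambda>n. h n x)) p \<partial>M)"
        proof (intro nn_integral_mono)
          fix x
          have "lq_norm UNIV q (\<lambda>n. g n x) \<le> lq_norm UNIV q (\<lambda>n. ennreal 4 * h n x)"
            using h'_le by (intro lq_norm_mono q) (auto simp: g_def intro: mult_left_mono)
          also have "\<dots> = ennreal 4 * lq_norm UNIV q (\<lambda>n. h n x)"
            by (rule lq_norm_cmult[OF q])
          finally have "ennpowr (lq_norm UNIV q (\<lambda>n. g n x)) p \<le> ennpowr (ennreal 4 * lq_norm UNIV q (\<lambda>n. h n x)) p"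
            using p by (rule_tac ennpowr_mono) auto
          also have "\<dots> = ennreal (4 powr p) * ennpowr (lq_norm UNIV q (\<lambda>n. h n x)) p"
            using ennpowr_ennreal[of 4 p] by (simp only: ennpowr_mult)
          finally show "ennpowr (lq_norm UNIV q (\<lambda>n. g n x)) p \<le> \<dots>" .
        qed
        also have "\<dots> = ennreal (4 powr p) * \<Phi>"
          unfolding \<Phi>_def by (intro nn_integral_cmult borel_measurable_ennpowr borel_measurable_lq_norm_UNIV q h_meas)
        finally have "relative_capacity M \<beta> p q E (ball x0 (2 * r)) \<Omega> \<le> ennreal KB * \<Phi>"
          using K3(1) by (simp add: KB_def ennreal_mult mult.assoc mult_left_mono)
        then show ?thesis by (simp add: add_increasing)
      qed
    qed
    then show "relative_capacity M \<beta> p q E (ball x0 (2 * r)) \<Omega> \<le>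
        ennreal (KA + KB) * (\<integral>\<^sup>+x. ennpowr (lq_norm (levels (UNIV :: 'a set)) q (\<lambda>n. f n x)) p \<partial>M)"
      using KA KB unfolding \<Phi>_eq L_def by (simp add: distrib_right ennreal_plus)
  qed
qed

end

section \<open>Potentials from fractional gradients\<close>

context doubling_space
begin

lemma emeasure_uniform_space:
  assumes "A \<in> sets M" "emeasure M A \<noteq> 0" "emeasure M A < top"
  shows "emeasure (uniform_measure M A) (space M) = 1"
  using assms by (simp add: emeasure_uniform_measure Int_absorb1 sets.sets_into_space)

text \<open>The pointwise inequality is averaged in z over Q and then in y over P; N is null for
  both normalized measures.\<close>

lemma mean_value_diff_le:
  assumes P: "P \<in> sets M" "emeasure M P \<noteq> 0" "emeasure M P < top"
    and Q: "Q \<in> sets M" "emeasure M Q \<noteq> 0" "emeasure M Q < top"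
    and [measurable]: "u \<in> borel_measurable M" "G \<in> borel_measurable M"
    and N: "N \<in> null_sets M"
    and le: "\<And>y z. y \<in> P - N \<Longrightarrow> z \<in> Q - N \<Longrightarrow> u y \<le> u z + D * (G y + G z)"
  shows "(\<integral>\<^sup>+y. u y \<partial>uniform_measure M P) \<le> (\<integral>\<^sup>+z. u z \<partial>uniform_measure M Q) +
    D * ((\<integral>\<^sup>+y. G y \<partial>uniform_measure M P) + (\<integral>\<^sup>+z. G z \<partial>uniform_measure M Q))"
proof -
  have ae: "AE y in M. y \<notin> N" using N by (rule AE_not_in)
  have aeP: "AE y in uniform_measure M P. y \<in> P - N"
    using ae by (intro AE_uniform_measureI P) auto
  have aeQ: "AE y in uniform_measure M Q. y \<in> Q - N"
    using ae by (intro AE_uniform_measureI Q) auto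
  define UQ where "UQ = (\<integral>\<^sup>+z. u z \<partial>uniform_measure M Q)"
  define GQ where "GQ = (\<integral>\<^sup>+z. G z \<partial>uniform_measure M Q)"
  have one: "emeasure (uniform_measure M P) (space M) = 1" "emeasure (uniform_measure M Q) (space M) = 1"
    using P Q by (auto intro: emeasure_uniform_space)
  have "u y \<le> UQ + D * (G y + GQ)" if y: "y \<in> P - N" for y
  proof -
    have "u y = (\<integral>\<^sup>+z. u y \<partial>uniform_measure M Q)" using one by simp
    also have "\<dots> \<le> (\<integral>\<^sup>+z. u z + D * (G y + G z) \<partial>uniform_measure M Q)"
    proof (rule nn_integral_mono_AE)
      show "AE z in uniform_measure M Q. u y \<le> u z + D * (G y + G z)"
        using aeQ by eventually_elim (rule le[OF y])
    qed
    also have "\<dots> = UQ + D * (G y + GQ)"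
      using one unfolding UQ_def GQ_def by (simp add: nn_integral_add nn_integral_cmult)
    finally show ?thesis .
  qed
  then have "AE y in uniform_measure M P. u y \<le> UQ + D * (G y + GQ)"
    using aeP by (rule_tac eventually_mono)
  then have "(\<integral>\<^sup>+y. u y \<partial>uniform_measure M P) \<le> (\<integral>\<^sup>+y. UQ + D * (G y + GQ) \<partial>uniform_measure M P)"
    by (rule nn_integral_mono_AE)
  also have "\<dots> = UQ + D * ((\<integral>\<^sup>+y. G y \<partial>uniform_measure M P) + GQ)"
    using one by (simp add: nn_integral_add nn_integral_cmult)
  finally show ?thesis by (simp add: UQ_def GQ_def)
qed

lemma mean_value_le_ball_avg:
  assumes [measurable]: "G \<in> borel_measurable M" "P \<in> sets M"
    and P: "emeasure M P \<noteq> 0" "emeasure M P < top" "P \<subseteq> ball x r"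
    and r: "0 < r" and \<kappa>: "0 < \<kappa>" "vol x r \<le> ennreal \<kappa> * emeasure M P"
  shows "(\<integral>\<^sup>+y. G y \<partial>uniform_measure M P) \<le> ennreal \<kappa> * ball_avg M r G x"
proof -
  have "1 / emeasure M P \<le> ennreal \<kappa> * (1 / vol x r)"
  proof -
    define i where "i = 1 / vol x r"
    have "vol x r * i = 1"
      using r by (simp add: i_def ennreal_times_divide)
    then have "1 \<le> ennreal \<kappa> * emeasure M P * i"
      using \<kappa> by (metis mult_right_mono zero_le)
    then have "1 / emeasure M P \<le> (ennreal \<kappa> * i) * emeasure M P / emeasure M P"
      by (intro divide_right_mono_ennreal) (simp add: mult_ac)
    also have "\<dots> = ennreal \<kappa> * i"
      using P by (intro ennreal_mult_divide_eq) auto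
    finally show ?thesis by (simp add: i_def)
  qed
  moreover have "(\<integral>\<^sup>+y. G y * indicator P y \<partial>M) \<le> (\<integral>\<^sup>+y. G y * indicator (ball x r) y \<partial>M)"
    using P by (intro nn_integral_mono) (auto simp: indicator_def)
  ultimately have "(\<integral>\<^sup>+y. G y * indicator P y \<partial>M) * (1 / emeasure M P) \<le>
      (\<integral>\<^sup>+y. G y * indicator (ball x r) y \<partial>M) * (ennreal \<kappa> * (1 / vol x r))"
    by (intro mult_mono) auto
  then show ?thesis
    by (simp add: nn_integral_uniform_measure ball_avg_eq ennreal_times_divide mult.commute[of _ "ennreal \<kappa>"])
qed

text \<open>Up to c^2 the average at x is below the average of doubled radius at every y within
  2^(-n) of x. Integrating this over such y against the kernel of the potential costs one more
  c.\<close>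

lemma ball_avg_le_scale_potential:
  assumes [measurable]: "G \<in> borel_measurable M"
  shows "ball_avg M (2 powi (- n)) G x \<le>
    ennreal (c ^ 3) * scale_potential n (ball_avg M (2 * 2 powi (- n)) G) x"
proof -
  define r where "r = (2::real) powi (- n)"
  have r: "0 < r" by (simp add: r_def)
  define T where "T = ball_avg M r G x"
  note measurable_ball_kernel[of M M r, OF borel_subset borel_subset, measurable]
  have [measurable]: "(\<lambda>y. indicator (ball y r) x :: ennreal) \<in> borel_measurable M"
  proof -
    have "(\<lambda>y. indicator (ball y r) x :: ennreal) = indicator (ball x r)"
      by (auto simp: indicator_def fun_eq_iff dist_commute)
    then show ?thesis by simp
  qed
  have "T = T * (vol x r / vol x r)" using r by simp
  also have "\<dots> = (\<integral>\<^sup>+y. T / vol x r * indicator (ball x r) y \<partial>M)"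
    by (subst nn_integral_cmult_indicator) (auto simp: ennreal_times_divide ennreal_divide_times)
  also have "\<dots> \<le> (\<integral>\<^sup>+y. ennreal (c ^ 3) *
      (indicator (ball y r) x / vol y r * ball_avg M (2 * r) G y) \<partial>M)"
  proof (intro nn_integral_mono)
    fix y
    show "T / vol x r * indicator (ball x r) y \<le>
        ennreal (c ^ 3) * (indicator (ball y r) x / vol y r * ball_avg M (2 * r) G y)"
    proof (cases "dist x y < r")
      case True
      have "T \<le> ennreal (c\<^sup>2) * ball_avg M (2 * r) G y"
        unfolding T_def using r True by (intro ball_avg_le_ball_avg_double) auto
      moreover have "1 / vol x r \<le> ennreal c * (1 / vol y r)"
        using r True c_gt_1 by (intro inverse_emeasure_le emeasure_ball_le_near) (auto simp: dist_commute)
      ultimately have "T * (1 / vol x r) \<le>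
          (ennreal (c\<^sup>2) * ball_avg M (2 * r) G y) * (ennreal c * (1 / vol y r))"
        by (intro mult_mono) auto
      also have "\<dots> = ennreal (c ^ 3) * (1 / vol y r * ball_avg M (2 * r) G y)"
        using c_gt_1 by (simp add: power3_eq_cube power2_eq_square ennreal_mult mult_ac)
      finally show ?thesis
        using True by (simp add: dist_commute ennreal_times_divide)
    qed simp
  qed
  also have "\<dots> = ennreal (c ^ 3) * (\<integral>\<^sup>+y. indicator (ball y r) x / vol y r * ball_avg M (2 * r) G y \<partial>M)"
    by (rule nn_integral_cmult) measurable
  finally show ?thesis by (simp add: T_def r_def)
qed

text \<open>Reverse doubling from 2 r to 4 r leaves at least the fraction 1 - cR of the larger ball
  to the annulus. The factor c^2 reflects r + 10 r \<le> 2^2 * 4 r.\<close>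

lemma annulus_emeasure:
  assumes rd: "0 < cR" "cR < 1" "vol x0 (2 * r) \<le> ennreal cR * vol x0 (4 * r)"
    and r: "0 < r" and le: "dist x0 x \<le> r" "\<rho> \<le> 10 * r"
  defines "Z \<equiv> ball x0 (4 * r) - ball x0 (2 * r)"
  shows "emeasure M Z \<noteq> 0" "emeasure M Z < top"
    "vol x \<rho> \<le> ennreal (c ^ 2 / (1 - cR)) * emeasure M Z"
proof -
  have fin: "emeasure M Z \<le> vol x0 (4 * r)"
    unfolding Z_def by (intro emeasure_mono) auto
  then show "emeasure M Z < top" using emeasure_ball_finite by (rule le_less_trans)
  then obtain z where z: "emeasure M Z = ennreal z" "0 \<le> z" by (cases "emeasure M Z") auto
  obtain b where b: "vol x0 (4 * r) = ennreal b" "0 < b"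
    using r emeasure_ball_finite[of x0 "4 * r"] ball_pos[of "4 * r" x0]
    by (metis ennreal_cases ennreal_less_zero_iff less_irrefl mult_pos_pos zero_less_numeral)
  have "ennreal b \<le> emeasure M Z + vol x0 (2 * r)"
    unfolding b(1)[symmetric] Z_def
    by (rule order_trans[OF emeasure_mono emeasure_subadditive]) auto
  also have "\<dots> \<le> ennreal z + ennreal cR * ennreal b"
    using rd z b by (intro add_mono) auto
  also have "\<dots> = ennreal (z + cR * b)"
    using rd z b by (simp add: ennreal_mult)
  finally have "b \<le> z + cR * b" using rd z b by (subst (asm) ennreal_le_iff) auto
  then have zb: "(1 - cR) * b \<le> z" by (simp add: algebra_simps)
  then have "0 < z" using b rd by (smt (verit) mult_pos_pos)
  then show "emeasure M Z \<noteq> 0" using z by simp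
  have "b \<le> z / (1 - cR)" using zb rd by (simp add: field_simps)
  have "vol x \<rho> \<le> ennreal (c ^ 2) * vol x0 (4 * r)"
    using r le by (intro emeasure_ball_le_power) auto
  also have "\<dots> \<le> ennreal (c ^ 2) * ennreal (z / (1 - cR))"
    unfolding b(1) using \<open>b \<le> z / (1 - cR)\<close> by (intro mult_left_mono ennreal_leI) auto
  also have "\<dots> = ennreal (c ^ 2 / (1 - cR)) * emeasure M Z"
    using rd z by (simp flip: ennreal_mult)
  finally show "vol x \<rho> \<le> ennreal (c ^ 2 / (1 - cR)) * emeasure M Z" .
qed

text \<open>For distinct points the distance lies in one dyadic band k, and k \<ge> n - 1. If k
  \<ge> n, its power \<beta> is at most 2^(-\<beta> n) \<open>decay \<beta> (k - n)\<close>, which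
  is one weight of the supremum; the band k = n - 1 loses 2^(2 \<beta>) \<le> 4, the origin of the
  constant 4.\<close>

lemma hajlasz_pointwise_le:
  fixes \<beta> :: real and u :: "'a \<Rightarrow> real" and g :: "int \<Rightarrow> 'a \<Rightarrow> ennreal"
  assumes \<beta>: "0 < \<beta>" "\<beta> < 1"
    and g: "\<And>k. 2 powi (- k - 1) \<le> dist y z \<Longrightarrow> dist y z < 2 powi (- k) \<Longrightarrow>
      ennreal \<bar>u y - u z\<bar> \<le> ennreal (dist y z powr \<beta>) * (g k y + g k z)"
    and d: "dist y z < 2 * 2 powi (- n)" and u: "0 \<le> u y" "0 \<le> u z"
  defines "G \<equiv> \<lambda>y. SUP j. ennreal (decay \<beta> (j - n)) * g j y"
  shows "ennreal (u y) \<le> ennreal (u z) + ennreal (4 * 2 powr (- \<beta> * n)) * (G y + G z)"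
proof (cases "y = z")
  case True
  then show ?thesis by simp
next
  case False
  then have d0: "0 < dist y z" by simp
  obtain m :: int where m: "2 powi (- m) \<le> dist y z" "dist y z < 2 * 2 powi (- m)"
    using dyadic_scale[OF d0] by blast
  define k where "k = m - 1"
  have k: "2 powi (- k - 1) \<le> dist y z" "dist y z < 2 powi (- k)"
    using m power_int_add[of "2::real" 1 "- m"] by (auto simp: k_def)
  have "n - 1 \<le> k"
  proof (rule ccontr)
    assume "\<not> n - 1 \<le> k"
    then have "(2::real) powi (1 - n) \<le> 2 powi (- k - 1)" by (intro power_int_increasing) auto
    then show False using d k power_int_add[of "2::real" 1 "- n"] by simp
  qed
  have w: "dist y z powr \<beta> \<le> 4 * 2 powr (- \<beta> * n) * decay \<beta> (k - n)"
  proof -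
    have "dist y z powr \<beta> \<le> (2 powi (- k)) powr \<beta>"
      using k \<beta> by (intro powr_mono2) auto
    also have "\<dots> = 2 powr (- \<beta> * k)"
      by (simp add: powr_powr mult.commute flip: powr_real_of_int')
    also have "\<dots> \<le> 4 * 2 powr (- \<beta> * n) * decay \<beta> (k - n)"
    proof (cases "n \<le> k")
      case True
      then have "2 powr (- \<beta> * n) * decay \<beta> (k - n) = 2 powr (- \<beta> * k)"
        by (simp add: algebra_simps flip: powr_add)
      then show ?thesis by (simp add: mult.assoc)
    next
      case False
      then have kn: "k = n - 1" using \<open>n - 1 \<le> k\<close> by linarith
      have "2 powr (- \<beta> * k) = 2 powr (2 * \<beta>) * (2 powr (- \<beta> * n) * decay \<beta> (k - n))"
        by (simp add: kn algebra_simps flip: powr_add)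
      also have "2 powr (2 * \<beta>) \<le> 2 powr 2" using \<beta> by (intro powr_mono) auto
      finally show ?thesis by (simp add: mult_right_mono mult.assoc)
    qed
    finally show ?thesis .
  qed
  have G: "ennreal (dist y z powr \<beta>) * g k v \<le> ennreal (4 * 2 powr (- \<beta> * n)) * G v" for v
  proof -
    have "ennreal (dist y z powr \<beta>) * g k v \<le>
        ennreal (4 * 2 powr (- \<beta> * n) * decay \<beta> (k - n)) * g k v"
      using w by (intro mult_right_mono ennreal_leI) auto
    also have "\<dots> = ennreal (4 * 2 powr (- \<beta> * n)) * (ennreal (decay \<beta> (k - n)) * g k v)"
      by (simp add: ennreal_mult mult.assoc)
    also have "\<dots> \<le> ennreal (4 * 2 powr (- \<beta> * n)) * G v"
      unfolding G_def by (intro mult_left_mono SUP_upper) auto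
    finally show ?thesis .
  qed
  have "ennreal (u y) \<le> ennreal (u z + \<bar>u y - u z\<bar>)" by (intro ennreal_leI) auto
  also have "\<dots> = ennreal (u z) + ennreal \<bar>u y - u z\<bar>" using u by (simp add: ennreal_plus)
  also have "\<dots> \<le> ennreal (u z) + ennreal (4 * 2 powr (- \<beta> * n)) * (G y + G z)"
    using g[OF k] G[of y] G[of z] unfolding distrib_left
    by (intro add_left_mono) (meson add_mono order_trans)
  finally show ?thesis .
qed

text \<open>Means of u are compared along Z and the successive balls about x, beginning with the
  value 0 on Z. Continuity takes the place of Lebesgue's differentiation theorem: the mean reaches
  1/2 after finitely many balls, whatever the point x with u x = 1.\<close>

lemma one_le_sum_ball_avg:
  fixes \<beta> :: real and u :: "'a \<Rightarrow> real" and G :: "int \<Rightarrow> 'a \<Rightarrow> ennreal"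
  assumes G [measurable]: "\<And>n. G n \<in> borel_measurable M"
    and u: "continuous_on UNIV u" "\<And>y. 0 \<le> u y" "u x = 1"
    and N: "N \<in> null_sets M"
    and le: "\<And>n y z. m \<le> n \<Longrightarrow> y \<in> ball x (2 powi (- n)) - N \<Longrightarrow> z \<in> ball x (2 powi (- n)) - N \<Longrightarrow>
      ennreal (u y) \<le> ennreal (u z) + ennreal (4 * 2 powr (- \<beta> * n)) * (G n y + G n z)"
    and Z: "Z \<in> sets M" "Z \<subseteq> ball x (2 powi (- m))" "emeasure M Z \<noteq> 0" "\<And>y. y \<in> Z \<Longrightarrow> u y = 0"
    and \<kappa>: "c \<le> \<kappa>" "vol x (2 powi (- m)) \<le> ennreal \<kappa> * emeasure M Z"
  obtains i :: nat where
    "1 \<le> (\<Sum>n\<in>{m..m + int i}. ennreal (32 * \<kappa> * 2 powr (- \<beta> * n)) * ball_avg M (2 powi (- n)) (G n) x)"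
proof -
  define U where "U y = ennreal (u y)" for y
  have [measurable]: "U \<in> borel_measurable M"
    unfolding U_def using u(1)
    by (intro borel_measurable_imp_measurable measurable_compose[OF _ measurable_ennreal] borel_measurable_continuous_onI)
  define B where "B n = ball x (2 powi (- n))" for n :: int
  have B: "B n \<in> sets M" "emeasure M (B n) \<noteq> 0" "emeasure M (B n) < top" for n
    by (auto simp: B_def)
  define a where "a n = ball_avg M (2 powi (- n)) U x" for n
  define T where "T n = ball_avg M (2 powi (- n)) (G n) x" for n
  have \<kappa>1: "1 \<le> \<kappa>" using \<kappa> c_gt_1 by simp
  \<comment> \<open>Both sets lie in \<open>B n\<close> and fill a fixed part of it. The pointwise
    constant 4, the two means of \<open>G n\<close> and the factor \<kappa> for each give 8
    \<kappa>.\<close>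
  have step: "(\<integral>\<^sup>+y. U y \<partial>uniform_measure M P) \<le> (\<integral>\<^sup>+y. U y \<partial>uniform_measure M Q) +
      ennreal (8 * \<kappa> * 2 powr (- \<beta> * n)) * T n"
    if "m \<le> n" and P: "P \<in> sets M" "P \<subseteq> B n" "emeasure M P \<noteq> 0" "emeasure M (B n) \<le> ennreal \<kappa> * emeasure M P"
      and Q: "Q \<in> sets M" "Q \<subseteq> B n" "emeasure M Q \<noteq> 0" "emeasure M (B n) \<le> ennreal \<kappa> * emeasure M Q"
    for n P Q
  proof -
    have fin: "emeasure M P < top" "emeasure M Q < top"
      using P Q B(3)[of n] emeasure_mono[OF P(2) B(1)] emeasure_mono[OF Q(2) B(1)] by (auto intro: le_less_trans)
    have "(\<integral>\<^sup>+y. U y \<partial>uniform_measure M P) \<le> (\<integral>\<^sup>+y. U y \<partial>uniform_measure M Q) +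
        ennreal (4 * 2 powr (- \<beta> * n)) *
          ((\<integral>\<^sup>+y. G n y \<partial>uniform_measure M P) + (\<integral>\<^sup>+y. G n y \<partial>uniform_measure M Q))"
    proof (rule mean_value_diff_le[OF P(1,3) fin(1) Q(1,3) fin(2) _ _ N])
      show "U y \<le> U z + ennreal (4 * 2 powr (- \<beta> * n)) * (G n y + G n z)"
        if "y \<in> P - N" "z \<in> Q - N" for y z
        unfolding U_def using that P(2) Q(2) by (intro le[OF \<open>m \<le> n\<close>]) (auto simp: B_def)
    qed auto
    also have "\<dots> \<le> (\<integral>\<^sup>+y. U y \<partial>uniform_measure M Q) +
        ennreal (4 * 2 powr (- \<beta> * n)) * (ennreal \<kappa> * T n + ennreal \<kappa> * T n)"
      unfolding T_def using P Q fin \<kappa>1 unfolding B_def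
      by (intro add_left_mono mult_left_mono add_mono mean_value_le_ball_avg) auto
    also have "ennreal (4 * 2 powr (- \<beta> * n)) * (ennreal \<kappa> * T n + ennreal \<kappa> * T n) =
        ennreal (8 * \<kappa> * 2 powr (- \<beta> * n)) * T n"
    proof -
      have "ennreal \<kappa> * T n + ennreal \<kappa> * T n = (ennreal \<kappa> + ennreal \<kappa>) * T n"
        by (simp only: distrib_right)
      also have "ennreal \<kappa> + ennreal \<kappa> = ennreal (\<kappa> + \<kappa>)"
        using \<kappa>1 by (intro ennreal_plus[symmetric]) auto
      finally have "ennreal (4 * 2 powr (- \<beta> * n)) * (ennreal \<kappa> * T n + ennreal \<kappa> * T n) =
          ennreal (4 * 2 powr (- \<beta> * n)) * ennreal (\<kappa> + \<kappa>) * T n"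
        by (simp only: mult.assoc)
      also have "ennreal (4 * 2 powr (- \<beta> * n)) * ennreal (\<kappa> + \<kappa>) = ennreal (4 * 2 powr (- \<beta> * n) * (\<kappa> + \<kappa>))"
        using \<kappa>1 by (intro ennreal_mult[symmetric]) auto
      also have "4 * 2 powr (- \<beta> * n) * (\<kappa> + \<kappa>) = 8 * \<kappa> * 2 powr (- \<beta> * n)" by simp
      finally show ?thesis .
    qed
    finally show ?thesis .
  qed
  define t where "t n = ennreal (8 * \<kappa> * 2 powr (- \<beta> * n)) * T n" for n
  have \<kappa>_mono: "v \<le> ennreal \<kappa> * v" for v
    using \<kappa>1 mult_right_mono[of 1 "ennreal \<kappa>" v] by simp
  \<comment> \<open>The separate \<open>t m\<close> pays for passing from Z to \<open>B m\<close>;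
    the sum pays for passing between consecutive balls and for i > 0 contains \<open>t m\<close>
    once more.\<close>
  have a: "a (m + int i) \<le> t m + (\<Sum>n\<in>{m..<m + int i}. t n)" for i
  proof (induction i)
    case 0
    have "(\<integral>\<^sup>+y. U y \<partial>uniform_measure M Z) = 0"
    proof -
      have "(\<integral>\<^sup>+y. U y * indicator Z y \<partial>M) = (\<integral>\<^sup>+y. 0 \<partial>M)"
        using Z(4) by (intro nn_integral_cong) (auto simp: U_def indicator_def)
      then show ?thesis using Z(1) by (simp add: nn_integral_uniform_measure)
    qed
    then show ?case
      using step[of m "B m" Z] Z \<kappa>(2) B[of m] \<kappa>_mono[of "emeasure M (B m)"]
      by (simp add: a_def ball_avg_def B_def t_def)
  next
    case (Suc i)
    have sub: "B (m + int (Suc i)) \<subseteq> B (m + int i)"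
      unfolding B_def by (intro subset_ball power_int_increasing) auto
    have half: "2 * (2::real) powi (- (m + int (Suc i))) = 2 powi (- (m + int i))"
    proof -
      have eq: "- (m + int i) = 1 + - (m + int (Suc i))" by simp
      show ?thesis unfolding eq by (subst power_int_add) auto
    qed
    have "emeasure M (B (m + int i)) \<le> ennreal c * emeasure M (B (m + int (Suc i)))"
      using doubling_ball[of "2 powi (- (m + int (Suc i)))" x] unfolding B_def half by simp
    also have "\<dots> \<le> ennreal \<kappa> * emeasure M (B (m + int (Suc i)))"
      using \<kappa> by (intro mult_right_mono ennreal_leI) auto
    finally have "a (m + int (Suc i)) \<le> a (m + int i) + t (m + int i)"
      unfolding a_def ball_avg_def B_def[symmetric] t_def
      using B sub by (intro step \<kappa>_mono) auto
    also have "\<dots> \<le> (t m + (\<Sum>n\<in>{m..<m + int i}. t n)) + t (m + int i)"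
      by (intro add_right_mono Suc)
    also have "\<dots> = t m + (\<Sum>n\<in>{m..<m + int (Suc i)}. t n)"
    proof -
      have "{m..<m + int (Suc i)} = insert (m + int i) {m..<m + int i}" by auto
      then show ?thesis by (simp add: add_ac)
    qed
    finally show ?case .
  qed
  have "\<exists>d>0. \<forall>y. dist y x < d \<longrightarrow> dist (u y) (u x) < 1/2"
    using u(1) unfolding continuous_on_iff by (metis UNIV_I half_gt_zero zero_less_one)
  then obtain d where d: "0 < d" "\<And>y. dist y x < d \<Longrightarrow> dist (u y) (u x) < 1/2" by blast
  obtain i :: nat where "2 powi (- m) / d < 2 ^ i"
    using real_arch_pow[of 2] by auto
  then have i: "2 powi (- (m + int i)) < d"
    using d(1) by (simp add: power_int_diff field_simps)
  have "ennreal (1/2) \<le> a (m + int i)"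
  proof -
    have "emeasure (uniform_measure M (B (m + int i))) (space M) = 1"
      by (intro emeasure_uniform_space B)
    then have "ennreal (1/2) = (\<integral>\<^sup>+y. ennreal (1/2) \<partial>uniform_measure M (B (m + int i)))"
      by (simp only: nn_integral_const space_uniform_measure mult_1_right)
    also have "\<dots> \<le> (\<integral>\<^sup>+y. U y \<partial>uniform_measure M (B (m + int i)))"
    proof (intro nn_integral_mono_AE AE_uniform_measureI B AE_I2 impI)
      fix y assume "y \<in> B (m + int i)"
      then have "dist y x < d" using i by (simp add: B_def dist_commute)
      then have "1/2 \<le> u y" using d(2)[of y] u(3) by (simp add: dist_real_def abs_if split: if_splits)
      then show "ennreal (1/2) \<le> U y" unfolding U_def by (rule ennreal_leI)
    qed
    finally show ?thesis by (simp add: a_def ball_avg_def B_def)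
  qed
  also note a[of i]
  also have "t m + (\<Sum>n\<in>{m..<m + int i}. t n) \<le>
      (\<Sum>n\<in>{m..m + int i}. t n) + (\<Sum>n\<in>{m..m + int i}. t n)"
    by (intro add_mono sum_mono2 member_le_sum) auto
  finally have *: "ennreal (1/2) \<le> 2 * (\<Sum>n\<in>{m..m + int i}. t n)" by (simp only: mult_2)
  \<comment> \<open>32 = 4 * 8, with one factor 2 for the mean being only 1/2 and one for the
    repeated \<open>t m\<close>.\<close>
  have "1 = 2 * ennreal (1/2)" using ennreal_mult[of 2 "1/2"] by simp
  also have "\<dots> \<le> 2 * (2 * (\<Sum>n\<in>{m..m + int i}. t n))"
    using * by (intro mult_left_mono) auto
  also have "\<dots> = (\<Sum>n\<in>{m..m + int i}. ennreal (32 * \<kappa> * 2 powr (- \<beta> * n)) * T n)"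
  proof -
    have "4 * t n = ennreal (32 * \<kappa> * 2 powr (- \<beta> * n)) * T n" for n
    proof -
      have "4 * t n = ennreal 4 * ennreal (8 * \<kappa> * 2 powr (- \<beta> * n)) * T n" by (simp add: t_def mult.assoc)
      also have "ennreal 4 * ennreal (8 * \<kappa> * 2 powr (- \<beta> * n)) = ennreal (4 * (8 * \<kappa> * 2 powr (- \<beta> * n)))"
        using \<kappa>1 by (intro ennreal_mult[symmetric]) auto
      finally show ?thesis by (simp add: mult.assoc)
    qed
    then show ?thesis by (simp add: mult.assoc[symmetric] sum_distrib_left)
  qed
  finally show thesis unfolding T_def by (rule that)
qed

lemma potential_capacity_le_gradient:
  fixes p \<beta> \<Lambda> :: real and q :: ennreal
  assumes p: "1 < p" and q: "1 < q" and \<beta>: "0 < \<beta>" "\<beta> < 1" and \<Lambda>: "11 \<le> \<Lambda>"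
    and rd: "reverse_doubling M"
  obtains K :: real where "0 < K"
    "\<And>x0 r E \<phi> g. 0 < r \<Longrightarrow> ennreal (4 * r) < ediam (UNIV :: 'a set) / 2 \<Longrightarrow>
      ennreal (10 * r) \<le> 2 * ediam (UNIV :: 'a set) \<Longrightarrow> E \<subseteq> cball x0 r \<Longrightarrow>
      continuous_on UNIV \<phi> \<Longrightarrow> (\<And>x. x \<in> E \<Longrightarrow> 1 \<le> \<phi> x) \<Longrightarrow> (\<And>x. x \<notin> ball x0 (2 * r) \<Longrightarrow> \<phi> x = 0) \<Longrightarrow>
      g \<in> hajlasz_gradients M \<beta> (ball x0 (\<Lambda> * r)) \<phi> \<Longrightarrow>
      potential_capacity M \<beta> p q E \<le> ennreal K * ennpowr (mixed_norm M (ball x0 (\<Lambda> * r)) UNIV p q g) p"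
proof -
  obtain cR :: real where cR: "0 < cR" "cR < 1"
    "\<And>x r. 0 < r \<Longrightarrow> ennreal r < ediam (UNIV :: 'a set) / 2 \<Longrightarrow>
       vol x (r / 2) \<le> ennreal cR * vol x r"
    using rd unfolding reverse_doubling_def by blast
  \<comment> \<open>c serves the passage between consecutive balls, c^2 / (1 - cR) the passage from
    the annulus to the first ball.\<close>
  define \<kappa> where "\<kappa> = max c (c ^ 2 / (1 - cR))"
  have \<kappa>: "c \<le> \<kappa>" "c ^ 2 / (1 - cR) \<le> \<kappa>" by (auto simp: \<kappa>_def)
  then have \<kappa>0: "0 < \<kappa>" using c_gt_1 by linarith
  obtain K1 :: real where K1: "0 < K1"
    "\<And>a. lq_norm UNIV q (\<lambda>k. SUP n. ennreal (decay \<beta> (n - k)) * a n) \<le>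
      ennreal K1 * lq_norm UNIV q a"
    using lq_norm_SUP_geometric_le[of \<beta> q] \<beta> q by auto
  obtain K2 where K2: "0 < K2"
    "\<And>(h :: int \<Rightarrow> 'a \<Rightarrow> ennreal) R. (\<And>j. h j \<in> borel_measurable M) \<Longrightarrow> 0 < R \<Longrightarrow>
      lpq p q (\<lambda>n. ball_avg M (R * 2 powi (- n)) (h n)) \<le>
        ennreal K2 * lpq p q h"
    using lq_norm_ball_avg[OF p q] by blast
  define C where "C = 32 * \<kappa> * c ^ 3"
  have C: "0 < C" using \<kappa>0 c_gt_1 by (simp add: C_def)
  define K where "K = C powr p * (K2 * K1 powr p)"
  have K: "0 < K" using C K1 K2 by (simp add: K_def)
  show thesis
  proof (rule that[OF K])
    fix x0 :: 'a and r :: real and E :: "'a set" and \<phi> :: "'a \<Rightarrow> real" and g :: "int \<Rightarrow> 'a \<Rightarrow> ennreal"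
    assume r: "0 < r" "ennreal (4 * r) < ediam (UNIV :: 'a set) / 2" "ennreal (10 * r) \<le> 2 * ediam (UNIV :: 'a set)"
      and E: "E \<subseteq> cball x0 r" and cont: "continuous_on UNIV \<phi>"
      and \<phi>E: "\<And>x. x \<in> E \<Longrightarrow> 1 \<le> \<phi> x" and \<phi>0: "\<And>x. x \<notin> ball x0 (2 * r) \<Longrightarrow> \<phi> x = 0"
      and g: "g \<in> hajlasz_gradients M \<beta> (ball x0 (\<Lambda> * r)) \<phi>"
    define \<Omega> where "\<Omega> = ball x0 (\<Lambda> * r)"
    have \<Omega> [measurable]: "\<Omega> \<in> sets M" by (simp add: \<Omega>_def)
    obtain N where N: "N \<in> null_sets M"
      and grad: "\<And>k x y. x \<in> \<Omega> - N \<Longrightarrow> y \<in> \<Omega> - N \<Longrightarrow> 2 powi (- k - 1) \<le> dist x y \<Longrightarrow> dist x y < 2 powi (- k) \<Longrightarrow>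
        ennreal \<bar>\<phi> x - \<phi> y\<bar> \<le> ennreal (dist x y powr \<beta>) * (g k x + g k y)"
      using g unfolding hajlasz_gradients_def \<Omega>_def by blast
    \<comment> \<open>Extension by zero gives functions measurable on the whole space, to which the
      averaging inequality applies; on \<Omega> nothing changes.\<close>
    define g' where "g' k y = indicator \<Omega> y * g k y" for k y
    have [measurable]: "g' k \<in> borel_measurable M" for k
    proof -
      have "g k \<in> borel_measurable (restrict_space M \<Omega>)"
        using g by (simp add: hajlasz_gradients_def \<Omega>_def)
      then show ?thesis
        unfolding g'_def using borel_measurable_restrict_space_iff_ennreal[of \<Omega> M "g k"]
        by (simp add: mult.commute)
    qed
    define G where "G n y = (SUP j. ennreal (decay \<beta> (j - n)) * g' j y)" for n y
    have [measurable]: "G n \<in> borel_measurable M" for n unfolding G_def by measurable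
    \<comment> \<open>The candidate for the potential capacity: C collects the 32 \<kappa> of the
      telescoping and the c^3 of \<open>ball_avg_le_scale_potential\<close>, which also doubles the
      radius.\<close>
    define F where "F n y = ennreal C * ball_avg M (2 * 2 powi (- n)) (G n) y" for n y
    have F_borel: "F n \<in> borel_measurable borel" for n
      unfolding F_def by (intro borel_measurable_times_ennreal borel_measurable_const ball_avg_measurable_borel) measurable
    \<comment> \<open>Truncation does not increase differences, so g still bounds them, and it makes
      u nonnegative and equal to 1 on E.\<close>
    define u where "u y = max 0 (min 1 (\<phi> y))" for y
    have u: "continuous_on UNIV u" "\<And>y. 0 \<le> u y" "\<And>y z. \<bar>u y - u z\<bar> \<le> \<bar>\<phi> y - \<phi> z\<bar>"
      unfolding u_def using cont by (auto intro!: continuous_intros)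
    define L where "L = levels (UNIV :: 'a set)"
    \<comment> \<open>2^(-m) > 5 r lets the first ball about any x in E contain the ball of radius 4
      r at x0, hence the annulus. 2^(-m) \<le> 10 r keeps it within distance 11 r of x0, the origin
      of 11 \<le> \<Lambda>.\<close>
    obtain m :: int where m: "2 powi (- m) \<le> 10 * r" "10 * r < 2 * 2 powi (- m)"
      using dyadic_scale[of "10 * r"] r by auto
    have levels: "n \<in> L" if "m \<le> n" for n
    proof -
      have "(2::real) powi (- n) \<le> 2 powi (- m)" using that by (intro power_int_increasing) auto
      then have "ennreal (2 powi (- n)) \<le> ennreal (10 * r)" using m by (intro ennreal_leI) linarith
      also have "\<dots> \<le> 2 * ediam (UNIV :: 'a set)" by (rule r(3))
      finally show ?thesis by (simp add: L_def mem_levels_iff)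
    qed
    have "1 \<le> potential M \<beta> F x" if x: "x \<in> E" for x
    proof -
      have x0x: "dist x0 x \<le> r" using x E by auto
      have sub: "ball x (2 powi (- n)) \<subseteq> \<Omega>" if "m \<le> n" for n
      proof
        fix y assume "y \<in> ball x (2 powi (- n))"
        moreover have "(2::real) powi (- n) \<le> 2 powi (- m)" using that by (intro power_int_increasing) auto
        ultimately have "dist x0 y < 11 * r"
          using m x0x dist_triangle[of x0 y x] by simp
        also have "\<dots> \<le> \<Lambda> * r" using \<Lambda> r by (intro mult_right_mono) auto
        finally show "y \<in> \<Omega>" by (simp add: \<Omega>_def)
      qed
      define Z where "Z = ball x0 (4 * r) - ball x0 (2 * r)"
      have "vol x0 (2 * r) \<le> ennreal cR * vol x0 (4 * r)"
        using cR(3)[of "4 * r" x0] r by simp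
      note annulus = annulus_emeasure[OF cR(1,2) this r(1) x0x m(1), folded Z_def]
      obtain i :: nat where
        "1 \<le> (\<Sum>n\<in>{m..m + int i}. ennreal (32 * \<kappa> * 2 powr (- \<beta> * n)) * ball_avg M (2 powi (- n)) (G n) x)"
      proof (rule one_le_sum_ball_avg[where u = u and Z = Z and G = G and m = m and x = x and N = N and \<kappa> = \<kappa> and \<beta> = \<beta>])
        show "u x = 1" using \<phi>E[OF x] by (simp add: u_def)
        show "Z \<subseteq> ball x (2 powi (- m))"
        proof
          fix y assume "y \<in> Z"
          then show "y \<in> ball x (2 powi (- m))"
            using x0x m dist_triangle[of x y x0] by (simp add: Z_def dist_commute)
        qed
        show "u y = 0" if "y \<in> Z" for y
          using \<phi>0[of y] that by (simp add: u_def Z_def)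
        have "ennreal (c\<^sup>2 / (1 - cR)) * emeasure M Z \<le> ennreal \<kappa> * emeasure M Z"
          using \<kappa> by (intro mult_right_mono ennreal_leI) auto
        then show "vol x (2 powi (- m)) \<le> ennreal \<kappa> * emeasure M Z"
          using annulus(3) by (rule_tac order_trans)
        show "ennreal (u y) \<le> ennreal (u z) + ennreal (4 * 2 powr (- \<beta> * n)) * (G n y + G n z)"
          if "m \<le> n" "y \<in> ball x (2 powi (- n)) - N" "z \<in> ball x (2 powi (- n)) - N" for n y z
          unfolding G_def
        proof (rule hajlasz_pointwise_le[OF \<beta>])
          have yz: "y \<in> \<Omega> - N" "z \<in> \<Omega> - N" using that sub[OF that(1)] by auto
          show "dist y z < 2 * 2 powi (- n)"
            using that dist_triangle3[of y z x] by simp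
          fix k :: int assume k: "2 powi (- k - 1) \<le> dist y z" "dist y z < 2 powi (- k)"
          have "ennreal \<bar>u y - u z\<bar> \<le> ennreal \<bar>\<phi> y - \<phi> z\<bar>" using u(3) by (rule ennreal_leI)
          also have "\<dots> \<le> ennreal (dist y z powr \<beta>) * (g k y + g k z)"
            using grad[OF yz k] .
          finally show "ennreal \<bar>u y - u z\<bar> \<le> ennreal (dist y z powr \<beta>) * (g' k y + g' k z)"
            using yz by (simp add: g'_def)
        qed (use u in auto)
      qed (use u N \<kappa> annulus in \<open>auto simp: Z_def\<close>)
      also have "(\<Sum>n\<in>{m..m + int i}. ennreal (32 * \<kappa> * 2 powr (- \<beta> * n)) * ball_avg M (2 powi (- n)) (G n) x) \<le>
          (\<Sum>n\<in>{m..m + int i}. ennreal (2 powr (- \<beta> * n)) * scale_potential n (F n) x)"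
      proof (intro sum_mono)
        fix n
        have "ennreal (32 * \<kappa> * 2 powr (- \<beta> * n)) * ball_avg M (2 powi (- n)) (G n) x \<le>
            ennreal (32 * \<kappa> * 2 powr (- \<beta> * n)) *
              (ennreal (c ^ 3) * scale_potential n (ball_avg M (2 * 2 powi (- n)) (G n)) x)"
          by (intro mult_left_mono ball_avg_le_scale_potential) auto
        also have "\<dots> = ennreal (2 powr (- \<beta> * n)) *
            (ennreal C * scale_potential n (ball_avg M (2 * 2 powi (- n)) (G n)) x)"
          using \<kappa>0 c_gt_1 by (simp add: C_def ennreal_mult mult_ac)
        also have "ennreal C * scale_potential n (ball_avg M (2 * 2 powi (- n)) (G n)) x = scale_potential n (F n) x"
        proof -
          have [measurable]: "(\<lambda>y. indicator (ball y (2 powi (- n))) x :: ennreal) \<in> borel_measurable M"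
          proof -
            have "(\<lambda>y. indicator (ball y (2 powi (- n))) x :: ennreal) = indicator (ball x (2 powi (- n)))"
              by (auto simp: indicator_def fun_eq_iff dist_commute)
            then show ?thesis by simp
          qed
          show ?thesis
            unfolding F_def by (subst nn_integral_cmult[symmetric]) (auto simp: mult_ac intro!: nn_integral_cong)
        qed
        finally show "ennreal (32 * \<kappa> * 2 powr (- \<beta> * n)) * ball_avg M (2 powi (- n)) (G n) x \<le>
            ennreal (2 powr (- \<beta> * n)) * scale_potential n (F n) x" .
      qed
      also have "\<dots> \<le> potential M \<beta> F x"
        unfolding potential_def L_def[symmetric] by (intro sum_le_infsum_ennreal) (auto intro: levels)
      finally show ?thesis .
    qed
    then have "potential_capacity M \<beta> p q E \<le> ennpowr (mixed_norm M UNIV L p q F) p"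
      unfolding potential_capacity_def L_def using F_borel by (intro INF_lower) auto
    also have "\<dots> = (\<integral>\<^sup>+x. ennpowr (lq_norm L q (\<lambda>n. F n x)) p \<partial>M)"
      using p by (subst ennpowr_mixed_norm) auto
    also have "\<dots> \<le> (\<integral>\<^sup>+x. ennreal (C powr p) *
        ennpowr (lq_norm UNIV q (\<lambda>n. ball_avg M (2 * 2 powi (- n)) (G n) x)) p \<partial>M)"
    proof (intro nn_integral_mono)
      fix x
      have "lq_norm L q (\<lambda>n. F n x) \<le> lq_norm UNIV q (\<lambda>n. F n x)"
        by (intro lq_norm_mono_set q) auto
      also have "\<dots> = ennreal C * lq_norm UNIV q (\<lambda>n. ball_avg M (2 * 2 powi (- n)) (G n) x)"
        unfolding F_def by (rule lq_norm_cmult[OF q])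
      finally have "ennpowr (lq_norm L q (\<lambda>n. F n x)) p \<le>
          ennpowr (ennreal C * lq_norm UNIV q (\<lambda>n. ball_avg M (2 * 2 powi (- n)) (G n) x)) p"
        using p by (rule_tac ennpowr_mono) auto
      then show "ennpowr (lq_norm L q (\<lambda>n. F n x)) p \<le> ennreal (C powr p) *
          ennpowr (lq_norm UNIV q (\<lambda>n. ball_avg M (2 * 2 powi (- n)) (G n) x)) p"
        using C by (simp add: ennpowr_mult ennpowr_ennreal)
    qed
    also have "\<dots> = ennreal (C powr p) *
        lpq p q (\<lambda>n. ball_avg M (2 * 2 powi (- n)) (G n))"
      by (intro nn_integral_cmult borel_measurable_ennpowr borel_measurable_lq_norm_UNIV q) measurable
    also have "\<dots> \<le> ennreal (C powr p) * (ennreal K2 * lpq p q G)"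
      by (intro mult_left_mono K2) auto
    also have "lpq p q G \<le>
        (\<integral>\<^sup>+x. ennreal (K1 powr p) * ennpowr (lq_norm UNIV q (\<lambda>k. g' k x)) p \<partial>M)"
    proof (intro nn_integral_mono)
      fix x
      have "ennpowr (lq_norm UNIV q (\<lambda>n. G n x)) p \<le> ennpowr (ennreal K1 * lq_norm UNIV q (\<lambda>k. g' k x)) p"
        unfolding G_def using p K1 by (rule_tac ennpowr_mono) auto
      then show "ennpowr (lq_norm UNIV q (\<lambda>n. G n x)) p \<le> ennreal (K1 powr p) * ennpowr (lq_norm UNIV q (\<lambda>k. g' k x)) p"
        using K1(1) by (simp add: ennpowr_mult ennpowr_ennreal)
    qed
    also have "\<dots> = ennreal (K1 powr p) * lpq p q g'"
      by (intro nn_integral_cmult borel_measurable_ennpowr borel_measurable_lq_norm_UNIV q) measurable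
    also have "lpq p q g' =
        (\<integral>\<^sup>+x. ennpowr (lq_norm UNIV q (\<lambda>k. g k x)) p * indicator \<Omega> x \<partial>M)"
    proof (intro nn_integral_cong)
      fix x
      have "lq_norm UNIV q (\<lambda>k. g' k x) = indicator \<Omega> x * lq_norm UNIV q (\<lambda>k. g k x)"
        unfolding g'_def by (rule lq_norm_cmult[OF q])
      then show "ennpowr (lq_norm UNIV q (\<lambda>k. g' k x)) p = ennpowr (lq_norm UNIV q (\<lambda>k. g k x)) p * indicator \<Omega> x"
        by (simp add: indicator_def)
    qed
    also have "\<dots> = ennpowr (mixed_norm M \<Omega> UNIV p q g) p"
      using p by (intro ennpowr_mixed_norm[symmetric]) auto
    finally have "potential_capacity M \<beta> p q E \<le> ennreal (C powr p) *
        (ennreal K2 * (ennreal (K1 powr p) * ennpowr (mixed_norm M \<Omega> UNIV p q g) p))"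
      by (simp add: mult_left_mono)
    then show "potential_capacity M \<beta> p q E \<le> ennreal K * ennpowr (mixed_norm M (ball x0 (\<Lambda> * r)) UNIV p q g) p"
      using K2(1) by (simp add: K_def \<Omega>_def ennreal_mult mult.assoc)
  qed
qed

section \<open>Passage to the infima and conclusion\<close>

lemma inverse_potential_capacity_le_relative_capacity:
  assumes p: "0 < p" and K: "0 < K"
    and le: "\<And>\<phi> g. continuous_on UNIV \<phi> \<Longrightarrow> (\<And>x. x \<in> E \<Longrightarrow> 1 \<le> \<phi> x) \<Longrightarrow> (\<And>x. x \<notin> U \<Longrightarrow> \<phi> x = 0) \<Longrightarrow>
      g \<in> hajlasz_gradients M \<beta> \<Omega> \<phi> \<Longrightarrow> T \<le> ennreal K * ennpowr (mixed_norm M \<Omega> UNIV p q g) p"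
  shows "ennreal (inverse K) * T \<le> relative_capacity M \<beta> p q E U \<Omega>"
  unfolding relative_capacity_def
proof (rule INF_greatest)
  fix \<phi> :: "'a \<Rightarrow> real"
  assume \<phi>: "\<phi> \<in> {\<phi>. continuous_on UNIV \<phi> \<and> (\<forall>x\<in>E. 1 \<le> \<phi> x) \<and> (\<forall>x\<in>- U. \<phi> x = 0)}"
  \<comment> \<open>The p-th power stands outside the infimum over gradients, so the p-th root is
    taken before passing to that infimum and undone afterwards.\<close>
  have "ennpowr (ennreal (inverse K) * T) (1 / p) \<le> hajlasz_seminorm M \<beta> p q \<Omega> \<phi>"
    unfolding hajlasz_seminorm_def
  proof (rule INF_greatest)
    fix g assume "g \<in> hajlasz_gradients M \<beta> \<Omega> \<phi>"
    then have "T \<le> ennreal K * ennpowr (mixed_norm M \<Omega> UNIV p q g) p"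
      using \<phi> by (intro le) auto
    then have "ennreal (inverse K) * T \<le> ennreal (inverse K) * (ennreal K * ennpowr (mixed_norm M \<Omega> UNIV p q g) p)"
      by (intro mult_left_mono) auto
    then have "ennreal (inverse K) * T \<le> ennpowr (mixed_norm M \<Omega> UNIV p q g) p"
      by (simp add: ennreal_cancel_factor[OF K])
    then have "ennpowr (ennreal (inverse K) * T) (1 / p) \<le> ennpowr (ennpowr (mixed_norm M \<Omega> UNIV p q g) p) (1 / p)"
      using p by (rule_tac ennpowr_mono) auto
    then show "ennpowr (ennreal (inverse K) * T) (1 / p) \<le> mixed_norm M \<Omega> UNIV p q g"
      using p by simp
  qed
  then have "ennpowr (ennpowr (ennreal (inverse K) * T) (1 / p)) p \<le> ennpowr (hajlasz_seminorm M \<beta> p q \<Omega> \<phi>) p"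
    using p by (rule_tac ennpowr_mono) auto
  then show "ennreal (inverse K) * T \<le> ennpowr (hajlasz_seminorm M \<beta> p q \<Omega> \<phi>) p"
    using p by simp
qed

lemma relative_capacity_le_potential_capacity:
  assumes K: "0 < K" and p: "0 < p"
    and le: "\<And>f. (\<And>n. n \<in> levels (UNIV :: 'a set) \<Longrightarrow> f n \<in> borel_measurable borel) \<Longrightarrow>
      (\<And>x. x \<in> E \<Longrightarrow> 1 \<le> potential M \<beta> f x) \<Longrightarrow>
      R \<le> ennreal K * (\<integral>\<^sup>+x. ennpowr (lq_norm (levels (UNIV :: 'a set)) q (\<lambda>n. f n x)) p \<partial>M)"
  shows "R \<le> ennreal K * potential_capacity M \<beta> p q E"
proof (rule ennreal_le_mult_swap[OF K])
  show "ennreal (inverse K) * R \<le> potential_capacity M \<beta> p q E"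
    unfolding potential_capacity_def
  proof (rule INF_greatest)
    fix f assume "f \<in> {f. (\<forall>n\<in>levels (UNIV :: 'a set). f n \<in> borel_measurable borel) \<and> (\<forall>x\<in>E. 1 \<le> potential M \<beta> f x)}"
    then have "R \<le> ennreal K * ennpowr (mixed_norm M UNIV (levels (UNIV :: 'a set)) p q f) p"
      using p le[of f] by (subst ennpowr_mixed_norm) auto
    then have "ennreal (inverse K) * R \<le>
        ennreal (inverse K) * (ennreal K * ennpowr (mixed_norm M UNIV (levels (UNIV :: 'a set)) p q f) p)"
      by (intro mult_left_mono) auto
    then show "ennreal (inverse K) * R \<le> ennpowr (mixed_norm M UNIV (levels (UNIV :: 'a set)) p q f) p"
      by (simp add: ennreal_cancel_factor[OF K])
  qed
qed

end

theorem theorem1p1: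
  fixes M :: "'a::metric_space measure" and p \<beta> \<Lambda> \<sigma> :: real and q :: ennreal
  assumes "metric_measure_space M"
    and "1 < p" and "1 < q" and "0 < \<beta>" and "\<beta> < 1" and "41 \<le> \<Lambda>"
    and "doubling M" and "reverse_doubling M"
    and "\<beta> * p < \<sigma>" and "quantitative_reverse_doubling M \<sigma>"
  shows "\<exists>C\<ge>1::real. \<forall>(x::'a) r E.
           0 < r \<and> ennreal r < ediam (UNIV :: 'a set) / 80 \<and>
           compact E \<and> E \<subseteq> closure (ball x r) \<longrightarrow>
             ennreal (inverse C) * potential_capacity M \<beta> p q E
               \<le> relative_capacity M \<beta> p q E (ball x (2 * r)) (ball x (\<Lambda> * r)) \<and>
             relative_capacity M \<beta> p q E (ball x (2 * r)) (ball x (\<Lambda> * r))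
               \<le> ennreal C * potential_capacity M \<beta> p q E"
proof -
  obtain c :: real where c: "1 < c"
    "\<And>x r. 0 < r \<Longrightarrow> emeasure M (ball x (2 * r)) \<le> ennreal c * emeasure M (ball x r)"
    using \<open>doubling M\<close> unfolding doubling_def by blast
  interpret metric_measure_space M by fact
  interpret doubling_space M c
    by unfold_locales (use c in auto)
  have \<Lambda>: "11 \<le> \<Lambda>" using assms by simp
  obtain K1 :: real where K1: "0 < K1"
    "\<And>x0 r E \<phi> g. 0 < r \<Longrightarrow> ennreal (4 * r) < ediam (UNIV :: 'a set) / 2 \<Longrightarrow>
      ennreal (10 * r) \<le> 2 * ediam (UNIV :: 'a set) \<Longrightarrow> E \<subseteq> cball x0 r \<Longrightarrow>
      continuous_on UNIV \<phi> \<Longrightarrow> (\<And>x. x \<in> E \<Longrightarrow> 1 \<le> \<phi> x) \<Longrightarrow> (\<And>x. x \<notin> ball x0 (2 * r) \<Longrightarrow> \<phi> x = 0) \<Longrightarrow>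
      g \<in> hajlasz_gradients M \<beta> (ball x0 (\<Lambda> * r)) \<phi> \<Longrightarrow>
      potential_capacity M \<beta> p q E \<le> ennreal K1 * ennpowr (mixed_norm M (ball x0 (\<Lambda> * r)) UNIV p q g) p"
    using potential_capacity_le_gradient[OF assms(2-5) \<Lambda> assms(8)] by blast
  obtain K2 :: real where K2: "0 < K2"
    "\<And>f x0 r E \<Omega>. 0 < r \<Longrightarrow> compact E \<Longrightarrow> E \<subseteq> cball x0 r \<Longrightarrow> \<Omega> \<in> sets M \<Longrightarrow>
      (\<And>n. n \<in> levels (UNIV :: 'a set) \<Longrightarrow> f n \<in> borel_measurable borel) \<Longrightarrow>
      (\<And>x. x \<in> E \<Longrightarrow> 1 \<le> potential M \<beta> f x) \<Longrightarrow>
      relative_capacity M \<beta> p q E (ball x0 (2 * r)) \<Omega> \<le>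
        ennreal K2 * (\<integral>\<^sup>+x. ennpowr (lq_norm (levels (UNIV :: 'a set)) q (\<lambda>n. f n x)) p \<partial>M)"
    using relative_capacity_le_potential[of p q \<beta> \<sigma>] assms by blast
  define C where "C = max 1 (max K1 K2)"
  have C: "1 \<le> C" "K1 \<le> C" "K2 \<le> C" by (auto simp: C_def)
  have "ennreal (inverse C) * potential_capacity M \<beta> p q E \<le> relative_capacity M \<beta> p q E (ball x (2 * r)) (ball x (\<Lambda> * r)) \<and>
      relative_capacity M \<beta> p q E (ball x (2 * r)) (ball x (\<Lambda> * r)) \<le> ennreal C * potential_capacity M \<beta> p q E"
    if r: "0 < r" "ennreal r < ediam (UNIV :: 'a set) / 80" and E: "compact E" "E \<subseteq> closure (ball x r)"
    for x :: 'a and r E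
  proof
    \<comment> \<open>In a metric space \<open>cball x r\<close> can be larger than the closure of
      the ball; the estimates above are for subsets of \<open>cball x r\<close>.\<close>
    have E': "E \<subseteq> cball x r"
      using E(2) closure_minimal[of "ball x r" "cball x r"] by auto
    have diam: "ennreal (80 * r) < ediam (UNIV :: 'a set)"
    proof -
      have "80 * ennreal r < 80 * (ediam (UNIV :: 'a set) / 80)"
        using r by (intro ennreal_mult_strict_left_mono) auto
      also have "80 * (ediam (UNIV :: 'a set) / 80) = ediam (UNIV :: 'a set)"
        by (simp add: ennreal_times_divide ennreal_mult_divide_eq mult.commute)
      finally show ?thesis using r by (simp add: ennreal_mult)
    qed
    \<comment> \<open>The range in which reverse doubling applies to the ball of radius 4 r. The
      bound on 10 r below places the first scale of the telescoping among the admissible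
      ones.\<close>
    have small: "ennreal (4 * r) < ediam (UNIV :: 'a set) / 2"
    proof -
      have "ennreal (4 * r) = ennreal (8 * r) / 2"
        using r by (simp add: ennreal_divide_numeral)
      also have "\<dots> < ediam (UNIV :: 'a set) / 2"
      proof -
        have "ennreal (8 * r) \<le> ennreal (80 * r)" using r by (intro ennreal_leI) auto
        then have "ennreal (8 * r) < ediam (UNIV :: 'a set)" using diam by (rule le_less_trans)
        then show ?thesis
          by (subst divide_less_ennreal) (auto simp: ennreal_divide_times ennreal_times_divide ennreal_mult_divide_eq)
      qed
      finally show ?thesis .
    qed
    have large: "ennreal (10 * r) \<le> 2 * ediam (UNIV :: 'a set)"
    proof -
      have "ennreal (10 * r) \<le> ennreal (80 * r)" using r by (intro ennreal_leI) auto
      also have "\<dots> \<le> ediam (UNIV :: 'a set)" using diam by simp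
      also have "\<dots> \<le> 2 * ediam (UNIV :: 'a set)" by (simp add: mult_2)
      finally show ?thesis .
    qed
    have "ennreal (inverse C) * potential_capacity M \<beta> p q E \<le> ennreal (inverse K1) * potential_capacity M \<beta> p q E"
      using K1(1) C by (intro mult_right_mono ennreal_leI le_imp_inverse_le) auto
    also have "\<dots> \<le> relative_capacity M \<beta> p q E (ball x (2 * r)) (ball x (\<Lambda> * r))"
      using assms r small large E' K1(1)
      by (intro inverse_potential_capacity_le_relative_capacity K1(2)) auto
    finally show "ennreal (inverse C) * potential_capacity M \<beta> p q E \<le>
        relative_capacity M \<beta> p q E (ball x (2 * r)) (ball x (\<Lambda> * r))" .
    have "relative_capacity M \<beta> p q E (ball x (2 * r)) (ball x (\<Lambda> * r)) \<le> ennreal K2 * potential_capacity M \<beta> p q E"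
      using assms r E E' K2(1)
      by (intro relative_capacity_le_potential_capacity K2(2)) auto
    also have "\<dots> \<le> ennreal C * potential_capacity M \<beta> p q E"
      using C by (intro mult_right_mono ennreal_leI) auto
    finally show "relative_capacity M \<beta> p q E (ball x (2 * r)) (ball x (\<Lambda> * r)) \<le> ennreal C * potential_capacity M \<beta> p q E" .
  qed
  with C(1) show ?thesis by blast
qed

end
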